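(* Let $H$ be a bialgebra with a family $\{\mathcal R^{(c)}\}_{c\in C}$ of co-quasi-triangular structures, let $n\in\mathbb Z_{>1}$, let $\mathbf c:\{(i,j):1\le i<j\le n\}\to C$ be transitive, and let $\bullet_{\mathbf c}$ be the multiplication on $H^{\otimes n}$ twisted by $\mathcal J_{\mathbf c}$. For $c\in C$ let $\Psi^{(c)}\in\operatorname{End}_\Bbbk(H\otimes H)$ be $$\Psi^{(c)}(h\otimes h')=(\mathcal R^{(c)})^{*-1}(h_{(1)},h'_{(1)})\,\mathcal R^{(c)}(h_{(3)},h'_{(3)})\,h'_{(2)}\otimes h_{(2)}.$$ Then for all $\mathbf h,\mathbf h'\in H^{\otimes n}$ $$\mathbf h\bullet_{\mathbf c}\mathbf h'=m_H^{\otimes n}\circ\Big(\overleftarrow{\prod_{1\le i\le n-1}}\ \overrightarrow{\prod_{i+1\le j\le n}}\ \mathrm{id}_H^{\otimes(i+j-2)}\otimes\Psi^{(\mathbf c(i,j))}\otimes\mathrm{id}_H^{\otimes(2n-i-j)}\Big)(\mathbf h\otimes\mathbf h').$$ Explicitly, if $\mathbf h=a^1\otimes\cdots\otimes a^n$ and $\mathbf h'=b^1\otimes\cdots\otimes b^n$ with $a^i,b^i\in H$, then $$\mathbf h\bullet_{\mathbf c}\mathbf h'=\prod_{1\le j<i\le n}(\mathcal R^{(\mathbf c(j,i))})^{*-1}\big(a^i_{(j)},b^j_{(n+1-i)}\big)\,\mathcal R^{(\mathbf c(j,i))}\big(a^i_{(2i-j)},b^j_{(n+i+1-2j)}\big)\;a^1_{(1)}b^1_{(n)}\otimes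 a^2_{(2)}b^2_{(n-1)}\otimes\cdots\otimes a^n_{(n)}b^n_{(1)}.$$ In particular, if all the $\mathcal R^{(c)}$, $c\in C$, are counital, i.e. $\mathcal R^{(c)}(a,1)=\varepsilon(a)=\mathcal R^{(c)}(1,a)$ for all $a\in H$, then for all $h,h'\in H$ and $k,l\in\{1,\dots,n\}$ $$(1^{\otimes(l-1)}\otimes h\otimes1^{\otimes(n-l)})\bullet_{\mathbf c}(1^{\otimes(k-1)}\otimes h'\otimes1^{\otimes(n-k)})=\begin{cases}(hh')_k,&k=l,\\(h\otimes h')_{l,k},&k>l,\\(\Psi^{(\mathbf c(k,l))}(h\otimes h'))_{k,l},&k<l.\end{cases}$$
   Context: $\Bbbk$ is a field of characteristic zero; Sweedler notation with iterated comultiplication is used. Here $m_H^{\otimes n}:H^{\otimes2n}\to H^{\otimes n}$ multiplies positions $2s-1$ and $2s$ for $s=1,\dots,n$. $\overrightarrow{\prod}$ (resp. $\overleftarrow{\prod}$) is the product, here composition of maps, written from left to right in increasing (resp. decreasing) order of the index. For $X\in H^{\otimes r}$ and distinct $i_1,\dots,i_r$, $X_{i_1,\dots,i_r}\in H^{\otimes n}$ has the $s$-th factor of $X$ in position $i_s$ and $1$ elsewhere. For a coalgebra $D$, the convolution on $\operatorname{Hom}_\Bbbk(D,\Bbbk)$ is $(f*g)(d)=f(d_{(1)})g(d_{(2)})$ with unit $\varepsilon$, and $f^{*-1}$ is the convolution inverse; tensor powers $H^{\otimes N}$ carry the standard bialgebra structure. For $f\in\operatorname{Hom}_\Bbbk(H^{\otimes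 r},\Bbbk)$ and distinct $i_1,\dots,i_r$, $f_{i_1,\dots,i_r}(h_1\otimes\cdots\otimes h_N)=f(h_{i_1}\otimes\cdots\otimes h_{i_r})\prod_{j\notin\{i_1,\dots,i_r\}}\varepsilon(h_j)$. A co-quasi-triangular structure on $H$ is a $*$-invertible $\mathcal R\in\operatorname{Hom}_\Bbbk(H\otimes H,\Bbbk)$ with $\mathcal R(a_{(1)},a'_{(1)})a_{(2)}a'_{(2)}=\mathcal R(a_{(2)},a'_{(2)})a'_{(1)}a_{(1)}$, $\mathcal R\circ(m_H\otimes\mathrm{id})=\mathcal R_{1,3}*\mathcal R_{2,3}$ and $\mathcal R\circ(\mathrm{id}\otimes m_H)=\mathcal R_{1,3}*\mathcal R_{1,2}$. $\mathcal J_{\mathbf c}\in\operatorname{Hom}_\Bbbk(H^{\otimes n}\otimes H^{\otimes n},\Bbbk)$ is the convolution product, over $i=2,\dots,n$ in increasing order and for each $i$ over $j=i-1,\dots,1$ in decreasing order, of $\mathcal R^{(\mathbf c(j,i))}_{i,n+j}$. The twisted multiplication is $\mathbf h\bullet_{\mathbf c}\mathbf h'=\mathcal J_{\mathbf c}^{*-1}(\mathbf h_{(1)},\mathbf h'_{(1)})\,\mathcal J_{\mathbf c}(\mathbf h_{(3)},\mathbf h'_{(3)})\,\mathbf h_{(2)}\mathbf h'_{(2)}$, with the standard coproduct and product of $H^{\otimes n}$ on the right. $\mathbf c$ is transitive if $\mathbf c(i,k)\in\{\mathbf c(i,j),\mathbf c(j,k)\}$ for all $1\le i<j<k\le n$.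 *)

theory Defs
  imports Complex_Main "HOL-Library.FuncSet" "HOL-Library.Function_Algebras"
begin

text \<open>
  Tensors over the vector space \<open>'h\<close> are realised as elements of a dual space. Let \<open>M\<close> be the
  space of all \<open>f :: 'h list \<Rightarrow> 'k\<close> whose restriction to lists of length \<open>n\<close> is \<open>n\<close>-linear, for
  every \<open>n\<close>. The pure tensor \<open>h\<^sub>1 \<otimes> \<dots> \<otimes> h\<^sub>n\<close> is evaluation of such \<open>f\<close> at \<open>[h\<^sub>1, \<dots>, h\<^sub>n]\<close>, and the
  tensor power of degree \<open>n\<close> is the span of the pure tensors of length \<open>n\<close>. Over a field this is
  the usual tensor power: see \<open>tensor_power_universal\<close> and \<open>tensor_power_unique\<close> below.
  The identifications \<open>H = H\<^sup>\<otimes>\<^sup>1\<close> (\<open>h \<mapsto> pure [h]\<close>) and \<open>H\<^sup>\<otimes>\<^sup>m \<otimes> H\<^sup>\<otimes>\<^sup>n = H\<^sup>\<otimes>\<^sup>(\<^sup>m\<^sup>+\<^sup>n\<^sup>)\<close> are used throughout.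
  Linear maps on a tensor power are functions of which only the values there matter.
\<close>

type_synonym ('k, 'h) tensor = "('h list \<Rightarrow> 'k) \<Rightarrow> 'k"

text \<open>The unital ring structure of a bialgebra comes from the type class of \<open>'h\<close>.\<close>

record ('k, 'h) bialgebra_data =
  scl :: "'k \<Rightarrow> 'h \<Rightarrow> 'h"
  comul :: "'h \<Rightarrow> ('k, 'h) tensor"
  counit :: "'h \<Rightarrow> 'k"

definition multilinear ::
  "('k \<Rightarrow> 'h::ab_group_add \<Rightarrow> 'h) \<Rightarrow> ('k \<Rightarrow> 'v::ab_group_add \<Rightarrow> 'v) \<Rightarrow> nat \<Rightarrow> ('h list \<Rightarrow> 'v) \<Rightarrow> bool"
where
  "multilinear s t n f \<longleftrightarrow>
     (\<forall>hs i. length hs = n \<longrightarrow> i < n \<longrightarrow>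
        (\<forall>x y. f (hs[i := x + y]) = f (hs[i := x]) + f (hs[i := y])) \<and>
        (\<forall>c x. f (hs[i := s c x]) = t c (f (hs[i := x]))))"

definition tscale :: "'k::field \<Rightarrow> ('k, 'h) tensor \<Rightarrow> ('k, 'h) tensor" where
  "tscale c x = (\<lambda>f. c * x f)"

definition pure :: "('k::field, 'h::ring_1) bialgebra_data \<Rightarrow> 'h list \<Rightarrow> ('k, 'h) tensor" where
  "pure B hs = (\<lambda>f. if \<forall>n. multilinear (scl B) (*) n f then f hs else 0)"

definition tensor_power ::
  "('k::field, 'h::ring_1) bialgebra_data \<Rightarrow> nat \<Rightarrow> ('k, 'h) tensor set" where
  "tensor_power B n = module.span tscale (pure B ` {hs. length hs = n})"

definition linear_on_power ::
  "('k::field, 'h::ring_1) bialgebra_data \<Rightarrow> nat \<Rightarrow> ('k \<Rightarrow> 'v::ab_group_add \<Rightarrow> 'v) \<Rightarrow>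
     (('k, 'h) tensor \<Rightarrow> 'v) \<Rightarrow> bool" where
  "linear_on_power B n t L \<longleftrightarrow>
     (\<forall>x\<in>tensor_power B n. \<forall>y\<in>tensor_power B n. L (x + y) = L x + L y) \<and>
     (\<forall>c. \<forall>x\<in>tensor_power B n. L (tscale c x) = t c (L x))"

text \<open>
  \<open>tlift n G\<close> and \<open>slift n g\<close> are the linear maps on the tensor power of degree \<open>n\<close> induced by
  an \<open>n\<close>-linear tensor-valued map \<open>G\<close>, resp. an \<open>n\<close>-linear form \<open>g\<close> (see \<open>tlift_pure\<close> and \<open>slift_pure\<close>).
\<close>

definition tlift ::
  "nat \<Rightarrow> ('h list \<Rightarrow> ('k::field, 'h) tensor) \<Rightarrow> ('k, 'h) tensor \<Rightarrow> ('k, 'h) tensor" where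
  "tlift n G x = (\<lambda>f. x (\<lambda>hs. if length hs = n then G hs f else 0))"

definition slift :: "nat \<Rightarrow> ('h list \<Rightarrow> 'k::field) \<Rightarrow> ('k, 'h) tensor \<Rightarrow> 'k" where
  "slift n g x = x (\<lambda>hs. if length hs = n then g hs else 0)"

definition tprod ::
  "('k::field, 'h::ring_1) bialgebra_data \<Rightarrow> ('k, 'h) tensor \<Rightarrow> ('k, 'h) tensor \<Rightarrow> ('k, 'h) tensor" where
  "tprod B x y = (\<lambda>f. if \<forall>n. multilinear (scl B) (*) n f then x (\<lambda>xs. y (\<lambda>ys. f (xs @ ys))) else 0)"

lemma vector_space_tscale: "vector_space (tscale :: 'k::field \<Rightarrow> ('k, 'h) tensor \<Rightarrow> _)"
  by unfold_locales (auto simp: tscale_def fun_eq_iff algebra_simps)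

lemma multilinear_restrict:
  assumes "multilinear s (*) n (g :: 'h::ab_group_add list \<Rightarrow> 'k::field)"
  shows "multilinear s (*) m (\<lambda>hs. if length hs = n then g hs else 0)"
  using assms unfolding multilinear_def by simp

lemma slift_pure:
  assumes "multilinear (scl B) (*) n g" "length hs = n"
  shows "slift n g (pure B hs) = g hs"
  using multilinear_restrict[OF assms(1)] assms(2) by (simp add: slift_def pure_def)

lemma tlift_pure:
  assumes "multilinear (scl B) tscale n G" "length hs = n"
  shows "tlift n G (pure B hs) = G hs"
proof
  fix f
  have "multilinear (scl B) (*) n (\<lambda>hs. G hs f)"
    using assms(1) by (simp add: multilinear_def tscale_def)
  from slift_pure[OF this assms(2)] show "tlift n G (pure B hs) f = G hs f"
    by (simp add: slift_def tlift_def)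
qed

lemma slift_linear: "slift n g (x + y) = slift n g x + slift n g y" "slift n g (tscale c x) = c * slift n g x"
  by (simp_all add: slift_def tscale_def)

lemma tlift_linear: "tlift n G (x + y) = tlift n G x + tlift n G y" "tlift n G (tscale c x) = tscale c (tlift n G x)"
  by (simp_all add: tlift_def tscale_def fun_eq_iff)

lemma multilinear_append:
  fixes f :: "'h::ab_group_add list \<Rightarrow> 'k::field"
  assumes "\<forall>n. multilinear s (*) n f"
  shows "multilinear s (*) n (\<lambda>ys. f (xs @ ys))" "multilinear s (*) n (\<lambda>xs. f (xs @ ys))"
proof -
  have *: "multilinear s (*) (length xs + n) f" for xs :: "'h list" using assms by blast
  show "multilinear s (*) n (\<lambda>ys. f (xs @ ys))"
    unfolding multilinear_def
  proof (intro allI impI)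
    fix hs :: "'h list" and i assume "length hs = n" "i < n"
    then show "(\<forall>x y. f (xs @ hs[i := x + y]) = f (xs @ hs[i := x]) + f (xs @ hs[i := y])) \<and>
        (\<forall>c x. f (xs @ hs[i := s c x]) = c * f (xs @ hs[i := x]))"
      using *[of xs, unfolded multilinear_def, rule_format, of "xs @ hs" "length xs + i"]
      by (simp add: list_update_append)
  qed
  show "multilinear s (*) n (\<lambda>xs. f (xs @ ys))"
    unfolding multilinear_def
  proof (intro allI impI)
    fix hs :: "'h list" and i assume "length hs = n" "i < n"
    then show "(\<forall>x y. f (hs[i := x + y] @ ys) = f (hs[i := x] @ ys) + f (hs[i := y] @ ys)) \<and>
        (\<forall>c x. f (hs[i := s c x] @ ys) = c * f (hs[i := x] @ ys))"
      using *[of ys, unfolded multilinear_def, rule_format, of "hs @ ys" i]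
      by (simp add: list_update_append)
  qed
qed

lemma tprod_pure: "tprod B (pure B xs) (pure B ys) = pure B (xs @ ys)"
proof
  fix f
  show "tprod B (pure B xs) (pure B ys) f = pure B (xs @ ys) f"
  proof (cases "\<forall>n. multilinear (scl B) (*) n f")
    case True
    then show ?thesis
      using multilinear_append[OF True] by (simp add: tprod_def pure_def)
  qed (auto simp: tprod_def pure_def)
qed

text \<open>
  Universal property of the tensor power, for arbitrary target spaces \<open>V\<close>.
\<close>

lemma pure_multilinear:
  fixes B :: "('k::field, 'h::ring_1) bialgebra_data"
  shows "multilinear (scl B) tscale n (pure B)"
  unfolding multilinear_def pure_def tscale_def fun_eq_iff by auto

lemma tensor_power_unique:
  fixes t :: "'k::field \<Rightarrow> 'v::ab_group_add \<Rightarrow> 'v" and B :: "('k, 'h::ring_1) bialgebra_data"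
  assumes "vector_space t" "linear_on_power B n t L" "linear_on_power B n t L'"
    and "\<And>hs. length hs = n \<Longrightarrow> L (pure B hs) = L' (pure B hs)" and "x \<in> tensor_power B n"
  shows "L x = L' x"
proof -
  interpret T: vector_space "tscale :: 'k \<Rightarrow> ('k, 'h) tensor \<Rightarrow> _" by (rule vector_space_tscale)
  interpret V: vector_space t by fact
  let ?S = "T.span (pure B ` {hs. length hs = n})"
  note L = assms(2)[unfolded linear_on_power_def tensor_power_def]
    and L' = assms(3)[unfolded linear_on_power_def tensor_power_def]
  note L_add = L[THEN conjunct1, rule_format] and L_scale = L[THEN conjunct2, rule_format]
    and L'_add = L'[THEN conjunct1, rule_format] and L'_scale = L'[THEN conjunct2, rule_format]
  have z: "L 0 = 0 \<and> L' 0 = 0"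
  proof -
    have "tscale 0 0 = (0 :: ('k, 'h) tensor)" by (rule T.scale_zero_left)
    moreover have "L (tscale 0 0) = t 0 (L 0)" "L' (tscale 0 0) = t 0 (L' 0)"
      by (rule L_scale L'_scale, rule T.span_zero)+
    ultimately show ?thesis by (simp only: V.scale_zero_left)
  qed
  have eq0: "L 0 = L' 0" by (rule trans[OF conjunct1[OF z] conjunct2[OF z, symmetric]])
  have "x \<in> ?S" using assms(5) by (simp add: tensor_power_def)
  then have "x \<in> ?S \<and> L x = L' x"
  proof (induction rule: T.span_induct_alt)
    case base
    show ?case by (rule conjI[OF T.span_zero eq0])
  next
    case (step c x y)
    from step obtain hs where hs: "x = pure B hs" "length hs = n" by blast
    have x: "x \<in> ?S" using step(1) by (rule T.span_base)
    have cx: "tscale c x \<in> ?S" using x by (rule T.span_scale)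
    note y = conjunct1[OF step(2)]
    have eq: "L x = L' x" unfolding hs(1) by (rule assms(4)) fact
    have "L (tscale c x + y) = t c (L x) + L y"
      by (simp only: L_add[OF cx y] L_scale[OF x])
    also have "\<dots> = L' (tscale c x + y)"
      by (simp only: L'_add[OF cx y] L'_scale[OF x] eq conjunct2[OF step(2)])
    finally have "L (tscale c x + y) = L' (tscale c x + y)" .
    with T.span_add[OF cx conjunct1[OF step(2)]] show ?case by (rule conjI)
  qed
  then show ?thesis by blast
qed

lemma tensor_power_universal:
  fixes t :: "'k::field \<Rightarrow> 'v::ab_group_add \<Rightarrow> 'v" and B :: "('k, 'h::ring_1) bialgebra_data"
  assumes "vector_space t" "multilinear (scl B) t n G"
  shows "\<exists>L. linear_on_power B n t L \<and> (\<forall>hs. length hs = n \<longrightarrow> L (pure B hs) = G hs)"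
proof -
  interpret T: vector_space "tscale :: 'k \<Rightarrow> ('k, 'h) tensor \<Rightarrow> _" by (rule vector_space_tscale)
  interpret V: vector_space t by fact
  interpret K: vector_space "(*) :: 'k \<Rightarrow> 'k \<Rightarrow> 'k" by unfold_locales (auto simp: algebra_simps)
  interpret VK: vector_space_pair t "(*) :: 'k \<Rightarrow> 'k \<Rightarrow> 'k" ..
  let ?lin = "Vector_Spaces.linear t (*)"
  let ?S = "T.span (pure B ` {hs. length hs = n})"
  have sep: "v = w" if "\<And>\<phi>. ?lin \<phi> \<Longrightarrow> \<phi> v = \<phi> w" for v w
  proof (rule ccontr)
    assume "v \<noteq> w"
    then have "V.independent {v - w}" by (simp add: V.independent_insert)
    from VK.linear_independent_extend[OF this, of "\<lambda>_. 1"]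
    obtain \<phi> where \<phi>: "?lin \<phi>" "\<phi> (v - w) = 1" by auto
    then have "\<phi> v - \<phi> w = 1" by (simp add: VK.linear_diff)
    with that[OF \<phi>(1)] show False by simp
  qed
  define P where "P x v \<longleftrightarrow> (\<forall>\<phi>. ?lin \<phi> \<longrightarrow> \<phi> v = slift n (\<lambda>hs. \<phi> (G hs)) x)" for x v
  have uniq: "v = w" if "P x v" "P x w" for x v w
    using that by (intro sep) (auto simp: P_def)
  have add: "P (x + y) (v + w)" if "P x v" "P y w" for x y v w
    using that by (auto simp: P_def slift_linear VK.linear_add)
  have scale: "P (tscale c x) (t c v)" if "P x v" for c x v
    using that by (auto simp: P_def slift_linear VK.linear_scale)
  have base: "P (pure B hs) (G hs)" if "length hs = n" for hs
    unfolding P_def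
  proof (intro allI impI)
    fix \<phi> assume \<phi>: "?lin \<phi>"
    have "multilinear (scl B) (*) n (\<lambda>hs. \<phi> (G hs))"
      using assms(2) \<phi> by (simp add: multilinear_def VK.linear_add VK.linear_scale)
    then show "\<phi> (G hs) = slift n (\<lambda>hs. \<phi> (G hs)) (pure B hs)" using that by (simp add: slift_pure)
  qed
  have zero: "P 0 0" by (auto simp: P_def slift_def VK.linear_0)
  have ex: "\<exists>v. P x v" if "x \<in> ?S" for x
    using that
  proof (induction rule: T.span_induct_alt)
    case base show ?case by (rule exI, rule zero)
  next
    case (step c x y)
    then obtain hs v where *: "x = pure B hs" "length hs = n" "P y v" by blast
    show ?case unfolding *(1) by (rule exI, rule add[OF scale[OF base[OF *(2)]] *(3)])
  qed
  define L where "L x = (SOME v. P x v)" for x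
  have L: "P x (L x)" if "x \<in> ?S" for x using ex[OF that] unfolding L_def by (rule someI_ex)
  have "linear_on_power B n t L"
    unfolding linear_on_power_def tensor_power_def
  proof (intro conjI ballI allI)
    fix x y assume *: "x \<in> ?S" "y \<in> ?S"
    show "L (x + y) = L x + L y" by (rule uniq[OF L[OF T.span_add[OF *]] add[OF *[THEN L]]])
  next
    fix c x assume *: "x \<in> ?S"
    show "L (tscale c x) = t c (L x)" by (rule uniq[OF L[OF T.span_scale[OF *]] scale[OF L[OF *]]])
  qed
  moreover have "L (pure B hs) = G hs" if "length hs = n" for hs
    using that by (intro uniq[OF L base] T.span_base) auto
  ultimately show ?thesis by blast
qed

lemma pure_single_inject:
  fixes B :: "('k::field, 'h::ring_1) bialgebra_data"
  assumes "vector_space (scl B)" "pure B [x] = pure B [y]"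
  shows "x = y"
proof -
  have "multilinear (scl B) (scl B) 1 hd"
    unfolding multilinear_def
  proof (intro allI impI)
    fix hs :: "'h list" and i :: nat assume "length hs = 1" "i < 1"
    then obtain h where "hs = [h]" "i = 0" by (cases hs) auto
    then show "(\<forall>x y. hd (hs[i := x + y]) = hd (hs[i := x]) + hd (hs[i := y])) \<and>
        (\<forall>c x. hd (hs[i := scl B c x]) = scl B c (hd (hs[i := x])))" by simp
  qed
  from tensor_power_universal[OF assms(1) this]
  obtain L where L: "L (pure B hs) = hd hs" if "length hs = 1" for hs by blast
  have "x = L (pure B [x])" by (simp add: L)
  also have "\<dots> = L (pure B [y])" by (simp only: assms(2))
  also have "\<dots> = y" by (simp add: L)
  finally show ?thesis .
qed

definition tproduct_list ::
  "('k::field, 'h::ring_1) bialgebra_data \<Rightarrow> ('k, 'h) tensor list \<Rightarrow> ('k, 'h) tensor" where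
  "tproduct_list B xs = foldr (tprod B) xs (pure B [])"

text \<open>\<open>id\<^sup>\<otimes>\<^sup>p \<otimes> L \<otimes> id\<^sup>\<otimes>\<^sup>q\<close> for a linear map \<open>L\<close> on the tensor power of degree \<open>r\<close>.\<close>

definition amplify ::
  "('k::field, 'h::ring_1) bialgebra_data \<Rightarrow> nat \<Rightarrow> nat \<Rightarrow> (('k, 'h) tensor \<Rightarrow> ('k, 'h) tensor) \<Rightarrow> nat \<Rightarrow>
     ('k, 'h) tensor \<Rightarrow> ('k, 'h) tensor" where
  "amplify B p r L q = tlift (p + r + q) (\<lambda>hs.
     tproduct_list B [pure B (take p hs), L (pure B (take r (drop p hs))), pure B (drop (p + r) hs)])"

text \<open>Product of the algebra \<open>H\<^sup>\<otimes>\<^sup>n\<close>, and the map \<open>m\<^sub>H\<^sup>\<otimes>\<^sup>n\<close> multiplying neighbouring positions.\<close>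

definition tmult ::
  "('k::field, 'h::ring_1) bialgebra_data \<Rightarrow> nat \<Rightarrow> ('k, 'h) tensor \<Rightarrow> ('k, 'h) tensor \<Rightarrow> ('k, 'h) tensor" where
  "tmult B n x y = tlift (2 * n) (\<lambda>hs. pure B (map2 (*) (take n hs) (drop n hs))) (tprod B x y)"

definition mult_power ::
  "('k::field, 'h::ring_1) bialgebra_data \<Rightarrow> nat \<Rightarrow> ('k, 'h) tensor \<Rightarrow> ('k, 'h) tensor" where
  "mult_power B n = tlift (2 * n) (\<lambda>hs. pure B (map (\<lambda>s. hs ! (2 * s) * hs ! (2 * s + 1)) [0..<n]))"

locale bialgebra =
  fixes B :: "('k::field, 'h::ring_1) bialgebra_data"
  assumes vector_space: "vector_space (scl B)"
    and scale_mult_left: "scl B c x * y = scl B c (x * y)"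
    and scale_mult_right: "x * scl B c y = scl B c (x * y)"
    and comul_closed: "comul B x \<in> tensor_power B 2"
    and comul_linear: "Vector_Spaces.linear (scl B) tscale (comul B)"
    and counit_linear: "Vector_Spaces.linear (scl B) (*) (counit B)"
    and coassoc: "tlift 2 (\<lambda>hs. tprod B (comul B (hs ! 0)) (pure B [hs ! 1])) (comul B x) =
                  tlift 2 (\<lambda>hs. tprod B (pure B [hs ! 0]) (comul B (hs ! 1))) (comul B x)"
    and counit_left: "tlift 2 (\<lambda>hs. tscale (counit B (hs ! 0)) (pure B [hs ! 1])) (comul B x) = pure B [x]"
    and counit_right: "tlift 2 (\<lambda>hs. tscale (counit B (hs ! 1)) (pure B [hs ! 0])) (comul B x) = pure B [x]"
    and comul_mult: "comul B (x * y) = tmult B 2 (comul B x) (comul B y)"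
    and comul_one: "comul B 1 = pure B [1, 1]"
    and counit_mult: "counit B (x * y) = counit B x * counit B y"
    and counit_one: "counit B 1 = 1"

text \<open>
  The standard coalgebra structure of \<open>H\<^sup>\<otimes>\<^sup>n\<close>: apply the comultiplication in every factor, then
  move the first legs to the front.
\<close>

definition comul_power ::
  "('k::field, 'h::ring_1) bialgebra_data \<Rightarrow> nat \<Rightarrow> ('k, 'h) tensor \<Rightarrow> ('k, 'h) tensor" where
  "comul_power B n = tlift n (\<lambda>hs.
     tlift (2 * n) (\<lambda>zs. pure B (map (\<lambda>s. zs ! (2 * s)) [0..<n] @ map (\<lambda>s. zs ! (2 * s + 1)) [0..<n]))
       (tproduct_list B (map (comul B) hs)))"

definition counit_power ::
  "('k::field, 'h::ring_1) bialgebra_data \<Rightarrow> nat \<Rightarrow> ('k, 'h) tensor \<Rightarrow> 'k" where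
  "counit_power B n = slift n (\<lambda>hs. prod_list (map (counit B) hs))"

text \<open>
  \<open>iter_comul B n k\<close> maps \<open>x \<in> H\<^sup>\<otimes>\<^sup>n\<close> to \<open>x\<^sub>(\<^sub>1\<^sub>) \<otimes> \<dots> \<otimes> x\<^sub>(\<^sub>k\<^sub>+\<^sub>1\<^sub>)\<close>: there are \<open>k + 1\<close> Sweedler factors,
  each of them a block of \<open>n\<close> positions.
\<close>

primrec iter_comul ::
  "('k::field, 'h::ring_1) bialgebra_data \<Rightarrow> nat \<Rightarrow> nat \<Rightarrow> ('k, 'h) tensor \<Rightarrow> ('k, 'h) tensor" where
  "iter_comul B n 0 = (\<lambda>x. x)"
| "iter_comul B n (Suc k) = (\<lambda>x. tlift (2 * n)
     (\<lambda>zs. tprod B (pure B (take n zs)) (iter_comul B n k (pure B (drop n zs)))) (comul_power B n x))"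

text \<open>
  Sweedler notation for elements of \<open>H\<close>: in \<open>sweedler B [(h\<^sub>1, r\<^sub>1), (h\<^sub>2, r\<^sub>2), \<dots>] (\<lambda>y. F y)\<close> the element
  \<open>h\<^sub>i\<close> has \<open>r\<^sub>i \<ge> 1\<close> Sweedler factors, and \<open>y i s\<close> (\<open>i\<close> and \<open>s\<close> counted from \<open>1\<close>) stands for the \<open>s\<close>-th of
  them. Meaningful if \<open>F y\<close> is linear in every \<open>y i s\<close>.
\<close>

definition sweedler ::
  "('k::field, 'h::ring_1) bialgebra_data \<Rightarrow> ('h \<times> nat) list \<Rightarrow> ((nat \<Rightarrow> nat \<Rightarrow> 'h) \<Rightarrow> ('k, 'h) tensor) \<Rightarrow>
     ('k, 'h) tensor" where
  "sweedler B ps F = tlift (sum_list (map snd ps))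
     (\<lambda>zs. F (\<lambda>i s. zs ! (sum_list (map snd (take (i - 1) ps)) + (s - 1))))
     (tproduct_list B (map (\<lambda>(h, r). iter_comul B 1 (r - 1) (pure B [h])) ps))"

text \<open>Convolution on the dual of the coalgebra \<open>H\<^sup>\<otimes>\<^sup>n\<close>.\<close>

definition conv ::
  "('k::field, 'h::ring_1) bialgebra_data \<Rightarrow> nat \<Rightarrow> (('k, 'h) tensor \<Rightarrow> 'k) \<Rightarrow> (('k, 'h) tensor \<Rightarrow> 'k) \<Rightarrow>
     ('k, 'h) tensor \<Rightarrow> 'k" where
  "conv B n f g x =
     slift (2 * n) (\<lambda>zs. f (pure B (take n zs)) * g (pure B (drop n zs))) (comul_power B n x)"

definition is_conv_inverse ::
  "('k::field, 'h::ring_1) bialgebra_data \<Rightarrow> nat \<Rightarrow> (('k, 'h) tensor \<Rightarrow> 'k) \<Rightarrow> (('k, 'h) tensor \<Rightarrow> 'k) \<Rightarrow> bool" where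
  "is_conv_inverse B n f g \<longleftrightarrow> linear_on_power B n (*) g \<and>
     (\<forall>x\<in>tensor_power B n. conv B n f g x = counit_power B n x \<and> conv B n g f x = counit_power B n x)"

text \<open>Convolution inverses are unique as functions on the tensor power.\<close>

definition conv_inverse ::
  "('k::field, 'h::ring_1) bialgebra_data \<Rightarrow> nat \<Rightarrow> (('k, 'h) tensor \<Rightarrow> 'k) \<Rightarrow> ('k, 'h) tensor \<Rightarrow> 'k" where
  "conv_inverse B n f = (SOME g. is_conv_inverse B n f g)"

text \<open>
  \<open>f\<^sub>i\<^sub>1\<^sub>,\<^sub>\<dots>\<^sub>,\<^sub>i\<^sub>r\<close> on \<open>H\<^sup>\<otimes>\<^sup>N\<close> for a functional \<open>f\<close>, and \<open>X\<^sub>i\<^sub>1\<^sub>,\<^sub>\<dots>\<^sub>,\<^sub>i\<^sub>r\<close> in \<open>H\<^sup>\<otimes>\<^sup>n\<close> for a tensor \<open>X\<close>; the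
  positions in the list \<open>is\<close> are counted from \<open>1\<close>.
\<close>

definition functional_at ::
  "('k::field, 'h::ring_1) bialgebra_data \<Rightarrow> nat \<Rightarrow> nat list \<Rightarrow> (('k, 'h) tensor \<Rightarrow> 'k) \<Rightarrow> ('k, 'h) tensor \<Rightarrow> 'k" where
  "functional_at B N is f = slift N (\<lambda>hs.
     f (pure B (map (\<lambda>i. hs ! (i - 1)) is)) * (\<Prod>j\<in>{1..N} - set is. counit B (hs ! (j - 1))))"

definition tensor_at ::
  "('k::field, 'h::ring_1) bialgebra_data \<Rightarrow> nat \<Rightarrow> nat list \<Rightarrow> ('k, 'h) tensor \<Rightarrow> ('k, 'h) tensor" where
  "tensor_at B n is = tlift (length is) (\<lambda>hs.
     pure B (map (\<lambda>p. case map_of (zip is hs) p of Some h \<Rightarrow> h | None \<Rightarrow> 1) [1..<n + 1]))"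

definition co_quasi_triangular ::
  "('k::field, 'h::ring_1) bialgebra_data \<Rightarrow> (('k, 'h) tensor \<Rightarrow> 'k) \<Rightarrow> bool" where
  "co_quasi_triangular B R \<longleftrightarrow>
     linear_on_power B 2 (*) R \<and>
     (\<exists>g. is_conv_inverse B 2 R g) \<and>
     (\<forall>a a'. sweedler B [(a, 2), (a', 2)]
               (\<lambda>y. tscale (R (pure B [y 1 1, y 2 1])) (pure B [y 1 2 * y 2 2])) =
             sweedler B [(a, 2), (a', 2)]
               (\<lambda>y. tscale (R (pure B [y 1 2, y 2 2])) (pure B [y 2 1 * y 1 1]))) \<and>
     (\<forall>x\<in>tensor_power B 3. R (amplify B 0 2 (mult_power B 1) 1 x) =
        conv B 3 (functional_at B 3 [1, 3] R) (functional_at B 3 [2, 3] R) x) \<and>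
     (\<forall>x\<in>tensor_power B 3. R (amplify B 1 2 (mult_power B 1) 0 x) =
        conv B 3 (functional_at B 3 [1, 3] R) (functional_at B 3 [1, 2] R) x)"

definition counital ::
  "('k::field, 'h::ring_1) bialgebra_data \<Rightarrow> (('k, 'h) tensor \<Rightarrow> 'k) \<Rightarrow> bool" where
  "counital B R \<longleftrightarrow> (\<forall>a. R (pure B [a, 1]) = counit B a \<and> R (pure B [1, a]) = counit B a)"

definition transitive_colouring :: "nat \<Rightarrow> (nat \<times> nat \<Rightarrow> 'c) \<Rightarrow> bool" where
  "transitive_colouring n c \<longleftrightarrow>
     (\<forall>i j k. 1 \<le> i \<and> i < j \<and> j < k \<and> k \<le> n \<longrightarrow> c (i, k) \<in> {c (i, j), c (j, k)})"

definition twist_J ::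
  "('k::field, 'h::ring_1) bialgebra_data \<Rightarrow> ('c \<Rightarrow> ('k, 'h) tensor \<Rightarrow> 'k) \<Rightarrow> nat \<Rightarrow> (nat \<times> nat \<Rightarrow> 'c) \<Rightarrow>
     ('k, 'h) tensor \<Rightarrow> 'k" where
  "twist_J B R n c = foldr (conv B (2 * n))
     [functional_at B (2 * n) [i, n + j] (R (c (j, i))). i \<leftarrow> [2..<n + 1], j \<leftarrow> rev [1..<i]]
     (counit_power B (2 * n))"

text \<open>
  In \<open>zs\<close> below, the blocks of \<open>n\<close> positions numbered \<open>0, 1, 2\<close> are the Sweedler factors of \<open>x\<close>, the blocks
  numbered \<open>3, 4, 5\<close> those of \<open>y\<close>.
\<close>

definition twisted_mult ::
  "('k::field, 'h::ring_1) bialgebra_data \<Rightarrow> ('c \<Rightarrow> ('k, 'h) tensor \<Rightarrow> 'k) \<Rightarrow> nat \<Rightarrow> (nat \<times> nat \<Rightarrow> 'c) \<Rightarrow>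
     ('k, 'h) tensor \<Rightarrow> ('k, 'h) tensor \<Rightarrow> ('k, 'h) tensor" where
  "twisted_mult B R n c x y =
     tlift (6 * n) (\<lambda>zs. let blk = (\<lambda>b. take n (drop (b * n) zs)) in
       tscale (conv_inverse B (2 * n) (twist_J B R n c) (pure B (blk 0 @ blk 3)) *
               twist_J B R n c (pure B (blk 2 @ blk 5)))
              (tmult B n (pure B (blk 1)) (pure B (blk 4))))
       (tprod B (iter_comul B n 2 x) (iter_comul B n 2 y))"

definition Psi ::
  "('k::field, 'h::ring_1) bialgebra_data \<Rightarrow> (('k, 'h) tensor \<Rightarrow> 'k) \<Rightarrow> ('k, 'h) tensor \<Rightarrow> ('k, 'h) tensor" where
  "Psi B R = tlift 2 (\<lambda>hs. sweedler B [(hs ! 0, 3), (hs ! 1, 3)]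
     (\<lambda>y. tscale (conv_inverse B 2 R (pure B [y 1 1, y 2 1]) * R (pure B [y 1 3, y 2 3]))
                 (pure B [y 2 2, y 1 2])))"

end

(*
  Idea. A tensor is determined by the values that it gives to multilinear functionals on words in H,
  and dually a linear map of tensor powers transforms functionals. In this picture the functional f
  takes at h . h' (twisted product) the value of the convolution product J^-1 * (f o m) * J at the
  word h h', m being the product of H^(tensor n). Applying Psi to the neighbours a_j b_i of a word
  conjugates a functional by the factor R_(a_j, b_i) of J and exchanges the two letters. Moving
  b_1, then b_2, ... to the left until the word is a_1 b_1 a_2 b_2 ... therefore conjugates f o m
  by the factors R_(a_j, b_i), taken in column order. J has the same factors in row order, and the
  two products agree because factors without common position commute.

  The explicit formula is J^-1 * (f o m) * J in Sweedler notation: at each position, the factors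
  consume the legs one after another. If every R is counital, pulling the convolution back to words
  with 1 in all but two positions turns each factor of J into the counit, with at most one exception.
*)
theory Submission
  imports Defs
begin

section \<open>Tensors as functionals on multilinear functions\<close>

text \<open>A tensor built from \<open>pure\<close> vanishes on functions that are not multilinear,
  so it cannot be applied freely to the partially evaluated functions of a Sweedler calculation.
  Hence each tensor \<open>x\<close> is accompanied by a combination \<open>S\<close> of words
  (\<open>tens n x S\<close>), for which sums may be exchanged for arbitrary functions;
  multilinearity enters only where a coalgebra axiom is used or \<open>S\<close> is traded for
  \<open>x\<close>. Functionals are cut off to words of one length, so that convolution identities
  become equations between functions.

  Conjugation arises because \<Psi> takes R^-1 of the first legs, exchanges the second legs and
  takes R of the third. A factor at two adjacent places of a rearranged word must be recognised as a
  factor at their original places. This needs the rearrangement to respect coproducts, and the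
  letter a_j to precede b_i in the original word. New factors enter next to f, so the latest step
  contributes the leftmost factor of J. In the counital case the inverse of J is restricted to
  special words not factor by factor but by uniqueness of inverses.\<close>

text \<open>\<open>S\<close> is a finite linear combination of evaluations at words of length \<open>n\<close>.\<close>

inductive fsum :: "nat \<Rightarrow> (('h list \<Rightarrow> 'k::field) \<Rightarrow> 'k) \<Rightarrow> bool" for n where
  fsum_0: "fsum n (\<lambda>f. 0)"
| fsum_step: "length w = n \<Longrightarrow> fsum n S \<Longrightarrow> fsum n (\<lambda>f. c * f w + S f)"

lemma fsum_single: "length w = n \<Longrightarrow> fsum n (\<lambda>f. f w :: 'k::field)"
  using fsum_step[OF _ fsum_0, of w n 1] by simp

lemma fsum_add: "fsum n S \<Longrightarrow> fsum n T \<Longrightarrow> fsum n (\<lambda>f. S f + T f)"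
  by (induction rule: fsum.induct) (simp_all add: add.assoc fsum_step)

lemma fsum_scale: "fsum n S \<Longrightarrow> fsum n (\<lambda>f. c * S f)"
  by (induction rule: fsum.induct)
    (simp_all add: fsum_0 distrib_left mult.assoc[symmetric] fsum_step)

lemma fsum_apply_0: "fsum n S \<Longrightarrow> S (\<lambda>_. 0) = 0"
  by (induction rule: fsum.induct) simp_all

lemma fsum_apply_add: "fsum n S \<Longrightarrow> S (\<lambda>w. f w + g w) = S f + S g"
  by (induction rule: fsum.induct) (simp_all add: algebra_simps)

lemma fsum_apply_mult: "fsum n S \<Longrightarrow> S (\<lambda>w. c * f w) = c * S f"
  by (induction rule: fsum.induct) (simp_all add: algebra_simps)

lemma fsum_apply_mult_right: "fsum n S \<Longrightarrow> S (\<lambda>w. f w * c) = S f * c"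
  using fsum_apply_mult[of n S c f] by (simp add: mult.commute)

lemma fsum_cong: "fsum n S \<Longrightarrow> (\<And>w. length w = n \<Longrightarrow> f w = g w) \<Longrightarrow> S f = S g"
  by (induction rule: fsum.induct) simp_all

lemma fsum_bind:
  "fsum n S \<Longrightarrow> (\<And>w. length w = n \<Longrightarrow> fsum m (T w)) \<Longrightarrow> fsum m (\<lambda>f. S (\<lambda>w. T w f))"
  by (induction rule: fsum.induct) (simp_all add: fsum_0 fsum_add fsum_scale)

text \<open>Finite sums can be exchanged for an arbitrary \<open>K\<close>. The same exchange for
  two tensors would ask for multilinearity in each word, which is why calculations use the
  combinations.\<close>

lemma fsum_commute:
  assumes "fsum n S" "fsum m T"
  shows "S (\<lambda>x. T (\<lambda>y. K x y)) = T (\<lambda>y. S (\<lambda>x. K x y))"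
  using assms(1)
  by (induction rule: fsum.induct)
    (simp_all add: fsum_apply_0[OF assms(2)] fsum_apply_add[OF assms(2)] fsum_apply_mult[OF assms(2)])

context bialgebra
begin

abbreviation ml :: "nat \<Rightarrow> ('h list \<Rightarrow> 'k) \<Rightarrow> bool" where "ml \<equiv> multilinear (scl B) (*)"

section \<open>Linear forms and multilinear functions on words\<close>

abbreviation mlin :: "('h list \<Rightarrow> 'k) \<Rightarrow> bool" where "mlin f \<equiv> \<forall>n. ml n f"

definition lin :: "('h \<Rightarrow> 'k) \<Rightarrow> bool" where
  "lin \<phi> \<longleftrightarrow> (\<forall>x y. \<phi> (x + y) = \<phi> x + \<phi> y) \<and> (\<forall>c x. \<phi> (scl B c x) = c * \<phi> x)"

lemma lin_add: "lin \<phi> \<Longrightarrow> lin \<psi> \<Longrightarrow> lin (\<lambda>x. \<phi> x + \<psi> x)"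
  by (simp add: lin_def algebra_simps)

lemma lin_mult: "lin \<phi> \<Longrightarrow> lin (\<lambda>x. c * \<phi> x)"
  by (simp add: lin_def algebra_simps)

lemma lin_mult_right: "lin \<phi> \<Longrightarrow> lin (\<lambda>x. \<phi> x * c)"
  by (simp add: lin_def algebra_simps)

lemma lin_0: "lin (\<lambda>x. 0)"
  by (simp add: lin_def)

lemma lin_counit: "lin (counit B)"
proof -
  interpret Vector_Spaces.linear "scl B" "(*)" "counit B" by (rule counit_linear)
  show ?thesis by (simp add: lin_def add scale)
qed

lemma ml_iff_lin: "ml n F \<longleftrightarrow> (\<forall>hs i. length hs = n \<longrightarrow> i < n \<longrightarrow> lin (\<lambda>x. F (hs[i := x])))"
  by (simp add: multilinear_def lin_def)

lemma ml_0: "ml 0 F"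
  by (simp add: multilinear_def)

text \<open>The recursion by which statements about multilinear functions are proved by induction on
  the word, one letter at a time.\<close>

lemma ml_Suc:
  "ml (Suc n) F \<longleftrightarrow> (\<forall>hs. length hs = n \<longrightarrow> lin (\<lambda>x. F (x # hs))) \<and> (\<forall>x. ml n (\<lambda>hs. F (x # hs)))"
proof (intro iffI conjI allI impI)
  fix hs :: "'h list" assume F: "ml (Suc n) F" and "length hs = n"
  then show "lin (\<lambda>x. F (x # hs))"
    using F[unfolded ml_iff_lin, rule_format, of "0 # hs" 0] by simp
next
  fix x assume F: "ml (Suc n) F"
  show "ml n (\<lambda>hs. F (x # hs))"
    unfolding ml_iff_lin
  proof (intro allI impI)
    fix hs :: "'h list" and i assume "length hs = n" "i < n"
    then show "lin (\<lambda>y. F (x # hs[i := y]))"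
      using F[unfolded ml_iff_lin, rule_format, of "x # hs" "Suc i"] by simp
  qed
next
  assume F: "(\<forall>hs. length hs = n \<longrightarrow> lin (\<lambda>x. F (x # hs))) \<and> (\<forall>x. ml n (\<lambda>hs. F (x # hs)))"
  show "ml (Suc n) F"
    unfolding ml_iff_lin
  proof (intro allI impI)
    fix hs :: "'h list" and i assume *: "length hs = Suc n" "i < Suc n"
    then obtain x xs where hs: "hs = x # xs" by (cases hs) auto
    show "lin (\<lambda>y. F (hs[i := y]))"
    proof (cases i)
      case 0
      then show ?thesis using F hs *(1) by simp
    next
      case (Suc k)
      then show ?thesis using F[THEN conjunct2, rule_format, of x] hs * by (simp add: ml_iff_lin)
    qed
  qed
qed

lemma ml_cong: "(\<And>hs. length hs = n \<Longrightarrow> F hs = G hs) \<Longrightarrow> ml n F \<longleftrightarrow> ml n G"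
  by (simp add: multilinear_def)

lemma ml_mult: "ml n F \<Longrightarrow> ml n (\<lambda>hs. c * F hs)"
  by (simp add: ml_iff_lin lin_mult)

lemma ml_zero: "ml n (\<lambda>_. 0)"
  by (simp add: ml_iff_lin lin_0)

lemma fsum_lin:
  "fsum n S \<Longrightarrow> (\<And>w. length w = n \<Longrightarrow> lin (\<lambda>x. K x w)) \<Longrightarrow> lin (\<lambda>x. S (K x))"
  by (induction rule: fsum.induct) (simp_all add: lin_0 lin_add lin_mult)

lemma fsum_ml:
  "fsum m S \<Longrightarrow> (\<And>w. length w = m \<Longrightarrow> ml n (\<lambda>hs. K hs w)) \<Longrightarrow> ml n (\<lambda>hs. S (K hs))"
  unfolding ml_iff_lin by (intro allI impI fsum_lin[of m S]) simp_all

lemma ml_restrict: "ml n F \<Longrightarrow> mlin (\<lambda>hs. if length hs = n then F hs else 0)"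
  by (simp add: multilinear_restrict)

section \<open>Tensors and the combinations representing them\<close>

text \<open>
  \<open>x\<close> is a tensor of degree \<open>n\<close> represented by the combination \<open>S\<close> of words. Outside the multilinear
  functions \<open>x\<close> vanishes, whereas \<open>S\<close> has no special value there.
\<close>

definition tens :: "nat \<Rightarrow> ('k, 'h) tensor \<Rightarrow> (('h list \<Rightarrow> 'k) \<Rightarrow> 'k) \<Rightarrow> bool" where
  "tens n x S \<longleftrightarrow> fsum n S \<and> x = (\<lambda>f. if mlin f then S f else 0)"

lemma tens_fsum: "tens n x S \<Longrightarrow> fsum n S"
  by (simp add: tens_def)

lemma tens_apply: "tens n x S \<Longrightarrow> mlin f \<Longrightarrow> x f = S f"
  by (simp add: tens_def)

lemma tens_apply_non_mlin: "tens n x S \<Longrightarrow> \<not> mlin f \<Longrightarrow> x f = 0"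
  unfolding tens_def by meson

lemma tens_eqI: "tens n x S \<Longrightarrow> tens m y T \<Longrightarrow> (\<And>f. mlin f \<Longrightarrow> S f = T f) \<Longrightarrow> x = y"
  by (auto simp: tens_def fun_eq_iff)

text \<open>\<open>slift\<close> and \<open>tlift\<close> extend a function by 0 to words of other
  lengths. The extension is multilinear in every length, so \<open>x\<close> may be replaced by
  \<open>S\<close>; and \<open>S\<close> evaluates only at words of length \<open>n\<close>, so the
  extension may then be dropped.\<close>

lemma tens_apply_restrict:
  assumes "tens n x S" "ml n F"
  shows "x (\<lambda>hs. if length hs = n then F hs else 0) = S F"
  by (rule trans[OF tens_apply[OF assms(1) ml_restrict[OF assms(2)]] fsum_cong[OF tens_fsum[OF assms(1)]]])
    simp

lemma tens_slift: "tens n x S \<Longrightarrow> ml n F \<Longrightarrow> slift n F x = S F"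
  unfolding slift_def by (rule tens_apply_restrict)

lemma tens_pure: "length w = n \<Longrightarrow> tens n (pure B w) (\<lambda>f. f w)"
  by (simp add: tens_def pure_def fsum_single)

lemma tens_power:
  assumes "x \<in> tensor_power B n"
  obtains S where "tens n x S"
proof -
  interpret T: vector_space "tscale :: 'k \<Rightarrow> ('k, 'h) tensor \<Rightarrow> _" by (rule vector_space_tscale)
  have "x \<in> T.span (pure B ` {hs. length hs = n})" using assms by (simp add: tensor_power_def)
  then have "\<exists>S. tens n x S"
  proof (induction rule: T.span_induct_alt)
    case base
    have "tens n 0 (\<lambda>_. 0)" by (simp add: tens_def fsum_0 fun_eq_iff)
    then show ?case by blast
  next
    case (step c x y)
    then obtain w S where "x = pure B w" "length w = n" "tens n y S" by blast
    then have "tens n (tscale c x + y) (\<lambda>f. c * f w + S f)"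
      by (auto simp: tens_def fsum_step pure_def tscale_def fun_eq_iff)
    then show ?case by blast
  qed
  with that show thesis by blast
qed

text \<open>For multilinear \<open>f\<close>, the function of the second word, and its
  \<open>T\<close>-value as a function of the first word, are again multilinear, so both tensors may
  be replaced by their combinations. For other \<open>f\<close> the guard of \<open>tprod\<close>
  gives 0.\<close>

lemma tens_tprod:
  assumes x: "tens m x S" and y: "tens n y T"
  shows "tens (m + n) (tprod B x y) (\<lambda>f. S (\<lambda>us. T (\<lambda>vs. f (us @ vs))))"
  unfolding tens_def
proof (intro conjI ext)
  show "fsum (m + n) (\<lambda>f. S (\<lambda>us. T (\<lambda>vs. f (us @ vs))))"
    by (intro fsum_bind[OF tens_fsum[OF x]] fsum_bind[OF tens_fsum[OF y]] fsum_single) simp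
next
  fix f
  show "tprod B x y f = (if mlin f then S (\<lambda>us. T (\<lambda>vs. f (us @ vs))) else 0)"
  proof (cases "mlin f")
    case True
    then have "y (\<lambda>vs. f (us @ vs)) = T (\<lambda>vs. f (us @ vs))" for us
      by (intro tens_apply[OF y]) (simp add: multilinear_append)
    moreover have "mlin (\<lambda>us. T (\<lambda>vs. f (us @ vs)))"
      using True by (intro allI fsum_ml[OF tens_fsum[OF y]] multilinear_append(2)) simp_all
    ultimately show ?thesis using True by (simp add: tprod_def tens_apply[OF x])
  qed (auto simp: tprod_def)
qed

text \<open>The rule that computes maps given as a \<open>tlift\<close>. Multilinearity of
  \<open>T\<close> in \<open>hs\<close> is asked for because \<open>x\<close> sees only multilinear
  functions; if \<open>f\<close> is not multilinear, all \<open>G hs f\<close> vanish and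
  \<open>x\<close> is applied to the zero function.\<close>

lemma tens_tlift:
  assumes x: "tens n x S" and G: "\<And>hs. length hs = n \<Longrightarrow> tens m (G hs) (T hs)"
    and T: "\<And>f. mlin f \<Longrightarrow> ml n (\<lambda>hs. T hs f)"
  shows "tens m (tlift n G x) (\<lambda>f. S (\<lambda>hs. T hs f))"
  unfolding tens_def
proof (intro conjI ext)
  show "fsum m (\<lambda>f. S (\<lambda>hs. T hs f))"
    by (intro fsum_bind[OF tens_fsum[OF x]] tens_fsum[OF G])
next
  fix f
  show "tlift n G x f = (if mlin f then S (\<lambda>hs. T hs f) else 0)"
  proof (cases "mlin f")
    case True
    then have "(\<lambda>hs. if length hs = n then G hs f else 0) = (\<lambda>hs. if length hs = n then T hs f else 0)"
      by (auto simp: fun_eq_iff tens_apply[OF G])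
    then show ?thesis using True by (simp add: tlift_def tens_apply_restrict[OF x T])
  next
    case False
    then have "(\<lambda>hs. if length hs = n then G hs f else 0) = (\<lambda>hs. if length hs = n then 0 else 0)"
      by (auto simp: fun_eq_iff tens_apply_non_mlin[OF G])
    moreover have "x (\<lambda>hs. if length hs = n then 0 else 0) = S (\<lambda>_. 0)"
      by (rule tens_apply_restrict[OF x]) (rule ml_zero)
    ultimately show ?thesis using False by (auto simp: tlift_def fsum_apply_0[OF tens_fsum[OF x]])
  qed
qed

lemma tens_tscale: "tens n x S \<Longrightarrow> tens n (tscale c x) (\<lambda>f. c * S f)"
  by (auto simp: tens_def tscale_def fsum_scale)

lemma tens_cong: "tens n x S \<Longrightarrow> (\<And>f. S f = T f) \<Longrightarrow> tens n x T"
  using ext[of S T] by simp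

text \<open>A tensor has many representing combinations, but they agree on multilinear functions. In
  this way the axioms, which are equations between tensors, become identities between Sweedler
  sums.\<close>

lemma tens_unique:
  assumes "tens n x S" "tens n x T" "ml n F"
  shows "S F = T F"
  using tens_slift[OF assms(1,3)] tens_slift[OF assms(2,3)] by simp

section \<open>Sweedler sums and convolution\<close>

definition comul_sum :: "'h \<Rightarrow> ('h list \<Rightarrow> 'k) \<Rightarrow> 'k" where
  "comul_sum h = (SOME S. tens 2 (comul B h) S)"

text \<open>\<open>\<phi>(h\<^sub>(\<^sub>1\<^sub>), h\<^sub>(\<^sub>2\<^sub>))\<close>, computed with one fixed representative of the coproduct, so that sums can be
  interchanged without linearity of \<open>\<phi>\<close>.\<close>

definition csum :: "('h \<Rightarrow> 'h \<Rightarrow> 'k) \<Rightarrow> 'h \<Rightarrow> 'k" where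
  "csum \<phi> h = comul_sum h (\<lambda>w. \<phi> (w ! 0) (w ! 1))"

lemma length_2_conv: "length (w :: 'a list) = 2 \<longleftrightarrow> w = [w ! 0, w ! 1]"
  by (cases w; cases "tl w"; cases "tl (tl w)") auto

lemma tens_comul: "tens 2 (comul B h) (\<lambda>f. csum (\<lambda>u v. f [u, v]) h)"
proof -
  obtain S where "tens 2 (comul B h) S" using tens_power[OF comul_closed] .
  then have *: "tens 2 (comul B h) (comul_sum h)" unfolding comul_sum_def by (rule someI[of "tens 2 (comul B h)"])
  show ?thesis
    by (rule tens_cong[OF *], unfold csum_def, rule fsum_cong[OF tens_fsum[OF *]])
      (simp add: length_2_conv)
qed

lemma fsum_comul: "fsum 2 (comul_sum h)"
proof -
  obtain S where "tens 2 (comul B h) S" using tens_power[OF comul_closed] .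
  then show ?thesis unfolding comul_sum_def by (rule tens_fsum[OF someI[of "tens 2 (comul B h)"]])
qed

lemma csum_mult: "csum (\<lambda>u v. c * \<phi> u v) h = c * csum \<phi> h"
  unfolding csum_def by (rule fsum_apply_mult[OF fsum_comul])

lemma csum_mult_right: "csum (\<lambda>u v. \<phi> u v * c) h = csum \<phi> h * c"
  unfolding csum_def by (rule fsum_apply_mult_right[OF fsum_comul])

lemma csum_csum: "csum (\<lambda>u v. csum (\<lambda>x y. K u v x y) h') h = csum (\<lambda>x y. csum (\<lambda>u v. K u v x y) h) h'"
  unfolding csum_def by (rule fsum_commute[OF fsum_comul fsum_comul])

lemma fsum_csum_bind: "(\<And>u v. fsum n (T u v)) \<Longrightarrow> fsum n (\<lambda>f. csum (\<lambda>u v. T u v f) h)"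
  unfolding csum_def by (rule fsum_bind[OF fsum_comul]) blast

lemma lin_csum_param: "(\<And>u v. lin (\<lambda>x. K x u v)) \<Longrightarrow> lin (\<lambda>x. csum (K x) h)"
  unfolding csum_def by (rule fsum_lin[OF fsum_comul])

lemma ml_bilinear:
  assumes "\<And>v. lin (\<lambda>u. \<phi> u v)" "\<And>u. lin (\<phi> u)"
  shows "ml 2 (\<lambda>w. \<phi> (w ! 0) (w ! 1))"
  using assms by (simp add: numeral_2_eq_2 ml_Suc ml_0)

lemma ml_trilinear:
  assumes "\<And>v w. lin (\<lambda>u. \<phi> u v w)" "\<And>u w. lin (\<lambda>v. \<phi> u v w)" "\<And>u v. lin (\<phi> u v)"
  shows "ml 3 (\<lambda>w. \<phi> (w ! 0) (w ! 1) (w ! 2))"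
  using assms by (simp add: numeral_3_eq_3 numeral_2_eq_2 ml_Suc ml_0)

lemma csum_eq_comul:
  assumes "\<And>v. lin (\<lambda>u. \<phi> u v)" "\<And>u. lin (\<phi> u)"
  shows "csum \<phi> h = slift 2 (\<lambda>w. \<phi> (w ! 0) (w ! 1)) (comul B h)"
  using tens_slift[OF tens_comul ml_bilinear[OF assms]] by simp

text \<open>The chosen representative need not depend linearly on the split element. For bilinear
  \<phi> the sum depends only on the coproduct as a tensor, and that is linear.\<close>

lemma lin_csum:
  assumes "\<And>v. lin (\<lambda>u. \<phi> u v)" "\<And>u. lin (\<phi> u)"
  shows "lin (csum \<phi>)"
proof -
  interpret Vector_Spaces.linear "scl B" tscale "comul B" by (rule comul_linear)
  show ?thesis by (simp add: lin_def csum_eq_comul[OF assms] add scale slift_linear)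
qed

text \<open>Both sides of \<open>coassoc\<close> are computed as tensors of degree 3 and tested on
  \<phi>. Bound names are reused: on the left the inner sum splits the outer \<open>u\<close>, on
  the right the outer \<open>v\<close>.\<close>

lemma csum_coassoc:
  assumes "\<And>v w. lin (\<lambda>u. \<phi> u v w)" "\<And>u w. lin (\<lambda>v. \<phi> u v w)" "\<And>u v. lin (\<phi> u v)"
  shows "csum (\<lambda>u w. csum (\<lambda>u v. \<phi> u v w) u) h = csum (\<lambda>u v. csum (\<lambda>v w. \<phi> u v w) v) h"
proof -
  let ?F = "\<lambda>w. \<phi> (w ! 0) (w ! 1) (w ! 2)"
  have l: "tens 3 (tlift 2 (\<lambda>hs. tprod B (comul B (hs ! 0)) (pure B [hs ! 1])) (comul B h))
      (\<lambda>f. csum (\<lambda>u v. csum (\<lambda>u1 u2. f [u1, u2, v]) u) h)"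
  proof -
    have "tens (2 + 1) (tlift 2 (\<lambda>hs. tprod B (comul B (hs ! 0)) (pure B [hs ! 1])) (comul B h))
        (\<lambda>f. csum (\<lambda>u v. csum (\<lambda>u1 u2. f ([u1, u2] @ [[u,v] ! 1])) ([u,v] ! 0)) h)"
    proof (rule tens_tlift[OF tens_comul tens_tprod[OF tens_comul tens_pure]])
      fix f assume "mlin f"
      then have "ml (Suc (Suc (Suc 0))) f" by simp
      then show "ml 2 (\<lambda>hs. csum (\<lambda>u1 u2. f ([u1, u2] @ [hs ! 1])) (hs ! 0))"
        by (intro ml_bilinear lin_csum lin_csum_param) (auto simp: ml_Suc)
    qed simp
    then show ?thesis by simp
  qed
  have r: "tens 3 (tlift 2 (\<lambda>hs. tprod B (pure B [hs ! 0]) (comul B (hs ! 1))) (comul B h))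
      (\<lambda>f. csum (\<lambda>u v. csum (\<lambda>v1 v2. f [u, v1, v2]) v) h)"
  proof -
    have "tens (1 + 2) (tlift 2 (\<lambda>hs. tprod B (pure B [hs ! 0]) (comul B (hs ! 1))) (comul B h))
        (\<lambda>f. csum (\<lambda>u v. csum (\<lambda>v1 v2. f ([[u,v] ! 0] @ [v1, v2])) ([u,v] ! 1)) h)"
    proof (rule tens_tlift[OF tens_comul tens_tprod[OF tens_pure tens_comul]])
      fix f assume "mlin f"
      then have "ml (Suc (Suc (Suc 0))) f" by simp
      then show "ml 2 (\<lambda>hs. csum (\<lambda>v1 v2. f ([hs ! 0] @ [v1, v2])) (hs ! 1))"
        by (intro ml_bilinear lin_csum lin_csum_param) (auto simp: ml_Suc)
    qed simp
    then show ?thesis by (simp add: numeral_3_eq_3)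
  qed
  have "ml 3 ?F" by (rule ml_trilinear[OF assms])
  from tens_unique[OF l r[folded coassoc] this] show ?thesis by simp
qed

lemma csum_counit_left:
  assumes "lin \<phi>"
  shows "csum (\<lambda>u v. counit B u * \<phi> v) h = \<phi> h"
proof -
  have "tens 1 (tlift 2 (\<lambda>hs. tscale (counit B (hs ! 0)) (pure B [hs ! 1])) (comul B h))
      (\<lambda>f. csum (\<lambda>u v. counit B ([u,v] ! 0) * f [[u,v] ! 1]) h)"
  proof (rule tens_tlift[OF tens_comul tens_tscale[OF tens_pure]])
    fix f assume "mlin f"
    then have "ml (Suc 0) f" by simp
    then show "ml 2 (\<lambda>hs. counit B (hs ! 0) * f [hs ! 1])"
      by (intro ml_bilinear lin_mult lin_mult_right lin_counit) (auto simp: ml_Suc)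
  qed simp
  moreover have "tens 1 (pure B [h]) (\<lambda>f. f [h])" by (rule tens_pure) simp
  moreover have "ml 1 (\<lambda>w. \<phi> (w ! 0))" using assms by (simp add: ml_Suc ml_0)
  ultimately show ?thesis unfolding counit_left by (drule_tac tens_unique) auto
qed

lemma csum_counit_right:
  assumes "lin \<phi>"
  shows "csum (\<lambda>u v. \<phi> u * counit B v) h = \<phi> h"
proof -
  have "tens 1 (tlift 2 (\<lambda>hs. tscale (counit B (hs ! 1)) (pure B [hs ! 0])) (comul B h))
      (\<lambda>f. csum (\<lambda>u v. counit B ([u,v] ! 1) * f [[u,v] ! 0]) h)"
  proof (rule tens_tlift[OF tens_comul tens_tscale[OF tens_pure]])
    fix f assume "mlin f"
    then have "ml (Suc 0) f" by simp
    then show "ml 2 (\<lambda>hs. counit B (hs ! 1) * f [hs ! 0])"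
      by (intro ml_bilinear lin_mult lin_mult_right lin_counit) (auto simp: ml_Suc)
  qed simp
  moreover have "tens 1 (pure B [h]) (\<lambda>f. f [h])" by (rule tens_pure) simp
  moreover have "ml 1 (\<lambda>w. \<phi> (w ! 0))" using assms by (simp add: ml_Suc ml_0)
  ultimately show ?thesis unfolding counit_right by (drule_tac tens_unique) (auto simp: mult.commute)
qed

text \<open>Bilinearity matters here: the combination chosen for the coproduct of 1 need not be the
  single word \<open>[1, 1]\<close>.\<close>

lemma csum_one:
  assumes "\<And>v. lin (\<lambda>u. \<phi> u v)" "\<And>u. lin (\<phi> u)"
  shows "csum \<phi> 1 = \<phi> 1 1"
proof -
  have "tens 2 (comul B 1) (\<lambda>f. f [1, 1])" unfolding comul_one by (rule tens_pure) simp
  from tens_unique[OF tens_comul this ml_bilinear[OF assms]] show ?thesis by simp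
qed

text \<open>The coproduct of a tensor power of H on a pure tensor: all first legs form one word, all
  second legs another.\<close>

primrec split_sum :: "'h list \<Rightarrow> ('h list \<Rightarrow> 'h list \<Rightarrow> 'k) \<Rightarrow> 'k" where
  "split_sum [] K = K [] []"
| "split_sum (h # hs) K = csum (\<lambda>u v. split_sum hs (\<lambda>us vs. K (u # us) (v # vs))) h"

lemma split_sum_cong:
  "(\<And>us vs. length us = length hs \<Longrightarrow> length vs = length hs \<Longrightarrow> K us vs = L us vs) \<Longrightarrow>
     split_sum hs K = split_sum hs L"
proof (induction hs arbitrary: K L)
  case (Cons h hs)
  have "split_sum hs (\<lambda>us vs. K (u # us) (v # vs)) = split_sum hs (\<lambda>us vs. L (u # us) (v # vs))" for u v
    by (rule Cons.IH) (simp add: Cons.prems)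
  then show ?case by simp
qed simp

lemma fsum_split_sum_bind:
  "(\<And>us vs. length us = length hs \<Longrightarrow> length vs = length hs \<Longrightarrow> fsum n (T us vs)) \<Longrightarrow>
     fsum n (\<lambda>f. split_sum hs (\<lambda>us vs. T us vs f))"
  by (induction hs arbitrary: T) (simp_all add: fsum_csum_bind)

lemma split_sum_mult: "split_sum hs (\<lambda>us vs. c * K us vs) = c * split_sum hs K"
  by (induction hs arbitrary: K) (simp_all add: csum_mult)

lemma split_sum_csum:
  "split_sum hs (\<lambda>us vs. csum (\<lambda>u v. K us vs u v) h) = csum (\<lambda>u v. split_sum hs (\<lambda>us vs. K us vs u v)) h"
proof (induction hs arbitrary: K)
  case (Cons g hs)
  then show ?case by (simp add: Cons.IH csum_csum[of _ h g])
qed simp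

lemma split_sum_commute:
  "split_sum hs (\<lambda>us vs. split_sum gs (\<lambda>xs ys. K us vs xs ys)) =
     split_sum gs (\<lambda>xs ys. split_sum hs (\<lambda>us vs. K us vs xs ys))"
  by (induction gs arbitrary: K) (simp_all add: split_sum_csum)

lemma split_sum_append:
  "split_sum (xs @ ys) K = split_sum xs (\<lambda>us vs. split_sum ys (\<lambda>us' vs'. K (us @ us') (vs @ vs')))"
  by (induction xs arbitrary: K) simp_all

lemma lin_split_sum:
  "(\<And>us vs. length us = length hs \<Longrightarrow> length vs = length hs \<Longrightarrow> lin (\<lambda>x. K x us vs)) \<Longrightarrow>
     lin (\<lambda>x. split_sum hs (K x))"
  by (induction hs arbitrary: K) (simp_all add: lin_csum_param)

lemma ml_split_sum:
  assumes "\<And>vs. length vs = n \<Longrightarrow> ml n (\<lambda>us. K us vs)" "\<And>us. length us = n \<Longrightarrow> ml n (K us)"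
  shows "ml n (\<lambda>hs. split_sum hs K)"
  using assms
proof (induction n arbitrary: K)
  case 0
  show ?case by (rule ml_0)
next
  case (Suc n)
  have 1: "lin (\<lambda>u. K (u # us) (v # vs))" "ml n (\<lambda>us. K (u # us) (v # vs))"
    if "length us = n" "length vs = n" for u v us vs
    using Suc.prems(1)[of "v # vs"] that by (auto simp: ml_Suc)
  have 2: "lin (\<lambda>v. K (u # us) (v # vs))" "ml n (\<lambda>vs. K (u # us) (v # vs))"
    if "length us = n" "length vs = n" for u v us vs
    using Suc.prems(2)[of "u # us"] that by (auto simp: ml_Suc)
  \<comment> \<open>In 1 and 2 the multilinearity claims are conditional also on the length of a
    bound word that they do not mention, so a word of length \<open>n\<close> must be
    exhibited.\<close>
  have n: "\<exists>w::'h list. length w = n" by (rule exI[of _ "replicate n 0"]) simp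
  have "ml n (\<lambda>hs. split_sum hs (\<lambda>us vs. K (u # us) (v # vs)))" for u v
    by (rule Suc.IH) (use 1 2 n in blast)+
  moreover have "lin (csum (\<lambda>u v. split_sum hs (\<lambda>us vs. K (u # us) (v # vs))))" if "length hs = n" for hs
    using that by (intro lin_csum lin_split_sum 1 2) simp_all
  moreover have "ml n (\<lambda>hs. csum (\<lambda>u v. split_sum hs (\<lambda>us vs. K (u # us) (v # vs))) x)" for x
    using calculation(1) unfolding ml_iff_lin by (auto intro: lin_csum_param)
  ultimately show ?case by (simp add: ml_Suc)
qed

text \<open>The positions being distinct, the letter at \<open>i\<close> is read exactly once.
  Shuffles of tensor factors get their multilinearity from this.\<close>

lemma lin_map_nth:
  assumes "ml (length S) g" "distinct S" "i \<in> set S" "i < length zs"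
  shows "lin (\<lambda>v. g (map ((!) (zs[i := v])) S))"
proof -
  obtain k where k: "k < length S" "S ! k = i" using assms(3) by (auto simp: in_set_conv_nth)
  have "map ((!) (zs[i := v])) S = (map ((!) zs) S)[k := v]" for v
    using k assms(2,4) by (auto intro!: nth_equalityI simp: nth_list_update nth_eq_iff_index_eq)
  then show ?thesis using assms(1) k(1) by (simp add: ml_iff_lin)
qed

lemma map_nth_update: "i \<notin> set S \<Longrightarrow> map ((!) (zs[i := v])) S = map ((!) zs) S"
  by (auto intro!: map_cong) (metis nth_list_update_neq)

lemma ml_take_drop:
  assumes "ml m F" "ml n G"
  shows "ml (m + n) (\<lambda>zs. F (take m zs) * G (drop m zs))"
  unfolding ml_iff_lin
proof (intro allI impI)
  fix zs :: "'h list" and i assume *: "length zs = m + n" "i < m + n"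
  show "lin (\<lambda>x. F (take m (zs[i := x])) * G (drop m (zs[i := x])))"
  proof (cases "i < m")
    case True
    then have "lin (\<lambda>x. F ((take m zs)[i := x]))" using assms(1) * by (simp add: ml_iff_lin)
    then show ?thesis using True by (simp add: take_update_swap lin_mult_right)
  next
    case False
    then have "lin (\<lambda>x. G ((drop m zs)[i - m := x]))" using assms(2) * by (simp add: ml_iff_lin)
    then show ?thesis using False by (simp add: drop_update_swap lin_mult)
  qed
qed

lemma nth_weave:
  assumes "length us = n" "length vs = n" "s < n"
  shows "concat (map2 (\<lambda>u v. [u, v]) us vs) ! (2 * s) = us ! s"
    "concat (map2 (\<lambda>u v. [u, v]) us vs) ! Suc (2 * s) = vs ! s"
  using assms
proof (induction us arbitrary: vs n s)
  case (Cons u us)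
  {
    case 1
    with Cons.IH(1) show ?case by (cases vs; cases s; auto)
  next
    case 2
    with Cons.IH(2) show ?case by (cases vs; cases s; auto)
  }
qed auto

text \<open>The tensor product of the coproducts of the letters gives the interleaved word u_1 v_1
  u_2 v_2 ...; the shuffle in \<open>comul_power\<close> reads its even positions before its odd
  ones and so separates the legs.\<close>

lemma tens_comul_power:
  assumes "tens n x S"
  shows "tens (2 * n) (comul_power B n x) (\<lambda>f. S (\<lambda>hs. split_sum hs (\<lambda>us vs. f (us @ vs))))"
  unfolding comul_power_def
proof (rule tens_tlift[OF assms])
  fix hs :: "'h list" assume n: "length hs = n"
  have *: "tens (2 * length hs) (tproduct_list B (map (comul B) hs))
      (\<lambda>f. split_sum hs (\<lambda>us vs. f (concat (map2 (\<lambda>u v. [u, v]) us vs))))"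
  proof (induction hs)
    case Nil
    show ?case by (simp add: tproduct_list_def tens_pure)
  next
    case (Cons h hs)
    then show ?case using tens_tprod[OF tens_comul Cons.IH] by (simp add: tproduct_list_def)
  qed
  let ?S = "map (\<lambda>s. 2 * s) [0..<n] @ map (\<lambda>s. 2 * s + 1) [0..<n]"
  let ?G = "\<lambda>zs :: 'h list. map (\<lambda>s. zs ! (2 * s)) [0..<n] @ map (\<lambda>s. zs ! (2 * s + 1)) [0..<n]"
  have "tens (2 * n) (tlift (2 * n) (\<lambda>zs. pure B (?G zs)) (tproduct_list B (map (comul B) hs)))
      (\<lambda>f. split_sum hs (\<lambda>us vs. f (?G (concat (map2 (\<lambda>u v. [u, v]) us vs)))))"
  proof (rule tens_tlift[OF *[unfolded n] tens_pure])
    fix f assume f: "mlin f"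
    show "ml (2 * n) (\<lambda>zs. f (?G zs))"
      unfolding ml_iff_lin
    proof (intro allI impI)
      fix zs :: "'h list" and i assume *: "length zs = 2 * n" "i < 2 * n"
      have "?G zs = map ((!) zs) ?S" for zs by simp
      moreover have "i \<in> set ?S" using *(2) by (cases "even i") (auto elim!: evenE oddE simp: image_iff)
      moreover have "distinct ?S" by (auto simp: distinct_map inj_on_def) presburger
      ultimately show "lin (\<lambda>x. f (?G (zs[i := x])))"
        using lin_map_nth[of ?S f i zs] f * by (simp add: comp_def)
    qed
  qed simp
  moreover have "split_sum hs (\<lambda>us vs. f (?G (concat (map2 (\<lambda>u v. [u, v]) us vs)))) =
      split_sum hs (\<lambda>us vs. f (us @ vs))" for f
    using n by (intro split_sum_cong arg_cong[of _ _ f]) (auto intro!: nth_equalityI simp: nth_weave)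
  ultimately show "tens (2 * n) (tlift (2 * n) (\<lambda>zs. pure B (?G zs)) (tproduct_list B (map (comul B) hs)))
      (\<lambda>f. split_sum hs (\<lambda>us vs. f (us @ vs)))" by simp
next
  fix f assume "mlin f"
  then show "ml n (\<lambda>hs. split_sum hs (\<lambda>us vs. f (us @ vs)))"
    by (intro ml_split_sum multilinear_append) simp_all
qed

primrec iter_split :: "nat \<Rightarrow> 'h list \<Rightarrow> ('h list \<Rightarrow> 'k) \<Rightarrow> 'k" where
  "iter_split 0 hs K = K hs"
| "iter_split (Suc k) hs K = split_sum hs (\<lambda>us vs. iter_split k vs (\<lambda>ws. K (us @ ws)))"

lemma fsum_iter_split: "length hs = n \<Longrightarrow> fsum (Suc k * n) (iter_split k hs)"
proof (induction k arbitrary: hs)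
  case 0
  then show ?case by (simp add: fsum_single)
next
  case (Suc k)
  show ?case
    unfolding iter_split.simps
  proof (rule fsum_split_sum_bind)
    fix us vs :: "'h list" assume "length us = length hs" "length vs = length hs"
    with Suc.prems show "fsum (Suc (Suc k) * n) (\<lambda>f. iter_split k vs (\<lambda>ws. f (us @ ws)))"
      by (intro fsum_bind[OF Suc.IH] fsum_single) simp_all
  qed
qed

lemma ml_iter_split: "mlin f \<Longrightarrow> ml n (\<lambda>hs. iter_split k hs f)"
proof (induction k arbitrary: f)
  case (Suc k)
  show ?case
    unfolding iter_split.simps
  proof (rule ml_split_sum)
    fix vs :: "'h list" assume "length vs = n"
    show "ml n (\<lambda>us. iter_split k vs (\<lambda>ws. f (us @ ws)))"
      by (rule fsum_ml[OF fsum_iter_split]) (use Suc.prems \<open>length vs = n\<close> multilinear_append in auto)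
  next
    fix us :: "'h list" assume "length us = n"
    show "ml n (\<lambda>vs. iter_split k vs (\<lambda>ws. f (us @ ws)))"
      using Suc.prems by (intro Suc.IH) (simp add: multilinear_append)
  qed
qed simp

lemma tens_iter_comul:
  "tens n x S \<Longrightarrow> tens (Suc k * n) (iter_comul B n k x) (\<lambda>f. S (\<lambda>hs. iter_split k hs f))"
proof (induction k arbitrary: x S)
  case (Suc k)
  have "tens (Suc (Suc k) * n) (iter_comul B n (Suc k) x)
      (\<lambda>f. S (\<lambda>hs. split_sum hs (\<lambda>us vs. iter_split k (drop n (us @ vs)) (\<lambda>ws. f (take n (us @ vs) @ ws)))))"
    unfolding iter_comul.simps
  proof (rule tens_tlift[OF tens_comul_power[OF Suc.prems]])
    fix zs :: "'h list" assume zs: "length zs = 2 * n"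
    have "tens (n + Suc k * n) (tprod B (pure B (take n zs)) (iter_comul B n k (pure B (drop n zs))))
       (\<lambda>f. iter_split k (drop n zs) (\<lambda>ws. f (take n zs @ ws)))"
      by (rule tens_tprod[OF tens_pure Suc.IH[OF tens_pure]]) (use zs in simp_all)
    then show "tens (Suc (Suc k) * n) (tprod B (pure B (take n zs)) (iter_comul B n k (pure B (drop n zs))))
       (\<lambda>f. iter_split k (drop n zs) (\<lambda>ws. f (take n zs @ ws)))" by simp
  next
    fix f assume f: "mlin f"
    show "ml (2 * n) (\<lambda>zs. iter_split k (drop n zs) (\<lambda>ws. f (take n zs @ ws)))"
      unfolding ml_iff_lin
    proof (intro allI impI)
      fix zs :: "'h list" and i assume *: "length zs = 2 * n" "i < 2 * n"
      show "lin (\<lambda>x. iter_split k (drop n (zs[i := x])) (\<lambda>ws. f (take n (zs[i := x]) @ ws)))"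
      proof (cases "i < n")
        case True
        have "ml n (\<lambda>us. iter_split k (drop n zs) (\<lambda>ws. f (us @ ws)))"
          by (rule fsum_ml[OF fsum_iter_split]) (use f * multilinear_append in auto)
        then show ?thesis using True * by (simp add: ml_iff_lin take_update_swap)
      next
        case False
        have "ml n (\<lambda>vs. iter_split k vs (\<lambda>ws. f (take n zs @ ws)))"
          using f by (intro ml_iter_split) (simp add: multilinear_append)
        then show ?thesis using False * by (simp add: ml_iff_lin drop_update_swap)
      qed
    qed
  qed
  moreover have "S (\<lambda>hs. split_sum hs (\<lambda>us vs. iter_split k (drop n (us @ vs)) (\<lambda>ws. f (take n (us @ vs) @ ws)))) =
      S (\<lambda>hs. iter_split (Suc k) hs f)" for f
    by (rule fsum_cong[OF tens_fsum[OF Suc.prems]]) (auto intro!: split_sum_cong)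
  ultimately show ?case by simp
qed simp

section \<open>The convolution monoid of functionals on words\<close>

definition cv :: "('h list \<Rightarrow> 'k) \<Rightarrow> ('h list \<Rightarrow> 'k) \<Rightarrow> 'h list \<Rightarrow> 'k" where
  "cv F G hs = split_sum hs (\<lambda>us vs. F us * G vs)"

text \<open>Functionals vanishing on words of the wrong length form a monoid under \<open>cv\<close> with unit \<open>un N\<close>.\<close>

definition fnl :: "nat \<Rightarrow> ('h list \<Rightarrow> 'k) set" where
  "fnl N = {F. ml N F \<and> (\<forall>hs. length hs \<noteq> N \<longrightarrow> F hs = 0)}"

definition res :: "nat \<Rightarrow> ('h list \<Rightarrow> 'k) \<Rightarrow> 'h list \<Rightarrow> 'k" where
  "res N F = (\<lambda>hs. if length hs = N then F hs else 0)"

definition eps :: "'h list \<Rightarrow> 'k" where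
  "eps hs = prod_list (map (counit B) hs)"

definition un :: "nat \<Rightarrow> 'h list \<Rightarrow> 'k" where
  "un N = res N eps"

text \<open>\<open>conv_inverse\<close> is determined only on the tensor power, so functionals on
  tensors are compared after restriction to pure tensors.\<close>

definition dual :: "nat \<Rightarrow> (('k, 'h) tensor \<Rightarrow> 'k) \<Rightarrow> 'h list \<Rightarrow> 'k" where
  "dual N f = res N (\<lambda>hs. f (pure B hs))"

lemma fnl_ml: "F \<in> fnl N \<Longrightarrow> ml N F"
  by (simp add: fnl_def)

lemma fnl_mlin: "F \<in> fnl N \<Longrightarrow> mlin F"
proof -
  assume F: "F \<in> fnl N"
  then have "(\<lambda>hs. if length hs = N then F hs else 0) = F" by (auto simp: fnl_def)
  with ml_restrict[OF fnl_ml[OF F]] show ?thesis by simp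
qed

lemma res_apply: "length hs = N \<Longrightarrow> res N F hs = F hs"
  by (simp add: res_def)

lemma res_fnl: "ml N F \<Longrightarrow> res N F \<in> fnl N"
  unfolding fnl_def res_def using ml_restrict[of N F] by simp

lemma fnl_eqI:
  "F \<in> fnl N \<Longrightarrow> G \<in> fnl N \<Longrightarrow> (\<And>hs. length hs = N \<Longrightarrow> F hs = G hs) \<Longrightarrow> F = G"
  unfolding fnl_def by (rule ext) (metis (mono_tags, lifting) mem_Collect_eq)

lemma eps_simps [simp]: "eps [] = 1" "eps (h # hs) = counit B h * eps hs"
  "eps (us @ vs) = eps us * eps vs"
  by (simp_all add: eps_def)

lemma ml_eps: "ml n eps"
  by (induction n) (simp_all add: ml_0 ml_Suc lin_mult_right lin_counit ml_mult)

lemma un_fnl: "un N \<in> fnl N"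
  unfolding un_def by (rule res_fnl[OF ml_eps])

lemma cv_Nil [simp]: "cv F G [] = F [] * G []"
  by (simp add: cv_def)

lemma cv_Cons: "cv F G (h # hs) = csum (\<lambda>u v. cv (\<lambda>us. F (u # us)) (\<lambda>vs. G (v # vs)) hs) h"
  by (simp add: cv_def)

lemma cv_cong:
  "(\<And>w. length w = length hs \<Longrightarrow> F w = F' w) \<Longrightarrow> (\<And>w. length w = length hs \<Longrightarrow> G w = G' w) \<Longrightarrow>
     cv F G hs = cv F' G' hs"
  unfolding cv_def by (rule split_sum_cong) simp

lemma lin_cv_left: "(\<And>w. length w = length hs \<Longrightarrow> lin (\<lambda>x. F x w)) \<Longrightarrow> lin (\<lambda>x. cv (F x) G hs)"
  unfolding cv_def by (intro lin_split_sum lin_mult_right) simp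

lemma lin_cv_right: "(\<And>w. length w = length hs \<Longrightarrow> lin (\<lambda>x. G x w)) \<Longrightarrow> lin (\<lambda>x. cv F (G x) hs)"
  unfolding cv_def by (intro lin_split_sum lin_mult) simp

lemma cv_csum_left: "cv (\<lambda>w. csum (\<lambda>u v. P u v w) h) Q hs = csum (\<lambda>u v. cv (P u v) Q hs) h"
  by (simp add: cv_def csum_mult_right[symmetric] split_sum_csum)

lemma cv_csum_right: "cv P (\<lambda>w. csum (\<lambda>u v. Q u v w) h) hs = csum (\<lambda>u v. cv P (Q u v) hs) h"
  by (simp add: cv_def csum_mult[symmetric] split_sum_csum)

lemma cv_mult_left: "cv (\<lambda>w. c * F w) G hs = c * cv F G hs"
  by (simp add: cv_def mult.assoc split_sum_mult)

lemma cv_mult_right: "cv F (\<lambda>w. c * G w) hs = c * cv F G hs"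
  by (simp add: cv_def mult.left_commute split_sum_mult)

lemma ml_cv: "ml n F \<Longrightarrow> ml n G \<Longrightarrow> ml n (cv F G)"
proof -
  assume F: "ml n F" and G: "ml n G"
  have "ml n (\<lambda>hs. split_sum hs (\<lambda>us vs. F us * G vs))"
    using F G by (intro ml_split_sum ml_mult) (simp_all add: ml_mult mult.commute[of "F _"])
  then show ?thesis by (simp add: cv_def[abs_def])
qed

lemma cv_fnl: "F \<in> fnl N \<Longrightarrow> G \<in> fnl N \<Longrightarrow> cv F G \<in> fnl N"
proof -
  assume F: "F \<in> fnl N" and G: "G \<in> fnl N"
  have "cv F G hs = 0" if "length hs \<noteq> N" for hs
  proof -
    have "cv F G hs = cv (\<lambda>w. 0 * F w) G hs"
      using that F by (intro cv_cong) (simp_all add: fnl_def)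
    also have "\<dots> = 0 * cv F G hs" by (rule cv_mult_left)
    finally show ?thesis by simp
  qed
  then show ?thesis using ml_cv[OF fnl_ml[OF F] fnl_ml[OF G]] by (simp add: fnl_def)
qed

text \<open>Induction on the word: coassociativity of H regroups the legs of the first letter, the
  induction hypothesis those of the others.\<close>

lemma cv_assoc_apply:
  "ml (length hs) F \<Longrightarrow> ml (length hs) G \<Longrightarrow> ml (length hs) H \<Longrightarrow>
     cv (cv F G) H hs = cv F (cv G H) hs"
proof (induction hs arbitrary: F G H)
  case (Cons h hs)
  let ?\<phi> = "\<lambda>u v w. cv (\<lambda>us. F (u # us)) (cv (\<lambda>vs. G (v # vs)) (\<lambda>ws. H (w # ws))) hs"
  have l: "lin (\<lambda>x. F (x # w))" "lin (\<lambda>x. G (x # w))" "lin (\<lambda>x. H (x # w))"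
    if "length w = length hs" for w
    using Cons.prems that by (simp_all add: ml_Suc)
  have "cv (cv F G) H (h # hs) = csum (\<lambda>x w. csum (\<lambda>u v.
      cv (cv (\<lambda>us. F (u # us)) (\<lambda>vs. G (v # vs))) (\<lambda>ws. H (w # ws)) hs) x) h"
    unfolding cv_Cons by (simp add: cv_csum_left cv_Cons)
  also have "\<dots> = csum (\<lambda>x w. csum (\<lambda>u v. ?\<phi> u v w) x) h"
    using Cons.prems by (simp add: Cons.IH ml_Suc)
  also have "\<dots> = csum (\<lambda>u x. csum (\<lambda>v w. ?\<phi> u v w) x) h"
    by (rule csum_coassoc; intro lin_cv_left lin_cv_right; simp add: l)
  also have "\<dots> = cv F (cv G H) (h # hs)"
    unfolding cv_Cons by (simp add: cv_csum_right cv_Cons)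
  finally show ?case .
qed (simp add: mult.assoc)

lemma cv_assoc:
  "F \<in> fnl N \<Longrightarrow> G \<in> fnl N \<Longrightarrow> H \<in> fnl N \<Longrightarrow> cv (cv F G) H = cv F (cv G H)"
  by (rule fnl_eqI[of _ N]) (auto intro: cv_fnl cv_assoc_apply dest: fnl_ml)

lemma cv_eps_left: "ml (length hs) F \<Longrightarrow> cv eps F hs = F hs"
proof (induction hs arbitrary: F)
  case (Cons h hs)
  then show ?case
    by (simp add: cv_Cons cv_mult_left ml_Suc csum_counit_left)
qed simp

lemma cv_eps_right: "ml (length hs) F \<Longrightarrow> cv F eps hs = F hs"
proof (induction hs arbitrary: F)
  case (Cons h hs)
  then show ?case
    by (simp add: cv_Cons cv_mult_right ml_Suc mult.commute[of "counit B _" "F _"] csum_counit_right)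
qed simp

lemma cv_un_left [simp]: "F \<in> fnl N \<Longrightarrow> cv (un N) F = F"
proof (rule fnl_eqI[of _ N])
  fix hs :: "'h list" assume *: "F \<in> fnl N" "length hs = N"
  have "cv (un N) F hs = cv eps F hs" by (rule cv_cong) (simp_all add: un_def res_def *)
  then show "cv (un N) F hs = F hs" using * by (simp add: cv_eps_left fnl_ml)
qed (simp_all add: cv_fnl un_fnl)

lemma cv_un_right [simp]: "F \<in> fnl N \<Longrightarrow> cv F (un N) = F"
proof (rule fnl_eqI[of _ N])
  fix hs :: "'h list" assume *: "F \<in> fnl N" "length hs = N"
  have "cv F (un N) hs = cv F eps hs" by (rule cv_cong) (simp_all add: un_def res_def *)
  then show "cv F (un N) hs = F hs" using * by (simp add: cv_eps_right fnl_ml)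
qed (simp_all add: cv_fnl un_fnl)

lemma cv_inverse_unique:
  assumes "F \<in> fnl N" "G \<in> fnl N" "H \<in> fnl N" "cv F G = un N" "cv H F = un N"
  shows "G = H"
proof -
  have "G = cv (cv H F) G" using assms by simp
  also have "\<dots> = cv H (cv F G)" by (rule cv_assoc[OF assms(3,1,2)])
  finally show ?thesis using assms by simp
qed

section \<open>From functionals on tensor powers to functionals on words\<close>

lemma pure_in_tensor_power: "length hs = n \<Longrightarrow> pure B hs \<in> tensor_power B n"
proof -
  interpret T: vector_space "tscale :: 'k \<Rightarrow> ('k, 'h) tensor \<Rightarrow> _" by (rule vector_space_tscale)
  show "length hs = n \<Longrightarrow> pure B hs \<in> tensor_power B n"
    unfolding tensor_power_def by (rule T.span_base) simp
qed

lemma dual_fnl: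
  assumes "linear_on_power B n (*) f"
  shows "dual n f \<in> fnl n"
  unfolding dual_def
proof (rule res_fnl)
  note L = assms[unfolded linear_on_power_def]
  have P: "pure B (hs[i := x + y]) = pure B (hs[i := x]) + pure B (hs[i := y])"
    "pure B (hs[i := scl B d x]) = tscale d (pure B (hs[i := x]))"
    if "length hs = n" "i < n" for hs i x y d
    using pure_multilinear[of B n] that by (simp_all add: multilinear_def)
  show "ml n (\<lambda>hs. f (pure B hs))"
    unfolding multilinear_def
  proof (intro allI impI conjI)
    fix hs :: "'h list" and i x y assume *: "length hs = n" "i < n"
    show "f (pure B (hs[i := x + y])) = f (pure B (hs[i := x])) + f (pure B (hs[i := y]))"
      using * L[THEN conjunct1] by (simp add: P pure_in_tensor_power)
  next
    fix hs :: "'h list" and i d x assume *: "length hs = n" "i < n"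
    show "f (pure B (hs[i := scl B d x])) = d * f (pure B (hs[i := x]))"
      using * L[THEN conjunct2] by (simp add: P pure_in_tensor_power)
  qed
qed

text \<open>The bridge from \<open>conv\<close>, which lifts through \<open>comul_power\<close>, to
  \<open>cv\<close>. The lifted function is multilinear because its two factors read disjoint halves
  of the word.\<close>

lemma conv_tens:
  assumes x: "tens n x S" and f: "dual n f \<in> fnl n" and g: "dual n g \<in> fnl n"
  shows "conv B n f g x = S (cv (dual n f) (dual n g))"
proof -
  let ?F = "\<lambda>zs. dual n f (take n zs) * dual n g (drop n zs)"
  have "conv B n f g x = slift (2 * n) ?F (comul_power B n x)"
    unfolding conv_def slift_def
    by (rule arg_cong[of _ _ "comul_power B n x"]) (auto simp: dual_def res_def fun_eq_iff)
  also have "\<dots> = S (\<lambda>hs. split_sum hs (\<lambda>us vs. ?F (us @ vs)))"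
    using ml_take_drop[OF fnl_ml[OF f] fnl_ml[OF g]]
    by (intro tens_slift[OF tens_comul_power[OF x]]) (simp add: mult_2)
  also have "\<dots> = S (cv (dual n f) (dual n g))"
    by (rule fsum_cong[OF tens_fsum[OF x]]) (auto simp: cv_def intro!: split_sum_cong)
  finally show ?thesis .
qed

lemma dual_apply: "length hs = n \<Longrightarrow> dual n f hs = f (pure B hs)"
  by (simp add: dual_def res_apply)

lemma dual_conv:
  assumes "dual n f \<in> fnl n" "dual n g \<in> fnl n"
  shows "dual n (conv B n f g) = cv (dual n f) (dual n g)"
proof
  fix hs
  show "dual n (conv B n f g) hs = cv (dual n f) (dual n g) hs"
  proof (cases "length hs = n")
    case True
    then show ?thesis using conv_tens[OF tens_pure assms] by (simp add: dual_apply)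
  next
    case False
    then show ?thesis using cv_fnl[OF assms] by (simp add: fnl_def dual_def res_def)
  qed
qed

lemma counit_power_tens: "tens n x S \<Longrightarrow> counit_power B n x = S (un n)"
proof -
  assume x: "tens n x S"
  have "counit_power B n x = S eps"
    unfolding counit_power_def eps_def[symmetric] by (rule tens_slift[OF x ml_eps])
  also have "\<dots> = S (un n)" by (rule fsum_cong[OF tens_fsum[OF x]]) (simp add: un_def res_apply)
  finally show ?thesis .
qed

lemma dual_counit_power: "dual n (counit_power B n) = un n"
proof -
  have "counit_power B n (pure B hs) = eps hs" if "length hs = n" for hs
    using counit_power_tens[OF tens_pure[OF that]] that by (simp add: un_def res_apply)
  then show ?thesis by (auto simp: dual_def res_def un_def)
qed

definition cprod :: "nat \<Rightarrow> ('h list \<Rightarrow> 'k) list \<Rightarrow> 'h list \<Rightarrow> 'k" where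
  "cprod N Fs = foldr cv Fs (un N)"

lemma cprod_Nil [simp]: "cprod N [] = un N"
  by (simp add: cprod_def)

lemma cprod_Cons [simp]: "cprod N (F # Fs) = cv F (cprod N Fs)"
  by (simp add: cprod_def)

lemma cprod_fnl: "set Fs \<subseteq> fnl N \<Longrightarrow> cprod N Fs \<in> fnl N"
  by (induction Fs) (simp_all add: un_fnl cv_fnl)

lemma cprod_append:
  "set Fs \<subseteq> fnl N \<Longrightarrow> set Gs \<subseteq> fnl N \<Longrightarrow> cprod N (Fs @ Gs) = cv (cprod N Fs) (cprod N Gs)"
  by (induction Fs) (simp_all add: cprod_fnl cv_assoc[of _ N])

lemma dual_foldr_conv:
  "(\<And>f. f \<in> set fs \<Longrightarrow> dual n f \<in> fnl n) \<Longrightarrow>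
     dual n (foldr (conv B n) fs (counit_power B n)) = cprod n (map (dual n) fs)"
proof (induction fs)
  case (Cons f fs)
  have "cprod n (map (dual n) fs) \<in> fnl n" using Cons.prems by (intro cprod_fnl) auto
  then show ?case using Cons by (simp add: dual_conv)
qed (simp add: dual_counit_power)

text \<open>Neighbouring factors cancel from the middle outwards. One-sided inverses suffice for
  this one-sided conclusion; the other side is obtained by exchanging \<open>X\<close> and
  \<open>Y\<close> and reversing the list.\<close>

lemma cprod_inverse:
  assumes "\<And>e. e \<in> set es \<Longrightarrow> X e \<in> fnl N \<and> Y e \<in> fnl N \<and> cv (X e) (Y e) = un N"
  shows "cv (cprod N (map X es)) (cprod N (map Y (rev es))) = un N"
  using assms
proof (induction es)
  case (Cons e es)
  let ?P = "cprod N (map X es)" and ?Q = "cprod N (map Y (rev es))"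
  have c: "?P \<in> fnl N" "?Q \<in> fnl N" "X e \<in> fnl N" "Y e \<in> fnl N"
    using Cons.prems by (auto intro!: cprod_fnl)
  have "cprod N (map Y (rev (e # es))) = cv ?Q (Y e)"
    using Cons.prems c(4) by (subst rev.simps, subst map_append, subst cprod_append) auto
  then have "cv (cprod N (map X (e # es))) (cprod N (map Y (rev (e # es)))) =
      cv (cv (X e) ?P) (cv ?Q (Y e))" by simp
  also have "\<dots> = cv (X e) (cv (cv ?P ?Q) (Y e))" using c by (simp add: cv_assoc[of _ N] cv_fnl)
  also have "\<dots> = un N" using Cons c by simp
  finally show ?case .
qed (simp add: un_fnl)

lemma dual_conv_inverse_fnl:
  assumes "is_conv_inverse B n f g" "dual n f \<in> fnl n"
  shows "dual n g \<in> fnl n" "cv (dual n f) (dual n g) = un n" "cv (dual n g) (dual n f) = un n"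
proof -
  show g: "dual n g \<in> fnl n" using assms(1) by (intro dual_fnl) (simp add: is_conv_inverse_def)
  have *: "conv B n f g (pure B hs) = counit_power B n (pure B hs)"
    "conv B n g f (pure B hs) = counit_power B n (pure B hs)" if "length hs = n" for hs
    using assms(1) pure_in_tensor_power[OF that] by (auto simp: is_conv_inverse_def)
  have "dual n (conv B n f g) = dual n (counit_power B n)" "dual n (conv B n g f) = dual n (counit_power B n)"
    using * by (auto simp: dual_def res_def)
  then show "cv (dual n f) (dual n g) = un n" "cv (dual n g) (dual n f) = un n"
    by (simp_all add: dual_conv g assms(2) dual_counit_power)
qed

text \<open>\<open>slift n G\<close> witnesses that an inverse exists, so the choice in
  \<open>conv_inverse\<close> is an inverse; uniqueness in the monoid then fixes its values on
  words.\<close>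

lemma dual_conv_inverse:
  assumes "dual n f \<in> fnl n" "G \<in> fnl n" "cv (dual n f) G = un n" "cv G (dual n f) = un n"
  shows "dual n (conv_inverse B n f) = G"
proof -
  have G: "dual n (slift n G) = G"
    using assms(2) tens_slift[OF tens_pure fnl_ml[OF assms(2)]] by (auto simp: dual_def res_def fnl_def)
  have "is_conv_inverse B n f (slift n G)"
    unfolding is_conv_inverse_def
  proof (intro conjI ballI)
    show "linear_on_power B n (*) (slift n G)" by (simp add: linear_on_power_def slift_linear)
  next
    fix x assume "x \<in> tensor_power B n"
    then obtain S where S: "tens n x S" by (rule tens_power)
    show "conv B n f (slift n G) x = counit_power B n x"
      using conv_tens[OF S assms(1), of "slift n G"] assms G counit_power_tens[OF S] by simp
    show "conv B n (slift n G) f x = counit_power B n x"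
      using conv_tens[OF S _ assms(1), of "slift n G"] assms G counit_power_tens[OF S] by simp
  qed
  then have "is_conv_inverse B n f (conv_inverse B n f)" unfolding conv_inverse_def by (rule someI[of "is_conv_inverse B n f"])
  from dual_conv_inverse_fnl[OF this assms(1)] show ?thesis
    using cv_inverse_unique[OF assms(1)] assms by blast
qed

lemma is_conv_inverse_conv_inverse:
  "\<exists>g. is_conv_inverse B n f g \<Longrightarrow> is_conv_inverse B n f (conv_inverse B n f)"
  unfolding conv_inverse_def by (rule someI_ex[of "is_conv_inverse B n f"])

section \<open>Functionals acting on some of the positions\<close>

definition idx :: "(nat \<Rightarrow> bool) \<Rightarrow> nat \<Rightarrow> nat list" where
  "idx P n = filter P [0..<n]"

lemma idx_0 [simp]: "idx P 0 = []"
  by (simp add: idx_def)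

lemma idx_Suc: "idx P (Suc n) = (if P 0 then [0] else []) @ map Suc (idx (\<lambda>i. P (Suc i)) n)"
proof -
  have "[0..<Suc n] = 0 # map Suc [0..<n]" by (simp add: upt_conv_Cons map_Suc_upt del: upt_Suc)
  then show ?thesis by (simp add: idx_def filter_map comp_def)
qed

lemma set_idx: "set (idx P n) = {i. i < n \<and> P i}"
  by (auto simp: idx_def)

lemma distinct_idx: "distinct (idx P n)"
  by (simp add: idx_def)

text \<open>\<open>g\<close> evaluated on the letters at the positions in \<open>P\<close>, times the counits of the other letters.\<close>

primrec opf :: "(nat \<Rightarrow> bool) \<Rightarrow> ('h list \<Rightarrow> 'k) \<Rightarrow> 'h list \<Rightarrow> 'k" where
  "opf P g [] = g []"
| "opf P g (h # hs) = (if P 0 then opf (\<lambda>i. P (Suc i)) (\<lambda>w. g (h # w)) hs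
     else counit B h * opf (\<lambda>i. P (Suc i)) g hs)"

lemma opf_cong:
  "(\<And>w. length w = length (idx P (length hs)) \<Longrightarrow> g w = g' w) \<Longrightarrow> opf P g hs = opf P g' hs"
proof (induction hs arbitrary: P g g')
  case (Cons h hs)
  have "opf (\<lambda>i. P (Suc i)) (\<lambda>w. g (h # w)) hs = opf (\<lambda>i. P (Suc i)) (\<lambda>w. g' (h # w)) hs" if "P 0"
    using that by (intro Cons.IH Cons.prems) (simp add: idx_Suc)
  moreover have "opf (\<lambda>i. P (Suc i)) g hs = opf (\<lambda>i. P (Suc i)) g' hs" if "\<not> P 0"
    using that by (intro Cons.IH Cons.prems) (simp add: idx_Suc)
  ultimately show ?case by simp
qed simp

lemma opf_csum: "opf P (\<lambda>w. csum (\<lambda>u v. K u v w) h) hs = csum (\<lambda>u v. opf P (K u v) hs) h"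
  by (induction hs arbitrary: P K) (simp_all add: csum_mult)

lemma opf_eps: "opf P eps hs = eps hs"
proof -
  have m: "opf P (\<lambda>w. c * g w) hs = c * opf P g hs" for P c g hs
    by (induction hs arbitrary: P g) simp_all
  show ?thesis by (induction hs arbitrary: P) (simp_all add: m)
qed

text \<open>At positions in \<open>P\<close> both sides split the letter between \<open>g\<close>
  and \<open>g'\<close>; elsewhere two counits merge into one by the counit axiom. So
  \<open>opf P\<close> is multiplicative, and an inverse of R yields an inverse of each factor of
  J.\<close>

lemma opf_cv: "cv (opf P g) (opf P g') hs = opf P (cv g g') hs"
proof (induction hs arbitrary: P g g')
  case (Cons h hs)
  have "csum (\<lambda>u v. counit B u * (counit B v * c)) h = counit B h * c" for c
    by (rule csum_counit_left) (intro lin_mult_right lin_counit)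
  then show ?case
    by (simp add: cv_Cons cv_mult_left cv_mult_right Cons.IH opf_csum[symmetric])
qed simp

lemma lin_opf:
  "(\<And>w. length w = length (idx P (length hs)) \<Longrightarrow> lin (\<lambda>x. G x w)) \<Longrightarrow> lin (\<lambda>x. opf P (G x) hs)"
proof (induction hs arbitrary: P G)
  case (Cons h hs)
  have "lin (\<lambda>x. opf (\<lambda>i. P (Suc i)) (\<lambda>w. G x (h # w)) hs)" if "P 0"
    using that by (intro Cons.IH Cons.prems) (simp add: idx_Suc)
  moreover have "lin (\<lambda>x. opf (\<lambda>i. P (Suc i)) (G x) hs)" if "\<not> P 0"
    using that by (intro Cons.IH Cons.prems) (simp add: idx_Suc)
  ultimately show ?case by (cases "P 0") (simp_all add: lin_mult)
qed simp

lemma ml_opf: "ml (length (idx P n)) g \<Longrightarrow> ml n (opf P g)"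
proof (induction n arbitrary: P g)
  case (Suc n)
  show ?case
  proof (cases "P 0")
    case True
    with Suc.prems have "ml (Suc (length (idx (\<lambda>i. P (Suc i)) n))) g" by (simp add: idx_Suc)
    with True show ?thesis unfolding ml_Suc by (auto intro!: lin_opf Suc.IH)
  next
    case False
    with Suc.prems have "ml (length (idx (\<lambda>i. P (Suc i)) n)) g" by (simp add: idx_Suc)
    with False show ?thesis unfolding ml_Suc by (auto intro!: lin_mult_right lin_counit ml_mult Suc.IH)
  qed
qed (simp add: ml_0)

lemma opf_apply:
  "opf P g hs = g (map ((!) hs) (idx P (length hs))) *
     prod_list (map (\<lambda>i. counit B (hs ! i)) (idx (\<lambda>i. \<not> P i) (length hs)))"
proof (induction hs arbitrary: P g)
  case (Cons h hs)
  then show ?case by (simp add: idx_Suc comp_def)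
qed simp

lemma res_cv: "cv (res N F) (res N G) = res N (cv F G)"
proof
  fix hs
  show "cv (res N F) (res N G) hs = res N (cv F G) hs"
  proof (cases "length hs = N")
    case True
    then show ?thesis by (simp add: res_def cong: cv_cong)
  next
    case False
    then have "cv (res N F) (res N G) hs = split_sum hs (\<lambda>us vs. 0 * 0)"
      unfolding cv_def by (intro split_sum_cong) (simp add: res_def)
    also have "\<dots> = 0" by (subst split_sum_mult) simp
    finally show ?thesis using False by (simp add: res_def)
  qed
qed

section \<open>Functionals supported at disjoint positions commute\<close>

text \<open>\<open>F\<close> depends on the letter at position \<open>p\<close> only through its counit; this uses \<open>\<epsilon>(1) = 1\<close>.\<close>

definition epsat :: "nat \<Rightarrow> ('h list \<Rightarrow> 'k) \<Rightarrow> bool" where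
  "epsat p F \<longleftrightarrow> (\<forall>hs. p < length hs \<longrightarrow> F hs = counit B (hs ! p) * F (hs[p := 1]))"

lemma epsat_0: "epsat 0 F \<Longrightarrow> F (h # hs) = counit B h * F (1 # hs)"
  unfolding epsat_def by (drule spec[of _ "h # hs"]) simp

lemma epsat_Suc: "epsat (Suc p) F \<Longrightarrow> epsat p (\<lambda>w. F (h # w))"
  unfolding epsat_def
proof (intro allI impI)
  fix hs :: "'h list"
  assume "\<forall>hs. Suc p < length hs \<longrightarrow> F hs = counit B (hs ! Suc p) * F (hs[Suc p := 1])" "p < length hs"
  from this(1)[rule_format, of "h # hs"] this(2)
  show "F (h # hs) = counit B (hs ! p) * F (h # hs[p := 1])" by simp
qed

lemma epsat_opf: "\<not> P p \<Longrightarrow> epsat p (opf P g)"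
proof -
  have "\<not> P p \<Longrightarrow> p < length hs \<Longrightarrow> opf P g hs = counit B (hs ! p) * opf P g (hs[p := 1])" for hs
  proof (induction hs arbitrary: P g p)
    case (Cons h hs)
    show ?case
    proof (cases p)
      case 0
      then show ?thesis using Cons.prems by (simp add: counit_one)
    next
      case (Suc q)
      have "opf (\<lambda>i. P (Suc i)) k hs = counit B (hs ! q) * opf (\<lambda>i. P (Suc i)) k (hs[q := 1])" for k
        using Cons.prems Suc by (intro Cons.IH) simp_all
      then show ?thesis using Suc by simp
    qed
  qed simp
  then show "\<not> P p \<Longrightarrow> epsat p (opf P g)" unfolding epsat_def by blast
qed

lemma epsat_res: "epsat p F \<Longrightarrow> epsat p (res N F)"
  unfolding epsat_def res_def by (metis length_list_update mult_zero_right)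

text \<open>At each position one of the functionals takes only the counit, so the counit axiom hands
  the undivided letter to the other one, whichever factor comes first.\<close>

lemma cv_commute_apply:
  "ml (length hs) F \<Longrightarrow> ml (length hs) G \<Longrightarrow> (\<And>p. p < length hs \<Longrightarrow> epsat p F \<or> epsat p G) \<Longrightarrow>
     cv F G hs = cv G F hs"
proof (induction hs arbitrary: F G)
  case (Cons h hs)
  have IH: "cv (\<lambda>w. F (x # w)) (\<lambda>w. G (y # w)) hs = cv (\<lambda>w. G (y # w)) (\<lambda>w. F (x # w)) hs" for x y
  proof (rule Cons.IH)
    show "ml (length hs) (\<lambda>w. F (x # w))" "ml (length hs) (\<lambda>w. G (y # w))"
      using Cons.prems by (simp_all add: ml_Suc)
    show "p < length hs \<Longrightarrow> epsat p (\<lambda>w. F (x # w)) \<or> epsat p (\<lambda>w. G (y # w))" for p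
      using Cons.prems(3)[of "Suc p"] by (auto intro: epsat_Suc)
  qed
  have l: "lin (\<lambda>x. F (x # w))" "lin (\<lambda>x. G (x # w))" if "length w = length hs" for w
    using Cons.prems that by (simp_all add: ml_Suc)
  consider "epsat 0 F" | "epsat 0 G" using Cons.prems(3)[of 0] by auto
  then show ?case
  proof cases
    case 1
    have "cv F G (h # hs) = csum (\<lambda>u v. counit B u * cv (\<lambda>w. F (1 # w)) (\<lambda>w. G (v # w)) hs) h"
      unfolding cv_Cons by (subst epsat_0[OF 1]) (simp add: cv_mult_left)
    also have "\<dots> = cv (\<lambda>w. F (1 # w)) (\<lambda>w. G (h # w)) hs"
      by (rule csum_counit_left) (intro lin_cv_right l)
    also have "\<dots> = cv (\<lambda>w. G (h # w)) (\<lambda>w. F (1 # w)) hs" by (rule IH)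
    also have "\<dots> = csum (\<lambda>u v. cv (\<lambda>w. G (u # w)) (\<lambda>w. F (1 # w)) hs * counit B v) h"
      by (rule csum_counit_right[symmetric]) (intro lin_cv_left l)
    also have "\<dots> = cv G F (h # hs)"
      unfolding cv_Cons by (subst epsat_0[OF 1, of _ "_ :: 'h list"]) (simp add: cv_mult_right mult.commute)
    finally show ?thesis .
  next
    case 2
    have "cv F G (h # hs) = csum (\<lambda>u v. cv (\<lambda>w. F (u # w)) (\<lambda>w. G (1 # w)) hs * counit B v) h"
      unfolding cv_Cons by (subst epsat_0[OF 2]) (simp add: cv_mult_right mult.commute)
    also have "\<dots> = cv (\<lambda>w. F (h # w)) (\<lambda>w. G (1 # w)) hs"
      by (rule csum_counit_right) (intro lin_cv_left l)
    also have "\<dots> = cv (\<lambda>w. G (1 # w)) (\<lambda>w. F (h # w)) hs" by (rule IH)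
    also have "\<dots> = csum (\<lambda>u v. counit B u * cv (\<lambda>w. G (1 # w)) (\<lambda>w. F (v # w)) hs) h"
      by (rule csum_counit_left[symmetric]) (intro lin_cv_right l)
    also have "\<dots> = cv G F (h # hs)"
      unfolding cv_Cons by (subst epsat_0[OF 2]) (simp add: cv_mult_left)
    finally show ?thesis .
  qed
qed simp

lemma cv_commute:
  assumes "F \<in> fnl N" "G \<in> fnl N" "\<And>p. p < N \<Longrightarrow> epsat p F \<or> epsat p G"
  shows "cv F G = cv G F"
  by (rule fnl_eqI[of _ N]) (use assms in \<open>auto intro!: cv_fnl cv_commute_apply dest: fnl_ml\<close>)

definition pairop :: "nat \<Rightarrow> nat \<Rightarrow> nat \<Rightarrow> ('h list \<Rightarrow> 'k) \<Rightarrow> 'h list \<Rightarrow> 'k" where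
  "pairop N p q F = res N (opf (\<lambda>i. i = p \<or> i = q) F)"

lemma idx_pair: "p < q \<Longrightarrow> q < N \<Longrightarrow> idx (\<lambda>i. i = p \<or> i = q) N = [p, q]"
proof -
  assume *: "p < q" "q < N"
  have "[0..<N] = [0..<p] @ p # [Suc p..<q] @ q # [Suc q..<N]"
    using * upt_add_eq_append[of 0 p "q - p"] upt_add_eq_append[of 0 q "N - q"]
    by (simp add: upt_conv_Cons)
  then show ?thesis using * by (simp add: idx_def filter_empty_conv)
qed

lemma pairop_fnl: "p < q \<Longrightarrow> q < N \<Longrightarrow> F \<in> fnl 2 \<Longrightarrow> pairop N p q F \<in> fnl N"
  unfolding pairop_def by (rule res_fnl, rule ml_opf) (simp add: idx_pair fnl_ml numeral_2_eq_2)

lemma pairop_cv: "cv (pairop N p q F) (pairop N p q G) = pairop N p q (cv F G)"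
  unfolding pairop_def res_cv by (auto simp: res_def opf_cv fun_eq_iff)

lemma pairop_un: "p < q \<Longrightarrow> q < N \<Longrightarrow> pairop N p q (un 2) = un N"
proof
  fix hs assume *: "p < q" "q < N"
  have "opf (\<lambda>i. i = p \<or> i = q) (un 2) hs = opf (\<lambda>i. i = p \<or> i = q) eps hs" if "length hs = N"
    by (rule opf_cong) (simp add: that * idx_pair un_def res_apply)
  then show "pairop N p q (un 2) hs = un N hs"
    by (simp add: pairop_def un_def res_def opf_eps)
qed

lemma pairop_commute:
  assumes "p < q" "q < N" "p' < q'" "q' < N" "{p, q} \<inter> {p', q'} = {}" "F \<in> fnl 2" "G \<in> fnl 2"
  shows "cv (pairop N p q F) (pairop N p' q' G) = cv (pairop N p' q' G) (pairop N p q F)"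
proof (rule cv_commute)
  show "epsat r (pairop N p q F) \<or> epsat r (pairop N p' q' G)" for r
    unfolding pairop_def using assms(5) by (cases "r = p \<or> r = q") (auto intro!: epsat_res epsat_opf)
qed (use assms pairop_fnl in auto)

text \<open>Positions are counted from 1 in \<open>functional_at\<close> and from 0 in
  \<open>pairop\<close>, hence the successors. The product of counits over a set is rewritten as a
  product over the complementary index list.\<close>

lemma dual_functional_at:
  assumes "p < q" "q < N" "dual 2 f \<in> fnl 2"
  shows "dual N (functional_at B N [Suc p, Suc q] f) = pairop N p q (dual 2 f)"
proof
  fix hs :: "'h list"
  let ?P = "\<lambda>i. i = p \<or> i = q"
  let ?F = "\<lambda>hs. f (pure B (map (\<lambda>i. hs ! (i - 1)) [Suc p, Suc q])) *
     (\<Prod>j\<in>{1..N} - set [Suc p, Suc q]. counit B (hs ! (j - 1)))"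
  have F: "?F hs = opf ?P (dual 2 f) hs" if "length hs = N" for hs
  proof -
    have "(\<Prod>j\<in>{1..N} - set [Suc p, Suc q]. counit B (hs ! (j - 1))) =
        (\<Prod>j\<in>set (idx (\<lambda>i. \<not> ?P i) N). counit B (hs ! j))"
      by (rule prod.reindex_bij_witness[of _ Suc "\<lambda>j. j - 1"]) (auto simp: set_idx)
    also have "\<dots> = prod_list (map (\<lambda>j. counit B (hs ! j)) (idx (\<lambda>i. \<not> ?P i) N))"
      by (rule prod.distinct_set_conv_list[OF distinct_idx])
    finally show ?thesis using that assms by (simp add: opf_apply idx_pair dual_apply)
  qed
  have "ml N ?F"
    using fnl_ml[OF pairop_fnl[OF assms]] unfolding pairop_def
    by (subst ml_cong[of N ?F "res N (opf ?P (dual 2 f))"]) (simp_all only: F res_apply)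
  then show "dual N (functional_at B N [Suc p, Suc q] f) hs = pairop N p q (dual 2 f) hs"
    unfolding functional_at_def dual_def pairop_def res_def
    using tens_slift[OF tens_pure, of hs N ?F] F[of hs] by (simp add: dual_def res_def)
qed

section \<open>The twisted multiplication\<close>

lemma lin_comp_mult_left: "lin \<phi> \<Longrightarrow> lin (\<lambda>x. \<phi> (x * y))"
  by (simp add: lin_def distrib_right scale_mult_left)

lemma lin_comp_mult_right: "lin \<phi> \<Longrightarrow> lin (\<lambda>x. \<phi> (y * x))"
  by (simp add: lin_def distrib_left scale_mult_right)

definition fmul :: "nat \<Rightarrow> ('h list \<Rightarrow> 'k) \<Rightarrow> 'h list \<Rightarrow> 'k" where
  "fmul n f = res (2 * n) (\<lambda>zs. f (map2 (*) (take n zs) (drop n zs)))"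

lemma fmul_fnl:
  assumes "ml n f"
  shows "fmul n f \<in> fnl (2 * n)"
  unfolding fmul_def
proof (rule res_fnl, unfold ml_iff_lin, intro allI impI)
  fix zs :: "'h list" and i assume *: "length zs = 2 * n" "i < 2 * n"
  let ?w = "map2 (*) (take n zs) (drop n zs)"
  have l: "lin (\<lambda>x. f (?w[j := x]))" if "j < n" for j
    using assms that * by (simp add: ml_iff_lin)
  show "lin (\<lambda>x. f (map2 (*) (take n (zs[i := x])) (drop n (zs[i := x]))))"
  proof (cases "i < n")
    case True
    then have "map2 (*) (take n (zs[i := x])) (drop n (zs[i := x])) = ?w[i := x * zs ! (n + i)]" for x
      using * by (auto intro!: nth_equalityI simp: nth_list_update)
    then show ?thesis using lin_comp_mult_left[OF l[OF True]] by simp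
  next
    case False
    then have "map2 (*) (take n (zs[i := x])) (drop n (zs[i := x])) = ?w[i - n := zs ! (i - n) * x]" for x
      using * by (auto intro!: nth_equalityI simp: nth_list_update)
    moreover have "i - n < n" using False * by simp
    ultimately show ?thesis using lin_comp_mult_right[OF l, of "i - n"] by simp
  qed
qed

lemma tens_tmult:
  assumes "length p = n" "length q = n"
  shows "tens n (tmult B n (pure B p) (pure B q)) (\<lambda>f. f (map2 (*) p q))"
proof -
  have "tens n (tmult B n (pure B p) (pure B q))
      (\<lambda>f. f (map2 (*) (take n (p @ q)) (drop n (p @ q))))"
    unfolding tmult_def
  proof (rule tens_tlift[where S = "\<lambda>f. f (p @ q)" and
        T = "\<lambda>zs f. f (map2 (*) (take n zs) (drop n zs))"])
    show "tens (2 * n) (tprod B (pure B p) (pure B q)) (\<lambda>f. f (p @ q))"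
      using assms by (simp add: tprod_pure tens_pure)
  next
    fix f assume "mlin f"
    then have "ml (2 * n) (fmul n f)" by (simp add: fnl_ml fmul_fnl)
    then show "ml (2 * n) (\<lambda>zs. f (map2 (*) (take n zs) (drop n zs)))"
      by (subst ml_cong[of _ _ "fmul n f"]) (simp_all add: fmul_def res_apply)
  qed (simp add: tens_pure)
  then show ?thesis using assms by simp
qed

lemma block_eq_map_nth:
  "length zs = m \<Longrightarrow> b * n + n \<le> m \<Longrightarrow> take n (drop (b * n) zs) = map ((!) zs) [b * n..<b * n + n]"
  by (auto intro!: nth_equalityI)

lemma lin_three_blocks:
  assumes "ml (length S) F" "ml (length T) G" "ml (length U) H"
    and "distinct (S @ T @ U)" "i \<in> set (S @ T @ U)" "i < length zs"
  shows "lin (\<lambda>v. F (map ((!) (zs[i := v])) S) * G (map ((!) (zs[i := v])) T) * H (map ((!) (zs[i := v])) U))"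
proof -
  consider "i \<in> set S" "i \<notin> set T" "i \<notin> set U" | "i \<notin> set S" "i \<in> set T" "i \<notin> set U"
    | "i \<notin> set S" "i \<notin> set T" "i \<in> set U"
    using assms by auto
  then show ?thesis
    by cases (use assms in \<open>auto simp: map_nth_update intro!: lin_mult_right lin_mult lin_map_nth\<close>)
qed

text \<open>Blocks 0 to 2 are the three Sweedler factors of \<open>xs\<close>, blocks 3 to 5 those
  of \<open>ys\<close>. Exchanging the second split of \<open>xs\<close> with the first split of
  \<open>ys\<close> brings equally numbered factors together, which gives a triple convolution on
  the joined word.\<close>

lemma iter_split_cv:
  assumes "length xs = n" "length ys = n"
  shows "iter_split 2 xs (\<lambda>as. iter_split 2 ys (\<lambda>bs.
      let blk = (\<lambda>b. take n (drop (b * n) (as @ bs))) in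
        K (blk 0 @ blk 3) * J (blk 2 @ blk 5) * M (blk 1 @ blk 4))) = cv K (cv M J) (xs @ ys)"
proof -
  have "iter_split 2 xs (\<lambda>as. iter_split 2 ys (\<lambda>bs.
      let blk = (\<lambda>b. take n (drop (b * n) (as @ bs))) in
        K (blk 0 @ blk 3) * J (blk 2 @ blk 5) * M (blk 1 @ blk 4))) =
    split_sum xs (\<lambda>u v. split_sum v (\<lambda>v1 v2. split_sum ys (\<lambda>p q. split_sum q (\<lambda>q1 q2.
      K (u @ p) * J (v2 @ q2) * M (v1 @ q1)))))"
    unfolding numeral_2_eq_2 iter_split.simps
    by (intro split_sum_cong) (simp add: assms Let_def)
  also have "\<dots> = split_sum xs (\<lambda>u v. split_sum ys (\<lambda>p q. split_sum v (\<lambda>v1 v2. split_sum q (\<lambda>q1 q2.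
      K (u @ p) * (M (v1 @ q1) * J (v2 @ q2))))))"
    by (rule split_sum_cong, rule trans[OF split_sum_commute]) (simp only: mult_ac)
  also have "\<dots> = cv K (cv M J) (xs @ ys)"
    by (simp add: cv_def split_sum_append split_sum_mult)
  finally show ?thesis .
qed

lemma tens_twisted_mult:
  assumes x: "tens n x S" and y: "tens n y T"
    and J: "dual (2 * n) (twist_J B R n c) \<in> fnl (2 * n)" (is "?J \<in> _")
    and K: "dual (2 * n) (conv_inverse B (2 * n) (twist_J B R n c)) \<in> fnl (2 * n)" (is "?K \<in> _")
  shows "tens n (twisted_mult B R n c x y)
    (\<lambda>f. S (\<lambda>xs. T (\<lambda>ys. cv ?K (cv (fmul n f) ?J) (xs @ ys))))"
proof -
  let ?blk = "\<lambda>zs b. take n (drop (b * n) zs)"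
  let ?\<Phi> = "\<lambda>f zs. let blk = ?blk zs in
     ?K (blk 0 @ blk 3) * ?J (blk 2 @ blk 5) * fmul n f (blk 1 @ blk 4)"
  have X: "tens (3 * n) (iter_comul B n 2 x) (\<lambda>f. S (\<lambda>xs. iter_split 2 xs f))"
    using tens_iter_comul[OF x, of 2] by simp
  have Y: "tens (3 * n) (iter_comul B n 2 y) (\<lambda>f. T (\<lambda>ys. iter_split 2 ys f))"
    using tens_iter_comul[OF y, of 2] by simp
  have "tens n (twisted_mult B R n c x y)
      (\<lambda>f. S (\<lambda>xs. iter_split 2 xs (\<lambda>as. T (\<lambda>ys. iter_split 2 ys (\<lambda>bs. ?\<Phi> f (as @ bs))))))"
    unfolding twisted_mult_def
  proof (rule tens_tlift[where T = "\<lambda>zs f. ?\<Phi> f zs" and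
        S = "\<lambda>f. S (\<lambda>xs. iter_split 2 xs (\<lambda>as. T (\<lambda>ys. iter_split 2 ys (\<lambda>bs. f (as @ bs)))))"])
    show "tens (6 * n) (tprod B (iter_comul B n 2 x) (iter_comul B n 2 y))
        (\<lambda>f. S (\<lambda>xs. iter_split 2 xs (\<lambda>as. T (\<lambda>ys. iter_split 2 ys (\<lambda>bs. f (as @ bs))))))"
      using tens_tprod[OF X Y] by simp
  next
    fix zs :: "'h list" assume zs: "length zs = 6 * n"
    have l: "length (?blk zs b) = n" if "b < 6" for b
    proof -
      have "b * n + n \<le> 6 * n" using that mult_le_mono1[of "Suc b" 6 n] by simp
      then show ?thesis by (simp add: block_eq_map_nth[OF zs])
    qed
    show "tens n (let blk = ?blk zs in
       tscale (conv_inverse B (2 * n) (twist_J B R n c) (pure B (blk 0 @ blk 3)) *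
               twist_J B R n c (pure B (blk 2 @ blk 5)))
              (tmult B n (pure B (blk 1)) (pure B (blk 4)))) (\<lambda>f. ?\<Phi> f zs)"
      unfolding Let_def
      by (rule tens_cong[OF tens_tscale[OF tens_tmult]])
        (simp_all add: l[of 0, simplified] l[of 1, simplified] l[of 2, simplified] l[of 3, simplified]
          l[of 4, simplified] l[of 5, simplified] dual_apply fmul_def res_apply)
  next
    fix f assume "mlin f"
    then have M: "fmul n f \<in> fnl (2 * n)" by (intro fmul_fnl) simp
    \<comment> \<open>The three factors read disjoint pairs of blocks that together cover all
      \<open>6 * n\<close> positions, so each letter occurs in exactly one factor.\<close>
    let ?I = "\<lambda>b. [b * n..<b * n + n]"
    let ?S = "?I 0 @ ?I 3" and ?T = "?I 2 @ ?I 5" and ?U = "?I 1 @ ?I 4"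
    show "ml (6 * n) (?\<Phi> f)"
      unfolding ml_iff_lin
    proof (intro allI impI)
      fix zs :: "'h list" and i assume *: "length zs = 6 * n" "i < 6 * n"
      have e: "?\<Phi> f zs = ?K (map ((!) zs) ?S) * ?J (map ((!) zs) ?T) * fmul n f (map ((!) zs) ?U)"
        if "length zs = 6 * n" for zs :: "'h list"
      proof -
        have bl: "?blk zs b = map ((!) zs) (?I b)" if "b < 6" for b
        proof -
          have "b * n + n \<le> 6 * n" using that mult_le_mono1[of "Suc b" 6 n] by simp
          then show ?thesis by (rule block_eq_map_nth[OF \<open>length zs = 6 * n\<close>])
        qed
        have lt: "(0::nat) < 6" "(1::nat) < 6" "(2::nat) < 6" "(3::nat) < 6" "(4::nat) < 6" "(5::nat) < 6"
          by simp_all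
        show ?thesis unfolding Let_def map_append lt[THEN bl] ..
      qed
      have "lin (\<lambda>v. ?K (map ((!) (zs[i := v])) ?S) * ?J (map ((!) (zs[i := v])) ?T) *
          fmul n f (map ((!) (zs[i := v])) ?U))"
      proof (rule lin_three_blocks)
        show "distinct (?S @ ?T @ ?U)" by auto
        show "i \<in> set (?S @ ?T @ ?U)" using *(2) by auto
      qed (use * J K M in \<open>simp_all add: mult_2[symmetric] fnl_ml\<close>)
      then show "lin (\<lambda>v. ?\<Phi> f (zs[i := v]))" by (subst e) (simp_all add: *)
    qed
  qed
  moreover have "S (\<lambda>xs. iter_split 2 xs (\<lambda>as. T (\<lambda>ys. iter_split 2 ys (\<lambda>bs. ?\<Phi> f (as @ bs))))) =
      S (\<lambda>xs. T (\<lambda>ys. cv ?K (cv (fmul n f) ?J) (xs @ ys)))" for f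
  proof (rule fsum_cong[OF tens_fsum[OF x]])
    fix xs :: "'h list" assume xs: "length xs = n"
    have "iter_split 2 xs (\<lambda>as. T (\<lambda>ys. iter_split 2 ys (\<lambda>bs. ?\<Phi> f (as @ bs)))) =
        T (\<lambda>ys. iter_split 2 xs (\<lambda>as. iter_split 2 ys (\<lambda>bs. ?\<Phi> f (as @ bs))))"
      by (rule fsum_commute[OF fsum_iter_split[OF xs] tens_fsum[OF y]])
    also have "\<dots> = T (\<lambda>ys. cv ?K (cv (fmul n f) ?J) (xs @ ys))"
      by (rule fsum_cong[OF tens_fsum[OF y]]) (rule iter_split_cv[OF xs])
    finally show "iter_split 2 xs (\<lambda>as. T (\<lambda>ys. iter_split 2 ys (\<lambda>bs. ?\<Phi> f (as @ bs)))) =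
      T (\<lambda>ys. cv ?K (cv (fmul n f) ?J) (xs @ ys))" .
  qed
  ultimately show ?thesis by (rule tens_cong)
qed

section \<open>Reordering convolution products\<close>

lemma cprod_commute:
  assumes "F \<in> fnl N" "\<And>G. G \<in> set Gs \<Longrightarrow> G \<in> fnl N \<and> cv F G = cv G F"
  shows "cv F (cprod N Gs) = cv (cprod N Gs) F"
  using assms(2)
proof (induction Gs)
  case (Cons G Gs)
  have P: "cprod N Gs \<in> fnl N" using Cons.prems by (intro cprod_fnl) auto
  have G: "G \<in> fnl N" "cv F G = cv G F" using Cons.prems by auto
  have "cv F (cprod N (G # Gs)) = cv (cv F G) (cprod N Gs)" using assms P G(1) by (simp add: cv_assoc[of _ N])
  also have "\<dots> = cv G (cv F (cprod N Gs))" unfolding G(2) using assms P G(1) by (simp add: cv_assoc[of _ N])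
  also have "\<dots> = cv G (cv (cprod N Gs) F)" using Cons by simp
  finally show ?case using assms P G(1) by (simp add: cv_assoc[of _ N])
qed (use assms in simp)

text \<open>Each \<open>x b\<close> moves to the right through the blocks of the other indices, and
  the \<open>x b\<close> keep their order among themselves. In the application \<open>A b\<close> is
  a column and \<open>x b\<close> its entry in a newly added row.\<close>

lemma cprod_interleave:
  assumes "distinct bs"
    and "\<And>b. b \<in> set bs \<Longrightarrow> x b \<in> fnl N \<and> set (A b) \<subseteq> fnl N"
    and "\<And>b b' F. b \<in> set bs \<Longrightarrow> b' \<in> set bs \<Longrightarrow> b \<noteq> b' \<Longrightarrow> F \<in> set (A b') \<Longrightarrow> cv (x b) F = cv F (x b)"
  shows "cprod N (concat (map (\<lambda>b. A b @ [x b]) bs)) = cv (cprod N (concat (map A bs))) (cprod N (map x bs))"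
  using assms
proof (induction bs)
  case (Cons b bs)
  let ?A = "cprod N (concat (map A bs))" and ?x = "cprod N (map x bs)"
  have f: "set (concat (map (\<lambda>b. A b @ [x b]) bs)) \<subseteq> fnl N" "set (concat (map A bs)) \<subseteq> fnl N"
    "set (A b) \<subseteq> fnl N" "x b \<in> fnl N" "set (map x bs) \<subseteq> fnl N"
    using Cons.prems(2) by auto
  note g = f(1-3,5)[THEN cprod_fnl]
  have "cprod N (concat (map (\<lambda>b. A b @ [x b]) (b # bs))) =
      cv (cprod N (A b)) (cv (x b) (cprod N (concat (map (\<lambda>b. A b @ [x b]) bs))))"
    using f cprod_append[OF f(3), of "x b # concat (map (\<lambda>b. A b @ [x b]) bs)"] by simp
  also have "cprod N (concat (map (\<lambda>b. A b @ [x b]) bs)) = cv ?A ?x"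
  proof (rule Cons.IH)
    show "distinct bs" "\<And>b. b \<in> set bs \<Longrightarrow> x b \<in> fnl N \<and> set (A b) \<subseteq> fnl N" using Cons.prems by auto
    show "cv (x b) F = cv F (x b)" if "b \<in> set bs" "b' \<in> set bs" "b \<noteq> b'" "F \<in> set (A b')" for b b' F
      using that by (intro Cons.prems(3)) auto
  qed
  also have "cv (x b) (cv ?A ?x) = cv (cv (x b) ?A) ?x" using f(4) g by (simp add: cv_assoc[of _ N])
  also have "cv (x b) ?A = cv ?A (x b)"
  proof (rule cprod_commute[OF f(4)])
    fix F assume "F \<in> set (concat (map A bs))"
    then obtain b' where b': "b' \<in> set bs" "F \<in> set (A b')" by auto
    moreover have "b \<noteq> b'" using b' Cons.prems(1) by auto
    ultimately show "F \<in> fnl N \<and> cv (x b) F = cv F (x b)"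
      using Cons.prems(2)[of b'] Cons.prems(3)[of b b' F] by auto
  qed
  also have "cv (cprod N (A b)) (cv (cv ?A (x b)) ?x) =
      cv (cprod N (concat (map A (b # bs)))) (cprod N (map x (b # bs)))"
    using f g cprod_append[OF f(3) f(2)] by (simp add: cv_assoc[of _ N] cv_fnl)
  finally show ?case .
qed (simp add: un_fnl)

section \<open>Convolution products in Sweedler notation\<close>

text \<open>\<open>K\<close> receives \<open>r\<close> legs and one further leg goes into the
  counit. This makes \<open>r = 0\<close> meaningful and lets operations split off legs one at a
  time without knowing which is the last.\<close>

primrec legs :: "nat \<Rightarrow> ('h list \<Rightarrow> 'k) \<Rightarrow> 'h \<Rightarrow> 'k" where
  "legs 0 K h = counit B h * K []"
| "legs (Suc r) K h = csum (\<lambda>u v. legs r (\<lambda>l. K (u # l)) v) h"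

primrec multi_legs :: "'h list \<Rightarrow> (nat \<Rightarrow> nat) \<Rightarrow> ('h list list \<Rightarrow> 'k) \<Rightarrow> 'k" where
  "multi_legs [] r K = K []"
| "multi_legs (h # hs) r K = legs (r 0) (\<lambda>l. multi_legs hs (\<lambda>i. r (Suc i)) (\<lambda>ls. K (l # ls))) h"

text \<open>Splits only the letters at the positions in \<open>P\<close>; the second list keeps the other letters whole.\<close>

primrec psplit :: "'h list \<Rightarrow> (nat \<Rightarrow> bool) \<Rightarrow> ('h list \<Rightarrow> 'h list \<Rightarrow> 'k) \<Rightarrow> 'k" where
  "psplit [] P K = K [] []"
| "psplit (h # hs) P K = (if P 0 then csum (\<lambda>u v. psplit hs (\<lambda>i. P (Suc i)) (\<lambda>us vs. K (u # us) (v # vs))) h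
     else psplit hs (\<lambda>i. P (Suc i)) (\<lambda>us vs. K us (h # vs)))"

text \<open>Outside \<open>P\<close> the first functional contributes only a counit, so by the
  counit axiom the letter reaches \<open>F\<close> undivided.\<close>

lemma cv_opf_eq_psplit: "ml (length hs) F \<Longrightarrow> cv (opf P g) F hs = psplit hs P (\<lambda>us vs. g us * F vs)"
proof (induction hs arbitrary: P g F)
  case (Cons h hs)
  have F: "ml (length hs) (\<lambda>w. F (x # w))" "length w = length hs \<Longrightarrow> lin (\<lambda>x. F (x # w))" for x w
    using Cons.prems by (simp_all add: ml_Suc)
  show ?case
  proof (cases "P 0")
    case True
    then show ?thesis by (simp add: cv_Cons Cons.IH[OF F(1)])
  next
    case False
    have "csum (\<lambda>u v. counit B u * cv (opf (\<lambda>i. P (Suc i)) g) (\<lambda>w. F (v # w)) hs) h =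
        cv (opf (\<lambda>i. P (Suc i)) g) (\<lambda>w. F (h # w)) hs"
      by (rule csum_counit_left) (intro lin_cv_right F(2))
    then show ?thesis using False by (simp add: cv_Cons cv_mult_left Cons.IH[OF F(1)])
  qed
qed simp

primrec heads :: "(nat \<Rightarrow> bool) \<Rightarrow> 'h list list \<Rightarrow> 'h list" where
  "heads P [] = []"
| "heads P (l # ls) = (if P 0 then hd l # heads (\<lambda>i. P (Suc i)) ls else heads (\<lambda>i. P (Suc i)) ls)"

primrec tails :: "(nat \<Rightarrow> bool) \<Rightarrow> 'h list list \<Rightarrow> 'h list list" where
  "tails P [] = []"
| "tails P (l # ls) = (if P 0 then tl l else l) # tails (\<lambda>i. P (Suc i)) ls"

lemma heads_eq: "heads P ls = map (\<lambda>p. hd (ls ! p)) (idx P (length ls))"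
  by (induction ls arbitrary: P) (simp_all add: idx_Suc comp_def)

lemma length_tails: "length (tails P ls) = length ls"
  by (induction ls arbitrary: P) simp_all

lemma nth_tails: "p < length ls \<Longrightarrow> tails P ls ! p = (if P p then tl (ls ! p) else ls ! p)"
proof (induction ls arbitrary: P p)
  case (Cons l ls)
  then show ?case by (cases p) simp_all
qed simp

lemma psplit_mult: "psplit hs P (\<lambda>us vs. c * K us vs) = c * psplit hs P K"
  by (induction hs arbitrary: P K) (simp_all add: csum_mult)

lemma psplit_csum:
  "psplit hs P (\<lambda>us vs. csum (\<lambda>x y. K us vs x y) g) = csum (\<lambda>x y. psplit hs P (\<lambda>us vs. K us vs x y)) g"
proof (induction hs arbitrary: P K)
  case (Cons h hs)
  then show ?case by (simp add: Cons.IH csum_csum[of _ g h])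
qed simp

lemma psplit_legs:
  "psplit hs P (\<lambda>us vs. legs r (\<lambda>l. K us vs l) h) = legs r (\<lambda>l. psplit hs P (\<lambda>us vs. K us vs l)) h"
  by (induction r arbitrary: K h) (simp_all add: psplit_mult psplit_csum)

text \<open>A leg split off beforehand becomes the head of the leg list at its position, and the
  count there grows by one.\<close>

lemma psplit_multi_legs:
  "psplit hs P (\<lambda>us vs. multi_legs vs r (\<lambda>ls. K us ls)) =
     multi_legs hs (\<lambda>i. if P i then Suc (r i) else r i) (\<lambda>ls. K (heads P ls) (tails P ls))"
  by (induction hs arbitrary: P r K) (simp_all add: psplit_legs)

lemma legs_cong: "(\<And>l. length l = r \<Longrightarrow> K l = L l) \<Longrightarrow> legs r K h = legs r L h"
proof (induction r arbitrary: K L h)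
  case (Suc r)
  have "legs r (\<lambda>l. K (u # l)) v = legs r (\<lambda>l. L (u # l)) v" for u v
    by (rule Suc.IH) (simp add: Suc.prems)
  then show ?case by simp
qed simp

lemma multi_legs_cong:
  "(\<And>ls. map length ls = map r [0..<length hs] \<Longrightarrow> K ls = L ls) \<Longrightarrow>
     multi_legs hs r K = multi_legs hs r L"
proof (induction hs arbitrary: r K L)
  case (Cons h hs)
  have "[0..<length (h # hs)] = 0 # map Suc [0..<length hs]"
    by (simp add: upt_conv_Cons map_Suc_upt del: upt_Suc)
  then have *: "map r [0..<length (h # hs)] = r 0 # map (\<lambda>i. r (Suc i)) [0..<length hs]" by (simp add: comp_def)
  show ?case unfolding multi_legs.simps
  proof (rule legs_cong, rule Cons.IH)
    fix l :: "'h list" and ls :: "'h list list"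
    assume "length l = r 0" "map length ls = map (\<lambda>i. r (Suc i)) [0..<length hs]"
    then show "K (l # ls) = L (l # ls)" by (intro Cons.prems) (simp only: * list.map)
  qed
qed simp

text \<open>The positions on which a functional acts, and the functional.\<close>

type_synonym (in -) ('k, 'h) operation = "(nat \<Rightarrow> bool) \<times> ('h list \<Rightarrow> 'k)"

definition op_ok :: "nat \<Rightarrow> ('k, 'h) operation list \<Rightarrow> bool" where
  "op_ok N ops \<longleftrightarrow> (\<forall>(P, g) \<in> set ops. ml (length (idx P N)) g)"

definition op_count :: "('k, 'h) operation list \<Rightarrow> nat \<Rightarrow> nat" where
  "op_count ops p = length (filter (\<lambda>(P, g). P p) ops)"

lemma op_count_simps [simp]:
  "op_count [] p = 0"
  "op_count ((P, g) # ops) p = (if P p then Suc (op_count ops p) else op_count ops p)"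
  "op_count (ops @ ops') p = op_count ops p + op_count ops' p"
  by (simp_all add: op_count_def)

text \<open>
  \<open>leg_eval\<close> consumes the lists of legs, \<open>op_eval\<close> reads the same legs from an array \<open>y\<close>, where
  \<open>off p\<close> legs of position \<open>p\<close> have already been used.
\<close>

primrec leg_eval :: "('k, 'h) operation list \<Rightarrow> 'h list list \<Rightarrow> 'k" where
  "leg_eval [] ls = 1"
| "leg_eval (op # ops) ls = snd op (heads (fst op) ls) * leg_eval ops (tails (fst op) ls)"

primrec op_eval ::
  "nat \<Rightarrow> ('k, 'h) operation list \<Rightarrow> (nat \<Rightarrow> nat) \<Rightarrow> (nat \<Rightarrow> nat \<Rightarrow> 'h) \<Rightarrow> 'k"
where
  "op_eval N [] off y = 1"
| "op_eval N (op # ops) off y = snd op (map (\<lambda>p. y p (off p)) (idx (fst op) N)) *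
     op_eval N ops (\<lambda>p. if fst op p then Suc (off p) else off p) y"

lemma ml_cprod_opf: "op_ok N ops \<Longrightarrow> ml N (foldr cv (map (case_prod opf) ops) eps)"
  by (induction ops) (auto simp: op_ok_def ml_eps intro!: ml_cv ml_opf)

text \<open>The leftmost factor of a convolution takes the first leg at each of its positions and
  leaves the rest to the other factors. After the last one the unit \<open>eps\<close> remains,
  which is the counit in \<open>legs\<close>.\<close>

lemma cprod_opf_eq_multi_legs:
  "op_ok (length hs) ops \<Longrightarrow>
     foldr cv (map (case_prod opf) ops) eps hs = multi_legs hs (op_count ops) (leg_eval ops)"
proof (induction ops arbitrary: hs)
  case Nil
  show ?case by (induction hs) (simp_all add: op_count_def)
next
  case (Cons op ops)
  obtain P g where op: "op = (P, g)" by (cases op)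
  have ok: "op_ok (length hs) ops" using Cons.prems by (simp add: op_ok_def)
  have "foldr cv (map (case_prod opf) (op # ops)) eps hs =
      psplit hs P (\<lambda>us vs. g us * foldr cv (map (case_prod opf) ops) eps vs)"
    using cv_opf_eq_psplit[OF ml_cprod_opf[OF ok]] op by simp
  also have "\<dots> = psplit hs P (\<lambda>us vs. multi_legs vs (op_count ops) (\<lambda>ls. g us * leg_eval ops ls))"
  proof -
    have m: "c * multi_legs vs r K = multi_legs vs r (\<lambda>ls. c * K ls)" for c vs r K
    proof -
      have l: "legs r (\<lambda>l. c * K l) h = c * legs r K h" for r K h
        by (induction r arbitrary: K h) (simp_all add: csum_mult)
      show ?thesis by (induction vs arbitrary: r K) (simp_all add: l[symmetric])
    qed
    have psplit_cong: "psplit hs P K = psplit hs P L"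
      if "\<And>us vs. length vs = length hs \<Longrightarrow> K us vs = L us vs" for K L
      using that
    proof (induction hs arbitrary: P K L)
      case (Cons h hs)
      have "psplit hs (\<lambda>i. P (Suc i)) (\<lambda>us vs. K (u # us) (v # vs)) =
          psplit hs (\<lambda>i. P (Suc i)) (\<lambda>us vs. L (u # us) (v # vs))"
        "psplit hs (\<lambda>i. P (Suc i)) (\<lambda>us vs. K us (h # vs)) =
          psplit hs (\<lambda>i. P (Suc i)) (\<lambda>us vs. L us (h # vs))" for u v
        by (rule Cons.IH; simp add: Cons.prems)+
      then show ?case by simp
    qed simp
    show ?thesis using ok by (intro psplit_cong) (simp add: Cons.IH m)
  qed
  also have "\<dots> = multi_legs hs (op_count (op # ops)) (leg_eval (op # ops))"
  proof -
    have "op_count (op # ops) = (\<lambda>i. if P i then Suc (op_count ops i) else op_count ops i)"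
      "leg_eval (op # ops) = (\<lambda>ls. g (heads P ls) * leg_eval ops (tails P ls))"
      using op by auto
    then show ?thesis by (simp only: psplit_multi_legs)
  qed
  finally show ?case .
qed

lemma leg_eval_eq_op_eval:
  assumes "length ls = N" "\<And>p. p < N \<Longrightarrow> ls ! p = map (y p) [off p..<off p + op_count ops p]"
  shows "leg_eval ops ls = op_eval N ops off y"
  using assms
proof (induction ops arbitrary: ls off)
  case (Cons op ops)
  obtain P g where op: "op = (P, g)" by (cases op)
  have "heads P ls = map (\<lambda>p. y p (off p)) (idx P N)"
    unfolding heads_eq using Cons.prems op
    by (auto simp: set_idx upt_conv_Cons simp del: upt_Suc intro!: map_cong)
  moreover have "leg_eval ops (tails P ls) = op_eval N ops (\<lambda>p. if P p then Suc (off p) else off p) y"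
  proof (rule Cons.IH)
    fix p assume "p < N"
    then show "tails P ls ! p = map (y p) [(if P p then Suc (off p) else off p)..<
        (if P p then Suc (off p) else off p) + op_count ops p]"
      using Cons.prems op by (auto simp: nth_tails upt_conv_Cons simp del: upt_Suc)
  qed (simp add: length_tails Cons.prems)
  ultimately show ?case using op by simp
qed simp

lemma op_eval_cong:
  "(\<And>q t. q < N \<Longrightarrow> off q \<le> t \<Longrightarrow> t < off q + op_count ops q \<Longrightarrow> y q t = y' q t) \<Longrightarrow>
     op_eval N ops off y = op_eval N ops off y'"
proof (induction ops arbitrary: off)
  case (Cons op ops)
  obtain P g where op: "op = (P, g)" by (cases op)
  have "map (\<lambda>p. y p (off p)) (idx P N) = map (\<lambda>p. y' p (off p)) (idx P N)"
    using Cons.prems op by (auto simp: set_idx)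
  moreover have "op_eval N ops (\<lambda>p. if P p then Suc (off p) else off p) y =
      op_eval N ops (\<lambda>p. if P p then Suc (off p) else off p) y'"
    using op by (intro Cons.IH Cons.prems) (auto split: if_splits)
  ultimately show ?case unfolding op op_eval.simps fst_conv snd_conv by (simp only:)
qed simp

text \<open>Leg \<open>s\<close> of position \<open>p\<close> is read by exactly one operation, the
  one that acts at \<open>p\<close> when the offset there equals \<open>s\<close>.\<close>

lemma lin_op_eval:
  "op_ok N ops \<Longrightarrow> p < N \<Longrightarrow> off p \<le> s \<Longrightarrow> s < off p + op_count ops p \<Longrightarrow>
     lin (\<lambda>v. op_eval N ops off (\<lambda>q t. if q = p \<and> t = s then v else y q t))"
proof (induction ops arbitrary: off)
  case (Cons op ops)
  obtain P g where op: "op = (P, g)" by (cases op)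
  let ?y = "\<lambda>v q t. if q = p \<and> t = s then v else y q t"
  let ?off = "\<lambda>q. if P q then Suc (off q) else off q"
  have ok: "op_ok N ops" "ml (length (idx P N)) g" using Cons.prems(1) op by (auto simp: op_ok_def)
  show ?case
  proof (cases "P p \<and> s = off p")
    case True
    have "op_eval N ops ?off (?y v) = op_eval N ops ?off y" for v
      using True by (intro op_eval_cong) auto
    moreover obtain k where k: "k < length (idx P N)" "idx P N ! k = p"
      using True Cons.prems(2) by (metis (mono_tags, lifting) set_idx mem_Collect_eq in_set_conv_nth)
    have "map (\<lambda>q. ?y v q (off q)) (idx P N) = (map (\<lambda>q. y q (off q)) (idx P N))[k := v]" for v
      using k True distinct_idx[of P N]
      by (auto intro!: nth_equalityI simp: nth_list_update nth_eq_iff_index_eq)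
    moreover have "lin (\<lambda>v. g ((map (\<lambda>q. y q (off q)) (idx P N))[k := v]))"
      using ok(2) k by (simp add: ml_iff_lin)
    ultimately show ?thesis using op by (simp add: lin_mult_right)
  next
    case False
    have "map (\<lambda>q. ?y v q (off q)) (idx P N) = map (\<lambda>q. y q (off q)) (idx P N)" for v
      using False by (auto simp: set_idx)
    moreover have "lin (\<lambda>v. op_eval N ops ?off (?y v))"
      using False Cons.prems op by (intro Cons.IH ok(1)) (auto split: if_splits)
    ultimately show ?thesis unfolding op op_eval.simps fst_conv snd_conv by (simp only: lin_mult)
  qed
qed simp

section \<open>From leg lists to the notation \<open>sweedler\<close>\<close>

primrec block_legs :: "('h \<times> nat) list \<Rightarrow> ('h list \<Rightarrow> 'k) \<Rightarrow> 'k" where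
  "block_legs [] K = K []"
| "block_legs (p # ps) K = iter_split (snd p - 1) [fst p] (\<lambda>l. block_legs ps (\<lambda>zs. K (l @ zs)))"

lemma tens_block_legs:
  "(\<And>h r. (h, r) \<in> set ps \<Longrightarrow> r > 0) \<Longrightarrow>
     tens (sum_list (map snd ps)) (tproduct_list B (map (\<lambda>(h, r). iter_comul B 1 (r - 1) (pure B [h])) ps))
       (block_legs ps)"
proof (induction ps)
  case (Cons p ps)
  obtain h r where p: "p = (h, r)" by (cases p)
  have "tens r (iter_comul B 1 (r - 1) (pure B [h])) (iter_split (r - 1) [h])"
    using tens_iter_comul[OF tens_pure, of "[h]" 1 "r - 1"] Cons.prems[of h r] p by simp
  moreover have "tens (sum_list (map snd ps))
      (tproduct_list B (map (\<lambda>(h, r). iter_comul B 1 (r - 1) (pure B [h])) ps)) (block_legs ps)"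
    by (rule Cons.IH) (use Cons.prems in auto)
  ultimately show ?case using p tens_tprod by (simp add: tproduct_list_def)
next
  case Nil
  have "block_legs [] = (\<lambda>f. f [])" by (rule ext) simp
  then show ?case by (simp only:) (simp add: tproduct_list_def tens_pure)
qed

text \<open>The extra leg sent to the counit is removed by the counit axiom, which takes at least
  one other leg; hence the successor.\<close>

lemma legs_eq_iter_split: "ml (Suc r) K \<Longrightarrow> legs (Suc r) K h = iter_split r [h] K"
proof (induction r arbitrary: K h)
  case 0
  then have "csum (\<lambda>u v. K [u] * counit B v) h = K [h]"
    by (intro csum_counit_right) (simp add: ml_Suc)
  then show ?case by (simp add: mult.commute)
next
  case (Suc r)
  have "legs (Suc r) (\<lambda>l. K (u # l)) v = iter_split r [v] (\<lambda>l. K (u # l))" for u v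
    using Suc.prems by (intro Suc.IH) (simp add: ml_Suc)
  then have "csum (\<lambda>u v. legs (Suc r) (\<lambda>l. K (u # l)) v) h = iter_split (Suc r) [h] K" by simp
  then show ?case by (simp only: legs.simps)
qed

lemma multi_legs_eq_block_legs:
  "mlin \<Phi> \<Longrightarrow> (\<And>p. p < length hs \<Longrightarrow> r p > 0) \<Longrightarrow>
     multi_legs hs r (\<lambda>ls. \<Phi> (concat ls)) = block_legs (map (\<lambda>p. (hs ! p, r p)) [0..<length hs]) \<Phi>"
proof (induction hs arbitrary: r \<Phi>)
  case (Cons h hs)
  let ?ps = "map (\<lambda>p. (hs ! p, r (Suc p))) [0..<length hs]"
  have "[0..<length (h # hs)] = 0 # map Suc [0..<length hs]"
    by (simp add: upt_conv_Cons map_Suc_upt del: upt_Suc)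
  then have ps: "map (\<lambda>p. ((h # hs) ! p, r p)) [0..<length (h # hs)] = (h, r 0) # ?ps" by (simp add: comp_def)
  have pos: "r' > 0" if "(h', r') \<in> set ?ps" for h' r' using that Cons.prems(2) by auto
  have "multi_legs hs (\<lambda>i. r (Suc i)) (\<lambda>ls. \<Phi> (l @ concat ls)) = block_legs ?ps (\<lambda>zs. \<Phi> (l @ zs))" for l
    using Cons.prems by (intro Cons.IH) (simp_all add: multilinear_append)
  moreover have "ml (Suc (r 0 - 1)) (\<lambda>l. block_legs ?ps (\<lambda>zs. \<Phi> (l @ zs)))"
    using Cons.prems(1) by (intro fsum_ml[OF tens_fsum[OF tens_block_legs[OF pos]]] multilinear_append) auto
  ultimately show ?case unfolding ps using legs_eq_iter_split[of "r 0 - 1"] Cons.prems(2)[of 0] by simp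
qed simp

lemma (in -) sum_list_take_decompose:
  "i < sum_list rs \<Longrightarrow> \<exists>p < length rs. \<exists>s < rs ! p. i = sum_list (take p rs) + s" for i :: nat
proof (induction rs arbitrary: i)
  case (Cons r rs)
  show ?case
  proof (cases "i < r")
    case True
    then show ?thesis by (intro exI[of _ 0]) auto
  next
    case False
    then have "i - r < sum_list rs" using Cons.prems by simp
    from Cons.IH[OF this] obtain p s where "p < length rs" "s < rs ! p" "i - r = sum_list (take p rs) + s"
      by blast
    then show ?thesis using False by (intro exI[of _ "Suc p"]) auto
  qed
qed simp

lemma (in -) sum_list_take_unique:
  fixes rs :: "nat list"
  assumes "sum_list (take p rs) + s = sum_list (take q rs) + t"
    and "p < length rs" "q < length rs" "s < rs ! p" "t < rs ! q"
  shows "p = q \<and> s = t"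
proof -
  have *: "sum_list (take p rs) + rs ! p \<le> sum_list (take q rs)" if "p < q" "q \<le> length rs" for p q
    using that
  proof (induction q)
    case (Suc q)
    then show ?case by (cases "p = q") (auto simp: take_Suc_conv_app_nth)
  qed simp
  from *[of p q] *[of q p] assms show ?thesis by (cases p q rule: linorder_cases) auto
qed

lemma (in -) concat_nth_sum_list:
  "p < length ls \<Longrightarrow> s < length (ls ! p) \<Longrightarrow> concat ls ! (sum_list (take p (map length ls)) + s) = ls ! p ! s"
proof (induction ls arbitrary: p)
  case (Cons l ls)
  then show ?case by (cases p) (simp_all add: nth_append)
qed simp

text \<open>
  Each operation consumes, at each of its positions, the first leg not used by the operations before it.
\<close>

lemma sweedler_ops:
  assumes ok: "op_ok N ops" and hs: "length hs = N" and pos: "\<And>p. p < N \<Longrightarrow> op_count ops p > 0"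
    and ps: "ps = map (\<lambda>p. (hs ! p, op_count ops p)) [0..<N]"
    and F: "\<And>y. F y f = op_eval N ops (\<lambda>_. 0) (\<lambda>p s. y (Suc p) (Suc s))"
  shows "sweedler B ps F f = foldr cv (map (case_prod opf) ops) eps hs"
proof -
  let ?r = "op_count ops"
  define rs where "rs = map ?r [0..<N]"
  have rs: "length rs = N" "map snd ps = rs" "p < N \<Longrightarrow> rs ! p = ?r p" for p
    by (simp_all add: rs_def ps comp_def)
  let ?\<sigma> = "\<lambda>p. sum_list (take p rs)"
  let ?\<phi> = "\<lambda>zs. op_eval N ops (\<lambda>_. 0) (\<lambda>p s. zs ! (?\<sigma> p + s))"
  have ml: "ml (sum_list rs) ?\<phi>"
    unfolding ml_iff_lin
  proof (intro allI impI)
    fix zs :: "'h list" and i assume *: "length zs = sum_list rs" "i < sum_list rs"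
    from sum_list_take_decompose[OF *(2)] obtain p s where
      p: "p < N" "s < rs ! p" "i = ?\<sigma> p + s" by (auto simp: rs)
    have "?\<phi> (zs[i := v]) = op_eval N ops (\<lambda>_. 0) (\<lambda>q t. if q = p \<and> t = s then v else zs ! (?\<sigma> q + t))" for v
    proof (rule op_eval_cong)
      fix q t assume q: "q < N" "0 \<le> t" "t < 0 + ?r q"
      then have uniq: "?\<sigma> q + t = i \<Longrightarrow> q = p \<and> t = s"
        using sum_list_take_unique[of q rs t p s] p by (simp add: rs)
      show "zs[i := v] ! (?\<sigma> q + t) = (if q = p \<and> t = s then v else zs ! (?\<sigma> q + t))"
      proof (cases "q = p \<and> t = s")
        case True
        then show ?thesis using * p by simp
      next
        case False
        then have "i \<noteq> ?\<sigma> q + t" using uniq by blast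
        then show ?thesis using False by (simp only: nth_list_update_neq not_False_eq_True if_False)
      qed
    qed
    moreover have "lin (\<lambda>v. op_eval N ops (\<lambda>_. 0) (\<lambda>q t. if q = p \<and> t = s then v else zs ! (?\<sigma> q + t)))"
      using p by (intro lin_op_eval[OF ok]) (simp_all add: rs)
    ultimately show "lin (\<lambda>v. ?\<phi> (zs[i := v]))" by simp
  qed
  have T: "tens (sum_list rs) (tproduct_list B (map (\<lambda>(h, r). iter_comul B 1 (r - 1) (pure B [h])) ps)) (block_legs ps)"
    unfolding rs(2)[symmetric] by (rule tens_block_legs) (auto simp: ps pos)
  have "sweedler B ps F f = block_legs ps ?\<phi>"
    unfolding sweedler_def tlift_def rs(2) F
    using tens_apply_restrict[OF T ml] by (simp add: take_map[symmetric] rs(2) cong: if_cong)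
  \<comment> \<open>Passing to lists of legs requires multilinearity in every length, so
    \<open>?\<phi>\<close> is cut off to the one length that occurs.\<close>
  also have "\<dots> = block_legs ps (res (sum_list rs) ?\<phi>)"
    by (rule fsum_cong[OF tens_fsum[OF T]]) (simp add: res_apply)
  also have "\<dots> = multi_legs hs ?r (\<lambda>ls. res (sum_list rs) ?\<phi> (concat ls))"
    using multi_legs_eq_block_legs[OF fnl_mlin[OF res_fnl[OF ml]], of hs ?r] pos by (simp add: ps hs)
  also have "\<dots> = multi_legs hs ?r (leg_eval ops)"
  proof (rule multi_legs_cong)
    fix ls :: "'h list list" assume "map length ls = map ?r [0..<length hs]"
    then have ls: "map length ls = rs" by (simp add: rs_def hs)
    then have N: "length ls = N" "p < N \<Longrightarrow> length (ls ! p) = ?r p" for p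
      using rs(1) rs(3)[of p] by (auto simp: nth_map[symmetric] simp del: nth_map)
    have "res (sum_list rs) ?\<phi> (concat ls) = ?\<phi> (concat ls)"
      by (rule res_apply) (simp add: length_concat ls)
    also have "\<dots> = op_eval N ops (\<lambda>_. 0) (\<lambda>p s. ls ! p ! s)"
      by (rule op_eval_cong) (simp add: concat_nth_sum_list[of _ ls, unfolded ls] N)
    also have "\<dots> = leg_eval ops ls"
      by (rule leg_eval_eq_op_eval[symmetric]) (simp_all add: N map_nth flip: N(2))
    finally show "res (sum_list rs) ?\<phi> (concat ls) = leg_eval ops ls" .
  qed
  also have "\<dots> = foldr cv (map (case_prod opf) ops) eps hs"
    using ok hs by (simp add: cprod_opf_eq_multi_legs)
  finally show ?thesis .
qed

section \<open>The dual of \<open>\<Psi>\<close>\<close>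

text \<open>Serves the functions that are not multilinear, on which a Sweedler expression with
  values \<open>pure\<close> must vanish like every tensor.\<close>

lemma sweedler_eq_0:
  assumes "\<And>h r. (h, r) \<in> set ps \<Longrightarrow> r > 0" "\<And>y. F y f = 0"
  shows "sweedler B ps F f = 0"
proof -
  note T = tens_block_legs[of ps, OF assms(1)]
  have "sweedler B ps F f = block_legs ps (\<lambda>_. 0)"
    unfolding sweedler_def tlift_def assms(2) using tens_apply_restrict[OF T ml_zero] by simp
  then show ?thesis using fsum_apply_0[OF tens_fsum[OF T]] by simp
qed

lemma opf_True: "opf (\<lambda>_. True) g hs = g hs"
  by (induction hs arbitrary: g) simp_all

lemma opf_False: "opf (\<lambda>_. False) g hs = g [] * eps hs"
  by (induction hs) (simp_all add: mult.left_commute)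

lemma fsum_cv_middle:
  assumes "\<And>w. length w = length hs \<Longrightarrow> fsum m (\<lambda>f. G f w)"
  shows "fsum m (\<lambda>f. cv K (cv (G f) J) hs)"
  unfolding cv_def
proof (rule fsum_split_sum_bind, rule fsum_scale, rule fsum_split_sum_bind)
  fix us vs us' vs' :: "'h list"
  assume "length us = length hs" "length vs = length hs" "length us' = length vs" "length vs' = length vs"
  then have "fsum m (\<lambda>f. J vs' * G f us')" by (intro fsum_scale assms) simp
  then show "fsum m (\<lambda>f. G f us' * J vs')" by (simp add: mult.commute)
qed

definition swap_at :: "nat \<Rightarrow> 'a list \<Rightarrow> 'a list" where
  "swap_at p w = take p w @ [w ! Suc p, w ! p] @ drop (p + 2) w"

lemma swap_at_append: "length us = p \<Longrightarrow> swap_at p (us @ [a, b] @ vs) = us @ [b, a] @ vs"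
  by (simp add: swap_at_def nth_append)

lemma length_swap_at: "Suc p < length w \<Longrightarrow> length (swap_at p w) = length w"
  by (simp add: swap_at_def)

lemma decompose_at:
  assumes "Suc p < length w"
  obtains us a b vs where "w = us @ [a, b] @ vs" "length us = p"
proof
  show "w = take p w @ [w ! p, w ! Suc p] @ drop (p + 2) w"
    using assms by (simp add: Cons_nth_drop_Suc)
qed (use assms in simp)

text \<open>\<open>Psi\<close> is a Sweedler sum of three operations, each acting on both letters:
  R^-1 on the first legs, \<open>f\<close> after the exchange on the second, R on the third. By
  \<open>sweedler_ops\<close> this is a triple convolution.\<close>

lemma Psi_dual:
  assumes r: "dual 2 R \<in> fnl 2" and ri: "dual 2 (conv_inverse B 2 R) \<in> fnl 2"
  shows "tens 2 (Psi B R (pure B [a, b]))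
    (\<lambda>f. cv (dual 2 (conv_inverse B 2 R)) (cv (res 2 (\<lambda>w. f (swap_at 0 w))) (dual 2 R)) [a, b])"
proof -
  let ?r = "dual 2 R" and ?ri = "dual 2 (conv_inverse B 2 R)" and ?s = "\<lambda>f. res 2 (\<lambda>w. f (swap_at 0 w))"
  let ?F = "\<lambda>y. tscale (conv_inverse B 2 R (pure B [y 1 1, y 2 1]) * R (pure B [y 1 3, y 2 3]))
                 (pure B [y 2 2, y 1 2])"
  let ?T = "\<lambda>hs f. cv ?ri (cv (?s f) ?r) hs"
  have s: "?s f \<in> fnl 2" if "mlin f" for f
  proof (rule res_fnl)
    have "ml (Suc (Suc 0)) f" using that by simp
    then show "ml 2 (\<lambda>w. f (swap_at 0 w))" by (simp add: numeral_2_eq_2 ml_Suc ml_0 swap_at_def)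
  qed
  have T: "tens 2 (sweedler B [(h, 3), (h', 3)] ?F) (?T [h, h'])" for h h'
    unfolding tens_def
  proof (intro conjI ext)
    show "fsum 2 (?T [h, h'])"
      by (rule fsum_cv_middle) (simp add: res_apply fsum_single swap_at_def)
  next
    fix f
    show "sweedler B [(h, 3), (h', 3)] ?F f = (if mlin f then ?T [h, h'] f else 0)"
    proof (cases "mlin f")
      case False
      then have "sweedler B [(h, 3), (h', 3)] ?F f = 0"
        by (intro sweedler_eq_0) (auto simp: tscale_def pure_def)
      then show ?thesis using False by auto
    next
      case True
      let ?ops = "[(\<lambda>_. True, ?ri), (\<lambda>_. True, ?s f), (\<lambda>_. True, ?r)]"
      have i: "idx (\<lambda>_. True) 2 = [0, Suc 0]" by (simp add: idx_Suc numeral_2_eq_2)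
      have "sweedler B [(h, 3), (h', 3)] ?F f = foldr cv (map (case_prod opf) ?ops) eps [h, h']"
      proof (rule sweedler_ops)
        show "op_ok 2 ?ops" using r ri s[OF True] by (simp add: op_ok_def i fnl_ml numeral_2_eq_2[symmetric])
        show "[(h, 3), (h', 3)] = map (\<lambda>p. ([h, h'] ! p, op_count ?ops p)) [0..<2]"
          by (simp add: upt_rec numeral_3_eq_3)
        show "?F y f = op_eval 2 ?ops (\<lambda>_. 0) (\<lambda>p s. y (Suc p) (Suc s))" for y
          using True by (simp add: i i[unfolded numeral_2_eq_2] dual_def res_def tscale_def pure_def swap_at_def
              numeral_2_eq_2 numeral_3_eq_3 mult_ac)
      qed simp_all
      also have "\<dots> = ?T [h, h'] f"
      proof -
        have "cv ?r eps = ?r" using fnl_mlin[OF r] by (intro ext cv_eps_right) simp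
        then show ?thesis by (simp add: opf_True[abs_def])
      qed
      finally show ?thesis using True by simp
    qed
  qed
  have "tens 2 (Psi B R (pure B [a, b])) (\<lambda>f. ?T [[a, b] ! 0, [a, b] ! 1] f)"
    unfolding Psi_def
  proof (rule tens_tlift[where S = "\<lambda>f. f [a, b]" and T = "\<lambda>hs. ?T [hs ! 0, hs ! 1]"])
    fix f assume "mlin f"
    then have "cv ?ri (cv (?s f) ?r) \<in> fnl 2" by (intro cv_fnl r ri s)
    note m = fnl_ml[OF this]
    have "?T [hs ! 0, hs ! 1] f = ?T hs f" if "length hs = 2" for hs
      by (rule arg_cong[of _ _ "\<lambda>hs. ?T hs f"]) (rule sym, rule length_2_conv[THEN iffD1, OF that])
    then show "ml 2 (\<lambda>hs. ?T [hs ! 0, hs ! 1] f)"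
      using ml_cong[of 2 "\<lambda>hs. ?T [hs ! 0, hs ! 1] f" "cv ?ri (cv (?s f) ?r)"] m by blast
  qed (simp add: tens_pure, rule T)
  then show ?thesis by simp
qed

text \<open>Every letter outside the pair meets a counit on one side of the convolution, so the
  counit axiom leaves it whole and only the adjacent pair is split.\<close>

lemma cv_opf_adjacent:
  "ml (length (us @ [a, b] @ vs)) F \<Longrightarrow> (\<And>i. P i \<longleftrightarrow> i = length us \<or> i = Suc (length us)) \<Longrightarrow>
     cv (opf P g) F (us @ [a, b] @ vs) = cv g (\<lambda>w. F (us @ w @ vs)) [a, b] \<and>
     cv F (opf P g) (us @ [a, b] @ vs) = cv (\<lambda>w. F (us @ w @ vs)) g [a, b]"
proof (induction us arbitrary: P F)
  case Nil
  have P: "P 0" "P (Suc 0)" "(\<lambda>i. P (Suc (Suc i))) = (\<lambda>_. False)" using Nil.prems(2) by auto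
  have "cv (opf (\<lambda>_. False) g') (\<lambda>w. F (v # v' # w)) vs = g' [] * F (v # v' # vs)"
    "cv (\<lambda>w. F (v # v' # w)) (opf (\<lambda>_. False) g') vs = F (v # v' # vs) * g' []" for g' v v'
    using Nil.prems(1) by (simp_all add: opf_False[abs_def] cv_mult_left cv_mult_right cv_eps_left cv_eps_right ml_Suc)
  then show ?case by (simp add: cv_Cons P)
next
  case (Cons u us)
  have P: "\<not> P 0" "P (Suc i) \<longleftrightarrow> i = length us \<or> i = Suc (length us)" for i
    using Cons.prems(2) by auto
  have F: "ml (length (us @ [a, b] @ vs)) (\<lambda>w. F (x # w))" for x using Cons.prems(1) by (simp add: ml_Suc)
  have l: "lin (\<lambda>x. F (x # w))" if "length w = length (us @ [a, b] @ vs)" for w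
    using Cons.prems(1) that by (simp add: ml_Suc)
  let ?\<phi> = "\<lambda>v. cv (opf (\<lambda>i. P (Suc i)) g) (\<lambda>w. F (v # w)) (us @ [a, b] @ vs)"
  have "cv (opf P g) F ((u # us) @ [a, b] @ vs) = csum (\<lambda>x v. counit B x * ?\<phi> v) u"
    using P(1) by (simp add: cv_Cons cv_mult_left)
  also have "\<dots> = ?\<phi> u" by (rule csum_counit_left) (intro lin_cv_right l)
  finally have 1: "cv (opf P g) F ((u # us) @ [a, b] @ vs) = ?\<phi> u" .
  let ?\<psi> = "\<lambda>v. cv (\<lambda>w. F (v # w)) (opf (\<lambda>i. P (Suc i)) g) (us @ [a, b] @ vs)"
  have "cv F (opf P g) ((u # us) @ [a, b] @ vs) = csum (\<lambda>v x. ?\<psi> v * counit B x) u"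
    using P(1) by (simp add: cv_Cons cv_mult_right mult.commute)
  also have "\<dots> = ?\<psi> u" by (rule csum_counit_right) (intro lin_cv_left l)
  finally have 2: "cv F (opf P g) ((u # us) @ [a, b] @ vs) = ?\<psi> u" .
  show ?case unfolding 1 2 using Cons.IH[OF F P(2)] by simp
qed

lemma res_fnl_swap_at: "mlin f \<Longrightarrow> Suc p < N \<Longrightarrow> res N (\<lambda>w. f (swap_at p w)) \<in> fnl N"
proof (rule res_fnl)
  assume f: "mlin f" and p: "Suc p < N"
  let ?S = "swap_at p [0..<N]"
  have S: "[0..<N] = [0..<p] @ [p, Suc p] @ [Suc (Suc p)..<N]"
    using p upt_add_eq_append[of 0 p "N - p"] by (simp add: upt_conv_Cons)
  have S': "?S = [0..<p] @ [Suc p, p] @ [Suc (Suc p)..<N]" unfolding S by (rule swap_at_append) simp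
  have eq: "swap_at p w = map ((!) w) ?S" if "length w = N" for w :: "'h list"
    unfolding S' using that p by (auto simp: swap_at_def intro!: nth_equalityI)
  show "ml N (\<lambda>w. f (swap_at p w))"
    unfolding ml_iff_lin
  proof (intro allI impI)
    fix w :: "'h list" and i assume *: "length w = N" "i < N"
    have "lin (\<lambda>x. f (map ((!) (w[i := x])) ?S))"
      using f p * unfolding S' by (intro lin_map_nth) auto
    then show "lin (\<lambda>x. f (swap_at p (w[i := x])))" by (simp add: eq *)
  qed
qed

text \<open>\<open>Psi\<close> works on the two letters at \<open>p\<close>, and convolution with
  factors supported there is computed inside those letters; so the two-letter formula extends to
  whole words.\<close>

lemma tens_amplify_Psi:
  assumes x: "tens N x S" and N: "N = p + 2 + q"
    and r: "dual 2 R \<in> fnl 2" and ri: "dual 2 (conv_inverse B 2 R) \<in> fnl 2"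
  shows "tens N (amplify B p 2 (Psi B R) q x) (\<lambda>f. S (cv (pairop N p (Suc p) (dual 2 (conv_inverse B 2 R)))
    (cv (res N (\<lambda>w. f (swap_at p w))) (pairop N p (Suc p) (dual 2 R)))))"
proof -
  let ?r = "dual 2 R" and ?ri = "dual 2 (conv_inverse B 2 R)" and ?s = "\<lambda>f. res N (\<lambda>w. f (swap_at p w))"
  let ?T = "\<lambda>hs f. cv (pairop N p (Suc p) ?ri) (cv (?s f) (pairop N p (Suc p) ?r)) hs"
  show ?thesis
    unfolding amplify_def N[symmetric]
  proof (rule tens_tlift[OF x, where T = ?T])
    fix hs :: "'h list" assume hs: "length hs = N"
    with N have "Suc p < length hs" by simp
    then obtain us a b vs where w: "hs = us @ [a, b] @ vs" "length us = p" by (rule decompose_at)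
    have "tens N (tproduct_list B [pure B us, Psi B R (pure B [a, b]), pure B vs])
        (\<lambda>f. cv ?ri (cv (res 2 (\<lambda>w. f (us @ swap_at 0 w @ vs))) ?r) [a, b])"
      using tens_tprod[OF tens_pure[of us p] tens_tprod[OF Psi_dual[OF r ri, of a b]
            tens_tprod[OF tens_pure[of vs q] tens_pure[of "[]" 0]]]] w hs N
      by (simp add: tproduct_list_def)
    \<comment> \<open>The two expressions are identified for multilinear \<open>f\<close>, because
      the counit axiom is applied to the letters outside the pair. That the new one is a finite
      combination is therefore checked separately.\<close>
    moreover have "cv ?ri (cv (res 2 (\<lambda>w. f (us @ swap_at 0 w @ vs))) ?r) [a, b] = ?T hs f" if "mlin f" for f
    proof -
      let ?P = "\<lambda>i. i = p \<or> i = Suc p"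
      have s: "ml N (?s f)" "ml N (cv (?s f) (opf ?P ?r))"
        using fnl_ml[OF res_fnl_swap_at[OF that]] N r
        by (auto intro!: ml_cv ml_opf simp: idx_pair fnl_ml numeral_2_eq_2[symmetric])
      have len: "length (us @ [a', b'] @ vs) = N" for a' b' using hs w by simp
      have "?T hs f = cv (opf ?P ?ri) (cv (?s f) (opf ?P ?r)) hs"
        unfolding pairop_def using hs by (intro cv_cong) (simp_all add: res_apply cong: cv_cong)
      also have "\<dots> = cv ?ri (\<lambda>w. cv (?s f) (opf ?P ?r) (us @ w @ vs)) [a, b]"
        unfolding w(1) by (rule cv_opf_adjacent[THEN conjunct1]) (simp_all only: len s w(2))
      also have "\<dots> = cv ?ri (cv (\<lambda>w. ?s f (us @ w @ vs)) ?r) [a, b]"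
      proof (rule cv_cong)
        fix w' :: "'h list" assume "length w' = length [a, b]"
        then obtain a' b' where w': "w' = [a', b']" by (auto simp: length_Suc_conv)
        show "cv (?s f) (opf ?P ?r) (us @ w' @ vs) = cv (\<lambda>w. ?s f (us @ w @ vs)) ?r w'"
          unfolding w' by (rule cv_opf_adjacent[THEN conjunct2]) (simp_all only: len s w(2))
      qed simp
      also have "\<dots> = cv ?ri (cv (res 2 (\<lambda>w. f (us @ swap_at 0 w @ vs))) ?r) [a, b]"
      proof (intro cv_cong refl)
        fix w1 w' :: "'h list" assume "length w1 = length [a, b]" "length w' = length w1"
        then obtain a' b' where w': "w' = [a', b']" by (auto simp: length_Suc_conv)
        show "?s f (us @ w' @ vs) = res 2 (\<lambda>w. f (us @ swap_at 0 w @ vs)) w'"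
          unfolding w' using w hs swap_at_append[of us p a' b' vs] by (simp add: res_apply swap_at_def[of 0])
      qed
      finally show ?thesis by simp
    qed
    moreover have "fsum N (?T hs)"
      using hs N by (intro fsum_cv_middle) (simp add: res_apply fsum_single length_swap_at)
    ultimately have "tens N (tproduct_list B [pure B us, Psi B R (pure B [a, b]), pure B vs]) (?T hs)"
      by (auto simp: tens_def fun_eq_iff)
    then show "tens N (tproduct_list B [pure B (take p hs), Psi B R (pure B (take 2 (drop p hs))),
        pure B (drop (p + 2) hs)]) (?T hs)" using w by simp
  next
    fix f assume "mlin f"
    then have "cv (pairop N p (Suc p) ?ri) (cv (?s f) (pairop N p (Suc p) ?r)) \<in> fnl N"
      using N r ri by (intro cv_fnl res_fnl_swap_at pairop_fnl) simp_all
    then show "ml N (\<lambda>hs. ?T hs f)" by (rule fnl_ml)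
  qed
qed

section \<open>Rearranging words, and the factors of \<open>J\<close>\<close>

definition arr :: "nat list \<Rightarrow> 'a list \<Rightarrow> 'a list" where
  "arr \<pi> w = map ((!) w) \<pi>"

text \<open>The rearrangement respects coproducts. The property is carried along as an invariant: it
  is preserved by adjacent exchanges, the only moves that occur.\<close>

definition coalg_map :: "nat \<Rightarrow> nat list \<Rightarrow> bool" where
  "coalg_map N \<pi> \<longleftrightarrow> (\<forall>hs K. length hs = N \<longrightarrow>
     split_sum (arr \<pi> hs) K = split_sum hs (\<lambda>us vs. K (arr \<pi> us) (arr \<pi> vs)))"

lemma arr_upt: "length w = N \<Longrightarrow> arr [0..<N] w = w"
  unfolding arr_def by (metis map_nth)

lemma coalg_map_upt: "coalg_map N [0..<N]"
  by (auto simp: coalg_map_def arr_upt intro!: split_sum_cong)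

lemma split_sum_swap_at:
  assumes "Suc p < length w"
  shows "split_sum (swap_at p w) K = split_sum w (\<lambda>us vs. K (swap_at p us) (swap_at p vs))"
proof -
  obtain us a b vs where w: "w = us @ [a, b] @ vs" "length us = p" using assms by (rule decompose_at)
  show ?thesis
    unfolding w(1) swap_at_append[OF w(2)] split_sum_append
  proof (rule split_sum_cong)
    fix x x' :: "'h list" assume "length x = length us" "length x' = length us"
    then have x: "swap_at p (x @ [s, t] @ y) = x @ [t, s] @ y" "swap_at p (x' @ [s, t] @ y) = x' @ [t, s] @ y" for s t y
      using w(2) by (simp_all add: swap_at_append del: append.simps)
    show "split_sum [b, a] (\<lambda>us' vs'. split_sum vs (\<lambda>us'a vs'a. K (x @ us' @ us'a) (x' @ vs' @ vs'a))) =
      split_sum [a, b] (\<lambda>us' vs'. split_sum vs (\<lambda>us'a vs'a.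
        K (swap_at p (x @ us' @ us'a)) (swap_at p (x' @ vs' @ vs'a))))"
      unfolding split_sum.simps x append_assoc by (rule csum_csum)
  qed
qed

lemma arr_swap_at: "Suc p < length \<pi> \<Longrightarrow> arr (swap_at p \<pi>) w = swap_at p (arr \<pi> w)"
  by (simp add: arr_def swap_at_def take_map drop_map)

lemma length_arr [simp]: "length (arr \<pi> w) = length \<pi>"
  by (simp add: arr_def)

lemma coalg_map_swap_at:
  assumes "coalg_map N \<pi>" "Suc p < length \<pi>"
  shows "coalg_map N (swap_at p \<pi>)"
  unfolding coalg_map_def
proof (intro allI impI)
  fix hs :: "'h list" and K assume "length hs = N"
  then show "split_sum (arr (swap_at p \<pi>) hs) K =
      split_sum hs (\<lambda>us vs. K (arr (swap_at p \<pi>) us) (arr (swap_at p \<pi>) vs))"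
    using assms by (simp add: arr_swap_at split_sum_swap_at coalg_map_def)
qed

text \<open>Pullback along a coalgebra map is multiplicative for convolution.\<close>

lemma res_cv_arr:
  assumes "coalg_map N \<pi>"
  shows "res N (\<lambda>w. cv F G (arr \<pi> w)) = cv (res N (\<lambda>w. F (arr \<pi> w))) (res N (\<lambda>w. G (arr \<pi> w)))"
  unfolding res_cv using assms by (auto simp: res_def cv_def coalg_map_def)

text \<open>\<open>pairop\<close> feeds its two letters to \<open>F\<close> in increasing order of
  position. The condition on \<pi> ensures that this order is the same before and after the
  rearrangement; the remaining counits are merely permuted.\<close>

lemma pairop_arr:
  assumes \<pi>: "distinct \<pi>" "set \<pi> = {..<N}" and p: "Suc p < N" and lt: "\<pi> ! p < \<pi> ! Suc p"
  shows "res N (\<lambda>w. pairop N p (Suc p) F (arr \<pi> w)) = pairop N (\<pi> ! p) (\<pi> ! Suc p) F"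
proof
  fix w :: "'h list"
  have l: "length \<pi> = N" using distinct_card[OF \<pi>(1)] \<pi>(2) by simp
  have q: "\<pi> ! Suc p < N" using \<pi>(2) p l nth_mem[of "Suc p" \<pi>] by auto
  let ?P = "\<lambda>i. i = p \<or> i = Suc p" and ?Q = "\<lambda>i. i = \<pi> ! p \<or> i = \<pi> ! Suc p"
  show "res N (\<lambda>w. pairop N p (Suc p) F (arr \<pi> w)) w = pairop N (\<pi> ! p) (\<pi> ! Suc p) F w"
  proof (cases "length w = N")
    case True
    have "prod_list (map (\<lambda>i. counit B (arr \<pi> w ! i)) (idx (\<lambda>i. \<not> ?P i) N)) =
        (\<Prod>i\<in>{i. i < N \<and> \<not> ?P i}. counit B (w ! (\<pi> ! i)))"
      unfolding prod.distinct_set_conv_list[OF distinct_idx, symmetric] set_idx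
      by (rule prod.cong) (simp_all add: arr_def l)
    also have "\<dots> = (\<Prod>i\<in>{i. i < N \<and> \<not> ?Q i}. counit B (w ! i))"
    proof (rule prod.reindex_bij_betw)
      have "inj_on ((!) \<pi>) {..<N}" using \<pi>(1) l by (simp add: inj_on_nth)
      moreover have "(!) \<pi> ` {i. i < N \<and> \<not> ?P i} = {i. i < N \<and> \<not> ?Q i}"
      proof -
        have "{i. i < N \<and> \<not> ?Q i} = (!) \<pi> ` {..<N} - (!) \<pi> ` {p, Suc p}"
          using \<pi>(2) l nth_image[of N \<pi>] by (auto simp: atLeast0LessThan)
        also have "\<dots> = (!) \<pi> ` ({..<N} - {p, Suc p})"
          using p calculation(1) by (intro inj_on_image_set_diff[symmetric, of _ "{..<N}"]) (auto simp: \<pi> l inj_on_nth)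
        also have "{..<N} - {p, Suc p} = {i. i < N \<and> \<not> ?P i}" by auto
        finally show ?thesis ..
      qed
      ultimately show "bij_betw ((!) \<pi>) {i. i < N \<and> \<not> ?P i} {i. i < N \<and> \<not> ?Q i}"
        unfolding bij_betw_def by (blast intro: inj_on_subset)
    qed
    also have "\<dots> = prod_list (map (\<lambda>i. counit B (w ! i)) (idx (\<lambda>i. \<not> ?Q i) N))"
      unfolding prod.distinct_set_conv_list[OF distinct_idx, symmetric] set_idx ..
    finally show ?thesis
      using True p q lt by (simp add: pairop_def res_apply l opf_apply idx_pair) (simp add: arr_def l)
  qed (simp add: res_def pairop_def)
qed

end

section \<open>The factors of \<open>J\<close> in row order and in column order\<close>

locale twist = bialgebra B for B :: "('k::field, 'h::ring_1) bialgebra_data" +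
  fixes R :: "'c \<Rightarrow> ('k, 'h) tensor \<Rightarrow> 'k" and n :: nat and c :: "nat \<times> nat \<Rightarrow> 'c"
  assumes R_fnl: "1 \<le> j \<Longrightarrow> j < i \<Longrightarrow> i \<le> n \<Longrightarrow> dual 2 (R (c (j, i))) \<in> fnl 2"
    and R_inverse: "1 \<le> j \<Longrightarrow> j < i \<Longrightarrow> i \<le> n \<Longrightarrow> \<exists>g. is_conv_inverse B 2 (R (c (j, i))) g"
begin

text \<open>
  A pair \<open>(i, j)\<close> stands for the letters \<open>a\<^sub>i\<close> and \<open>b\<^sub>j\<close>, at the positions \<open>i - 1\<close> and \<open>n + j - 1\<close> of a
  word of length \<open>2 n\<close>; the colour is \<open>c(j, i)\<close>.
\<close>

definition pairs :: "(nat \<times> nat) set" where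
  "pairs = {(i, j). 1 \<le> j \<and> j < i \<and> i \<le> n}"

definition r :: "nat \<times> nat \<Rightarrow> 'h list \<Rightarrow> 'k" where
  "r e = dual 2 (R (c (snd e, fst e)))"

definition ri :: "nat \<times> nat \<Rightarrow> 'h list \<Rightarrow> 'k" where
  "ri e = dual 2 (conv_inverse B 2 (R (c (snd e, fst e))))"

definition X :: "nat \<times> nat \<Rightarrow> 'h list \<Rightarrow> 'k" where
  "X e = pairop (2 * n) (fst e - 1) (n + snd e - 1) (r e)"

definition Y :: "nat \<times> nat \<Rightarrow> 'h list \<Rightarrow> 'k" where
  "Y e = pairop (2 * n) (fst e - 1) (n + snd e - 1) (ri e)"

lemma r_inverse:
  assumes "e \<in> pairs"
  shows "r e \<in> fnl 2" "ri e \<in> fnl 2" "cv (r e) (ri e) = un 2" "cv (ri e) (r e) = un 2"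
proof -
  have e: "1 \<le> snd e" "snd e < fst e" "fst e \<le> n" using assms by (auto simp: pairs_def)
  show r: "r e \<in> fnl 2" unfolding r_def using e by (intro R_fnl) auto
  have "is_conv_inverse B 2 (R (c (snd e, fst e))) (conv_inverse B 2 (R (c (snd e, fst e))))"
    using e by (intro is_conv_inverse_conv_inverse R_inverse) auto
  from dual_conv_inverse_fnl[OF this r[unfolded r_def]]
  show "ri e \<in> fnl 2" "cv (r e) (ri e) = un 2" "cv (ri e) (r e) = un 2" by (simp_all add: r_def ri_def)
qed

lemma X_inverse:
  assumes "e \<in> pairs"
  shows "X e \<in> fnl (2 * n)" "Y e \<in> fnl (2 * n)" "cv (X e) (Y e) = un (2 * n)" "cv (Y e) (X e) = un (2 * n)"
proof -
  have e: "fst e - 1 < n + snd e - 1" "n + snd e - 1 < 2 * n" using assms by (auto simp: pairs_def)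
  then show "X e \<in> fnl (2 * n)" "Y e \<in> fnl (2 * n)" unfolding X_def Y_def
    by (auto intro!: pairop_fnl r_inverse assms)
  show "cv (X e) (Y e) = un (2 * n)" "cv (Y e) (X e) = un (2 * n)" unfolding X_def Y_def
    using e by (simp_all add: pairop_cv r_inverse assms pairop_un)
qed

text \<open>The first entry of a pair addresses the first half of the word and the second entry the
  second half, so pairs differing in both entries act on disjoint positions.\<close>

lemma X_commute:
  assumes "e \<in> pairs" "e' \<in> pairs" "fst e \<noteq> fst e'" "snd e \<noteq> snd e'"
  shows "cv (X e) (X e') = cv (X e') (X e)"
  unfolding X_def by (rule pairop_commute) (use assms r_inverse in \<open>auto simp: pairs_def\<close>)

definition rows :: "nat \<Rightarrow> (nat \<times> nat) list" where
  "rows m = concat (map (\<lambda>i. map (Pair i) (rev [1..<i])) [2..<m + 1])"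

text \<open>The order produced by the maps \<open>Psi\<close>: the letter b_j passes a_m, ...,
  a_{j+1}, for j = 1, 2, ..., and each later step is put in front of the earlier ones.\<close>

definition columns :: "nat \<Rightarrow> (nat \<times> nat) list" where
  "columns m = concat (map (\<lambda>j. map (\<lambda>i. (i, j)) [j + 1..<m + 1]) (rev [1..<m]))"

lemma set_rows: "m \<le> n \<Longrightarrow> set (rows m) \<subseteq> pairs"
  by (auto simp: rows_def pairs_def)

lemma set_columns: "m \<le> n \<Longrightarrow> set (columns m) \<subseteq> pairs"
  by (auto simp: columns_def pairs_def)

text \<open>Induction on the number of letters. Passing to \<open>Suc m\<close> appends (Suc m, j)
  to each column j; these entries commute with the entries of other columns, and collected on the
  right they form the new row, with j decreasing as required.\<close>

lemma cprod_columns_eq_rows: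
  "m \<le> n \<Longrightarrow> cprod (2 * n) (map X (columns m)) = cprod (2 * n) (map X (rows m))"
proof (induction m)
  case (Suc m)
  show ?case
  proof (cases "m = 0")
    case True
    then show ?thesis by (simp add: rows_def columns_def)
  next
    case False
    let ?A = "\<lambda>j. map X (map (\<lambda>i. (i, j)) [j + 1..<m + 1])" and ?x = "\<lambda>j. X (Suc m, j)"
      and ?js = "rev [1..<Suc m]"
    have p: "j \<in> set ?js \<Longrightarrow> (Suc m, j) \<in> pairs" "j \<in> set ?js \<Longrightarrow> i \<in> set [j + 1..<m + 1] \<Longrightarrow> (i, j) \<in> pairs" for i j
      using Suc.prems by (auto simp: pairs_def)
    have "map X (columns (Suc m)) = concat (map (\<lambda>j. ?A j @ [?x j]) ?js)"
      unfolding columns_def map_concat map_map by (intro arg_cong[of _ _ concat] map_cong) (auto simp: comp_def)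
    then have "cprod (2 * n) (map X (columns (Suc m))) = cprod (2 * n) (concat (map (\<lambda>j. ?A j @ [?x j]) ?js))"
      by simp
    also have "\<dots> = cv (cprod (2 * n) (concat (map ?A ?js))) (cprod (2 * n) (map ?x ?js))"
    proof (rule cprod_interleave)
      show "distinct ?js" by simp
      show "?x j \<in> fnl (2 * n) \<and> set (?A j) \<subseteq> fnl (2 * n)" if "j \<in> set ?js" for j
        using p that X_inverse(1) by fastforce
    next
      fix j j' F assume *: "j \<in> set ?js" "j' \<in> set ?js" "j \<noteq> j'" "F \<in> set (?A j')"
      then obtain i where i: "F = X (i, j')" "i \<in> set [j' + 1..<m + 1]" by auto
      have "cv (X (Suc m, j)) (X (i, j')) = cv (X (i, j')) (X (Suc m, j))"
        using * i by (intro X_commute p) auto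
      then show "cv (?x j) F = cv F (?x j)" unfolding i(1) .
    qed
    \<comment> \<open>\<open>?js\<close> also contains \<open>m\<close>, whose block is
      empty.\<close>
    also have "concat (map ?A ?js) = map X (columns m)"
      using False by (simp add: columns_def map_concat comp_def)
    also have "cprod (2 * n) (map X (columns m)) = cprod (2 * n) (map X (rows m))" using Suc by simp
    also have "map ?x ?js = map X (map (Pair (Suc m)) ?js)" by simp
    also have "cv (cprod (2 * n) (map X (rows m))) (cprod (2 * n) (map X (map (Pair (Suc m)) ?js))) =
        cprod (2 * n) (map X (rows (Suc m)))"
    proof -
      have "rows (Suc m) = rows m @ map (Pair (Suc m)) ?js" using False by (simp add: rows_def)
      moreover have "set (map X (rows m)) \<subseteq> fnl (2 * n)" "set (map X (map (Pair (Suc m)) ?js)) \<subseteq> fnl (2 * n)"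
        using set_rows[of m] Suc.prems X_inverse(1) p(1) by auto
      ultimately show ?thesis by (simp only: map_append cprod_append)
    qed
    finally show ?thesis .
  qed
qed (simp add: rows_def columns_def)

abbreviation J :: "'h list \<Rightarrow> 'k" where "J \<equiv> dual (2 * n) (twist_J B R n c)"

abbreviation Jinv :: "'h list \<Rightarrow> 'k" where "Jinv \<equiv> dual (2 * n) (conv_inverse B (2 * n) (twist_J B R n c))"

lemma J_eq: "J = cprod (2 * n) (map X (rows n))"
proof -
  let ?f = "\<lambda>(i, j). functional_at B (2 * n) [i, n + j] (R (c (j, i)))"
  have f: "dual (2 * n) (?f e) = X e" if "e \<in> pairs" for e
  proof -
    obtain i j where e: "e = (i, j)" "1 \<le> j" "j < i" "i \<le> n" using \<open>e \<in> pairs\<close> by (auto simp: pairs_def)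
    then have "dual (2 * n) (functional_at B (2 * n) [Suc (i - 1), Suc (n + j - 1)] (R (c (j, i)))) =
        pairop (2 * n) (i - 1) (n + j - 1) (dual 2 (R (c (j, i))))"
      by (intro dual_functional_at R_fnl) auto
    then show ?thesis using e by (simp add: X_def r_def)
  qed
  have fs: "dual (2 * n) f \<in> fnl (2 * n)" if "f \<in> set (map ?f (rows n))" for f
    using that f set_rows[of n] X_inverse(1) by fastforce
  have "twist_J B R n c = foldr (conv B (2 * n)) (map ?f (rows n)) (counit_power B (2 * n))"
    unfolding twist_J_def rows_def map_concat map_map by (simp add: comp_def)
  then have "J = cprod (2 * n) (map (dual (2 * n)) (map ?f (rows n)))"
    using dual_foldr_conv[of "map ?f (rows n)" "2 * n", OF fs] by simp
  also have "map (dual (2 * n)) (map ?f (rows n)) = map X (rows n)"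
    unfolding map_map comp_def using f set_rows[of n] by (intro map_cong) auto
  finally show ?thesis .
qed

lemma J_fnl: "J \<in> fnl (2 * n)"
  unfolding J_eq using set_rows[of n] X_inverse(1) by (intro cprod_fnl) auto

text \<open>Any ordering of the factors whose product is \<open>J\<close> gives the inverse by
  reversal. The rows serve the explicit formula, the columns the composition of the maps
  \<open>Psi\<close>.\<close>

lemma Jinv_eq:
  assumes "set es \<subseteq> pairs" "cprod (2 * n) (map X es) = J"
  shows "Jinv = cprod (2 * n) (map Y (rev es))"
proof (rule dual_conv_inverse[OF J_fnl])
  have *: "set (rev es) \<subseteq> pairs" using assms(1) by simp
  show "cprod (2 * n) (map Y (rev es)) \<in> fnl (2 * n)"
    using * X_inverse(2) by (intro cprod_fnl) auto
  show "cv J (cprod (2 * n) (map Y (rev es))) = un (2 * n)"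
    unfolding assms(2)[symmetric] using assms(1) X_inverse by (intro cprod_inverse) auto
  have "cv (cprod (2 * n) (map Y (rev es))) (cprod (2 * n) (map X (rev (rev es)))) = un (2 * n)"
    using * X_inverse by (intro cprod_inverse) auto
  then show "cv (cprod (2 * n) (map Y (rev es))) J = un (2 * n)" using assms(2) by simp
qed

lemma Jinv_fnl: "Jinv \<in> fnl (2 * n)"
  unfolding Jinv_eq[OF set_rows[OF order_refl] J_eq[symmetric]]
  using set_rows[OF order_refl] X_inverse(2) by (intro cprod_fnl) fastforce

lemma Jinv_inverse: "cv J Jinv = un (2 * n)" "cv Jinv J = un (2 * n)"
proof -
  have "set (rows n) \<subseteq> pairs" "set (rev (rows n)) \<subseteq> pairs" using set_rows[of n] by simp_all
  then have "cv (cprod (2 * n) (map X (rows n))) (cprod (2 * n) (map Y (rev (rows n)))) = un (2 * n)"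
    "cv (cprod (2 * n) (map Y (rev (rows n)))) (cprod (2 * n) (map X (rev (rev (rows n))))) = un (2 * n)"
    using X_inverse by (intro cprod_inverse; auto)+
  then show "cv J Jinv = un (2 * n)" "cv Jinv J = un (2 * n)"
    using Jinv_eq[OF set_rows[OF order_refl] J_eq[symmetric]] by (simp_all add: J_eq)
qed

lemmas tens_twisted_mult_J = tens_twisted_mult[OF _ _ J_fnl Jinv_fnl]

section \<open>The composition of the maps \<open>\<Psi>\<close>\<close>

lemma tens_cong_mlin:
  "tens m x S \<Longrightarrow> fsum m T \<Longrightarrow> (\<And>f. mlin f \<Longrightarrow> S f = T f) \<Longrightarrow> tens m x T"
  by (auto simp: tens_def)

lemma res_arr_fnl:
  assumes "mlin f" "distinct \<pi>" "set \<pi> = {..<N}"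
  shows "res N (\<lambda>w. f (arr \<pi> w)) \<in> fnl N"
  unfolding arr_def
proof (rule res_fnl, unfold ml_iff_lin, intro allI impI)
  fix w :: "'h list" and i assume "length w = N" "i < N"
  then show "lin (\<lambda>x. f (map ((!) (w[i := x])) \<pi>))" using assms by (intro lin_map_nth) simp_all
qed

lemma swap_at_perm:
  assumes "Suc p < length \<pi>"
  shows "distinct (swap_at p \<pi>) = distinct \<pi>" "set (swap_at p \<pi>) = set \<pi>"
proof -
  obtain us a b vs where w: "\<pi> = us @ [a, b] @ vs" "length us = p" using assms by (rule decompose_at)
  show "distinct (swap_at p \<pi>) = distinct \<pi>" "set (swap_at p \<pi>) = set \<pi>"
    unfolding w(1) swap_at_append[OF w(2)] by auto
qed

text \<open>
  After the steps \<open>es\<close> (last one first), the tensor \<open>t\<close> evaluates \<open>f\<close> by conjugating it with the factors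
  of these steps, the letters having been rearranged to \<open>\<pi>\<close>.
\<close>

definition state :: "('k, 'h) tensor \<Rightarrow> (('h list \<Rightarrow> 'k) \<Rightarrow> 'k) \<Rightarrow> nat list \<Rightarrow> (nat \<times> nat) list \<Rightarrow> bool" where
  "state t S \<pi> es \<longleftrightarrow> fsum (2 * n) S \<and> coalg_map (2 * n) \<pi> \<and> distinct \<pi> \<and> set \<pi> = {..<2 * n} \<and> set es \<subseteq> pairs \<and>
     tens (2 * n) t (\<lambda>f. S (cv (cprod (2 * n) (map Y (rev es)))
       (cv (res (2 * n) (\<lambda>w. f (arr \<pi> w))) (cprod (2 * n) (map X es)))))"

text \<open>Pulled back along \<pi>, the conjugation at the adjacent places \<open>p\<close> and
  \<open>Suc p\<close> becomes conjugation by the factor of \<open>e\<close> at the original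
  positions. It acts innermost, next to \<open>f\<close>, so \<open>Y e\<close> joins the left
  product at its right end and \<open>X e\<close> the right product at its left end.\<close>

lemma state_step:
  assumes st: "state t S \<pi> es" and e: "e \<in> pairs" and p: "Suc p < 2 * n"
    and \<pi>p: "\<pi> ! p = fst e - 1" "\<pi> ! Suc p = n + snd e - 1"
  shows "state (amplify B p 2 (Psi B (R (c (snd e, fst e)))) (2 * n - p - 2) t) S (swap_at p \<pi>) (e # es)"
proof -
  let ?N = "2 * n" and ?\<pi> = "swap_at p \<pi>"
  let ?A = "cprod ?N (map Y (rev es))" and ?D = "cprod ?N (map X es)"
  from st have S: "fsum ?N S" and \<pi>: "coalg_map ?N \<pi>" "distinct \<pi>" "set \<pi> = {..<?N}" and es: "set es \<subseteq> pairs"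
    and t: "tens ?N t (\<lambda>f. S (cv ?A (cv (res ?N (\<lambda>w. f (arr \<pi> w))) ?D)))" by (auto simp: state_def)
  have l: "length \<pi> = ?N" using distinct_card[OF \<pi>(2)] \<pi>(3) by simp
  have \<pi>': "distinct ?\<pi>" "set ?\<pi> = {..<?N}" "coalg_map ?N ?\<pi>"
    using \<pi> p l by (simp_all add: swap_at_perm coalg_map_swap_at)
  have A: "?A \<in> fnl ?N" and D: "?D \<in> fnl ?N" 
  proof -
    have "set (map Y (rev es)) \<subseteq> fnl ?N" "set (map X es) \<subseteq> fnl ?N" using es X_inverse(1,2) by auto
    then show "?A \<in> fnl ?N" "?D \<in> fnl ?N" by (simp_all only: cprod_fnl)
  qed
  note e' = r_inverse[OF e, unfolded r_def ri_def]
  have lt: "\<pi> ! p < \<pi> ! Suc p" using e \<pi>p by (auto simp: pairs_def)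
  let ?P = "pairop ?N p (Suc p) (r e)" and ?Q = "pairop ?N p (Suc p) (ri e)"
  have PQ: "res ?N (\<lambda>w. ?P (arr \<pi> w)) = X e" "res ?N (\<lambda>w. ?Q (arr \<pi> w)) = Y e"
    using pairop_arr[OF \<pi>(2,3) p lt] by (simp_all add: X_def Y_def \<pi>p)
  have AY: "cprod ?N (map Y (rev (e # es))) = cv ?A (Y e)"
  proof -
    have "set (map Y (rev es)) \<subseteq> fnl ?N" "set [Y e] \<subseteq> fnl ?N" using es e X_inverse(2) by auto
    from cprod_append[OF this] show ?thesis using X_inverse(2)[OF e] by simp
  qed
  let ?T = "\<lambda>f. S (cv (cprod ?N (map Y (rev (e # es))))
       (cv (res ?N (\<lambda>w. f (arr ?\<pi> w))) (cprod ?N (map X (e # es)))))"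
  have "tens ?N (amplify B p 2 (Psi B (R (c (snd e, fst e)))) (2 * n - p - 2) t)
    (\<lambda>f. S (cv ?A (cv (res ?N (\<lambda>w. cv ?Q (cv (res ?N (\<lambda>w. f (swap_at p w))) ?P) (arr \<pi> w))) ?D)))"
    unfolding r_def ri_def by (rule tens_amplify_Psi[OF t _ e'(1,2)]) (use p in simp)
  then have "tens ?N (amplify B p 2 (Psi B (R (c (snd e, fst e)))) (2 * n - p - 2) t) ?T"
  proof (rule tens_cong_mlin)
    show "fsum ?N ?T"
      by (rule fsum_bind[OF S], rule fsum_cv_middle) (simp add: res_apply fsum_single length_swap_at l p)
  next
    fix f assume f: "mlin f"
    let ?M = "res ?N (\<lambda>w. f (arr ?\<pi> w))"
    have M: "?M \<in> fnl ?N" by (rule res_arr_fnl[OF f \<pi>'(1,2)])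
    have "res ?N (\<lambda>w. res ?N (\<lambda>w. f (swap_at p w)) (arr \<pi> w)) = ?M"
      using p l by (auto simp: res_def arr_swap_at)
    then have "res ?N (\<lambda>w. cv ?Q (cv (res ?N (\<lambda>w. f (swap_at p w))) ?P) (arr \<pi> w)) = cv (Y e) (cv ?M (X e))"
      by (simp only: res_cv_arr[OF \<pi>(1)] PQ)
    moreover have "cv ?A (cv (cv (Y e) (cv ?M (X e))) ?D) = cv (cv ?A (Y e)) (cv ?M (cv (X e) ?D))"
      using A D M X_inverse[OF e] by (simp add: cv_assoc[of _ ?N] cv_fnl)
    ultimately show "S (cv ?A (cv (res ?N (\<lambda>w. cv ?Q (cv (res ?N (\<lambda>w. f (swap_at p w))) ?P) (arr \<pi> w))) ?D)) = ?T f"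
      unfolding AY by simp
  qed
  then show ?thesis using S \<pi>' es e by (simp add: state_def)
qed

text \<open>
  The order of the \<open>2 n\<close> tensor factors while the factor \<open>b\<^sub>i\<close> moves to the left, when it stands
  just before \<open>a\<^sub>j\<close>; factors are numbered by their original positions, counted from \<open>0\<close>.
\<close>

definition word :: "nat \<Rightarrow> nat \<Rightarrow> nat list" where
  "word i j = concat (map (\<lambda>s. [s - 1, n + s - 1]) [1..<i]) @ map (\<lambda>s. s - 1) [i..<j] @
     [n + i - 1] @ map (\<lambda>s. s - 1) [j..<n + 1] @ map (\<lambda>s. n + s - 1) [i + 1..<n + 1]"

lemma length_concat_pairs: "length (concat (map (\<lambda>s. [f s, g s]) xs)) = 2 * length xs"
  by (induction xs) simp_all

lemma word_split:
  assumes "1 \<le> i" "i < j" "j \<le> n"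
  shows "word i (Suc j) = (concat (map (\<lambda>s. [s - 1, n + s - 1]) [1..<i]) @ map (\<lambda>s. s - 1) [i..<j]) @
      [j - 1, n + i - 1] @ map (\<lambda>s. s - 1) [Suc j..<n + 1] @ map (\<lambda>s. n + s - 1) [i + 1..<n + 1]"
    "word i j = (concat (map (\<lambda>s. [s - 1, n + s - 1]) [1..<i]) @ map (\<lambda>s. s - 1) [i..<j]) @
      [n + i - 1, j - 1] @ map (\<lambda>s. s - 1) [Suc j..<n + 1] @ map (\<lambda>s. n + s - 1) [i + 1..<n + 1]"
proof -
  have "[i..<Suc j] = [i..<j] @ [j]" using assms by simp
  then show "word i (Suc j) = (concat (map (\<lambda>s. [s - 1, n + s - 1]) [1..<i]) @ map (\<lambda>s. s - 1) [i..<j]) @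
      [j - 1, n + i - 1] @ map (\<lambda>s. s - 1) [Suc j..<n + 1] @ map (\<lambda>s. n + s - 1) [i + 1..<n + 1]"
    unfolding word_def by simp
  have "[j..<n + 1] = j # [Suc j..<n + 1]" using assms by (intro upt_conv_Cons) simp
  then show "word i j = (concat (map (\<lambda>s. [s - 1, n + s - 1]) [1..<i]) @ map (\<lambda>s. s - 1) [i..<j]) @
      [n + i - 1, j - 1] @ map (\<lambda>s. s - 1) [Suc j..<n + 1] @ map (\<lambda>s. n + s - 1) [i + 1..<n + 1]"
    unfolding word_def by (simp del: upt_Suc)
qed

text \<open>Once b_i stands right after a_i, the letter b_{i+1} already stands right after a_n,
  ready for its own moves.\<close>

lemma word_next: "1 \<le> i \<Longrightarrow> i < n \<Longrightarrow> word i (Suc i) = word (Suc i) (n + 1)"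
proof -
  assume i: "1 \<le> i" "i < n"
  have "[Suc i..<n + 1] = Suc i # [Suc (Suc i)..<n + 1]" using i by (intro upt_conv_Cons) simp
  moreover have "[1..<Suc i] = [1..<i] @ [i]" "[i..<Suc i] = [i]" using i by simp_all
  ultimately show ?thesis unfolding word_def by (simp del: upt_Suc)
qed

abbreviation PsiStep :: "nat \<Rightarrow> nat \<Rightarrow> ('k, 'h) tensor \<Rightarrow> ('k, 'h) tensor" where
  "PsiStep i j \<equiv> amplify B (i + j - 2) 2 (Psi B (R (c (i, j)))) (2 * n - i - j)"

text \<open>b_i passes a_n, ..., a_{i+1} in this order, and the rightmost map of a composition acts
  first. Hence the induction runs downwards from \<open>n + 1\<close>, adding maps at the
  left.\<close>

lemma state_row:
  assumes st: "state t S (word i (n + 1)) es" and i: "1 \<le> i" "i < n"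
  shows "state (foldr (\<circ>) (map (PsiStep i) [i + 1..<n + 1]) id t) S (word i (Suc i))
    (map (\<lambda>j. (j, i)) [i + 1..<n + 1] @ es)"
proof -
  have "state (foldr (\<circ>) (map (PsiStep i) [Suc i..<n + 1]) id t) S (word i (Suc i))
      (map (\<lambda>j. (j, i)) [Suc i..<n + 1] @ es)"
  proof (rule inc_induct[of "Suc i" "n + 1"])
    show "Suc i \<le> n + 1" using i by simp
    show "state (foldr (\<circ>) (map (PsiStep i) [n + 1..<n + 1]) id t) S (word i (n + 1))
        (map (\<lambda>j. (j, i)) [n + 1..<n + 1] @ es)" using st by simp
  next
    fix j assume j: "Suc i \<le> j" "j < n + 1"
      and IH: "state (foldr (\<circ>) (map (PsiStep i) [Suc j..<n + 1]) id t) S (word i (Suc j))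
        (map (\<lambda>j. (j, i)) [Suc j..<n + 1] @ es)"
    have u: "[j..<n + 1] = j # [Suc j..<n + 1]" using j by (intro upt_conv_Cons) simp
    let ?us = "concat (map (\<lambda>s. [s - 1, n + s - 1]) [1..<i]) @ map (\<lambda>s. s - 1) [i..<j]"
    \<comment> \<open>Before the exchanged pair stand the \<open>2 * (i - 1)\<close> letters of the
      finished pairs and the \<open>j - i\<close> letters a_i, ..., a_{j-1}.\<close>
    have l: "length ?us = i + j - 2" using i j by (simp add: length_concat_pairs)
    have "1 \<le> i" "i < j" "j \<le> n" using i j by auto
    note w = word_split[OF this]
    have "state (amplify B (i + j - 2) 2 (Psi B (R (c (snd (j, i), fst (j, i))))) (2 * n - (i + j - 2) - 2)
        (foldr (\<circ>) (map (PsiStep i) [Suc j..<n + 1]) id t)) S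
        (swap_at (i + j - 2) (word i (Suc j))) ((j, i) # map (\<lambda>j. (j, i)) [Suc j..<n + 1] @ es)"
    proof (rule state_step[OF IH])
      show "(j, i) \<in> pairs" "Suc (i + j - 2) < 2 * n" using i j by (auto simp: pairs_def)
      show "word i (Suc j) ! (i + j - 2) = fst (j, i) - 1" "word i (Suc j) ! Suc (i + j - 2) = n + snd (j, i) - 1"
        unfolding w(1) nth_append[of ?us] l by simp_all
    qed
    moreover have "swap_at (i + j - 2) (word i (Suc j)) = word i j"
      unfolding w by (rule swap_at_append[OF l])
    moreover have "2 * n - (i + j - 2) - 2 = 2 * n - i - j" using i j by auto
    ultimately show "state (foldr (\<circ>) (map (PsiStep i) [j..<n + 1]) id t) S (word i j)
        (map (\<lambda>j. (j, i)) [j..<n + 1] @ es)" unfolding u by (simp del: upt_Suc)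
  qed
  then show ?thesis by simp
qed

lemma foldr_comp_append: "foldr (\<circ>) (fs @ gs) id x = foldr (\<circ>) fs id (foldr (\<circ>) gs id x)"
  by (induction fs) simp_all

lemma state_all_rows:
  assumes st: "state t S (word 1 (n + 1)) []" and m: "1 \<le> m" "m \<le> n"
  shows "state (foldr (\<circ>) (concat (map (\<lambda>i. map (PsiStep i) [i + 1..<n + 1]) (rev [1..<m]))) id t) S
    (word m (n + 1)) (concat (map (\<lambda>i. map (\<lambda>j. (j, i)) [i + 1..<n + 1]) (rev [1..<m])))"
  using m
proof (induction m rule: nat_induct_at_least)
  case base
  then show ?case using st by simp
next
  case (Suc m)
  then have m: "1 \<le> m" "m < n" "m \<le> n" by simp_all
  from state_row[OF Suc.IH[OF m(3)] m(1,2)] have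
    "state (foldr (\<circ>) (map (PsiStep m) [m + 1..<n + 1] @ concat (map (\<lambda>i. map (PsiStep i) [i + 1..<n + 1]) (rev [1..<m]))) id t) S
      (word m (Suc m)) (map (\<lambda>j. (j, m)) [m + 1..<n + 1] @ concat (map (\<lambda>i. map (\<lambda>j. (j, i)) [i + 1..<n + 1]) (rev [1..<m])))"
    by (simp only: foldr_comp_append)
  moreover have "rev [1..<Suc m] = m # rev [1..<m]" using Suc.hyps by simp
  moreover have "word m (Suc m) = word (Suc m) (n + 1)" using Suc by (intro word_next) auto
  ultimately show ?case by (simp only: list.map concat.simps)
qed

lemma tens_mult_power:
  assumes "tens (2 * m) t S"
  shows "tens m (mult_power B m t) (\<lambda>f. S (\<lambda>hs. f (map (\<lambda>s. hs ! (2 * s) * hs ! (2 * s + 1)) [0..<m])))"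
  unfolding mult_power_def
proof (rule tens_tlift[OF assms])
  show "tens m (pure B (map (\<lambda>s. hs ! (2 * s) * hs ! (2 * s + 1)) [0..<m]))
      (\<lambda>f. f (map (\<lambda>s. hs ! (2 * s) * hs ! (2 * s + 1)) [0..<m]))" for hs
    by (rule tens_pure) simp
next
  fix f assume f: "mlin f"
  let ?m = "\<lambda>hs. map (\<lambda>s. hs ! (2 * s) * hs ! (2 * s + 1)) [0..<m]"
  show "ml (2 * m) (\<lambda>hs. f (?m hs))"
    unfolding ml_iff_lin
  proof (intro allI impI)
    fix hs :: "'h list" and i assume *: "length hs = 2 * m" "i < 2 * m"
    have l: "lin (\<lambda>x. f ((?m hs)[j := x]))" if "j < m" for j using f that by (simp add: ml_iff_lin)
    show "lin (\<lambda>x. f (?m (hs[i := x])))"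
    proof (cases "even i")
      case True
      then obtain j where j: "i = 2 * j" by (auto elim: evenE)
      then have "?m (hs[i := x]) = (?m hs)[j := x * hs ! Suc i]" for x
        using * by (intro nth_equalityI) (auto simp: nth_list_update, presburger?)
      then show ?thesis using lin_comp_mult_left[OF l[of j]] * j by simp
    next
      case False
      then obtain j where j: "i = Suc (2 * j)" by (auto elim: oddE)
      then have "?m (hs[i := x]) = (?m hs)[j := hs ! (2 * j) * x]" for x
        using * by (intro nth_equalityI) (auto simp: nth_list_update, presburger?)
      then show ?thesis using lin_comp_mult_right[OF l[of j]] * j by simp
    qed
  qed
qed

theorem twisted_mult_eq_Psi:
  assumes n: "n \<ge> 1" and x: "x \<in> tensor_power B n" and y: "y \<in> tensor_power B n"
  shows "twisted_mult B R n c x y = mult_power B n (foldr (\<circ>)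
     [PsiStep i j. i \<leftarrow> rev [1..<n], j \<leftarrow> [i + 1..<n + 1]] id (tprod B x y))"
proof -
  obtain S T where S: "tens n x S" and T: "tens n y T" using x y by (metis tens_power)
  let ?S = "\<lambda>f. S (\<lambda>us. T (\<lambda>vs. f (us @ vs)))"
  have ST: "tens (2 * n) (tprod B x y) ?S" using tens_tprod[OF S T] by (simp add: mult_2)
  have w: "word 1 (n + 1) = [0..<2 * n]"
  proof -
    have "word 1 (n + 1) = map (\<lambda>s. s - 1) [1..<n + 1] @ [n] @ map (\<lambda>s. n + s - 1) [2..<n + 1]"
      by (simp add: word_def numeral_2_eq_2)
    also have "\<dots> = [0..<2 * n]"
      using n by (intro nth_equalityI) (auto simp: nth_append nth_Cons split: nat.split)
    finally show ?thesis .
  qed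
  have "state (tprod B x y) ?S (word 1 (n + 1)) []"
    unfolding state_def w
  proof (intro conjI)
    show "tens (2 * n) (tprod B x y) (\<lambda>f. ?S (cv (cprod (2 * n) (map Y (rev [])))
         (cv (res (2 * n) (\<lambda>w. f (arr [0..<2 * n] w))) (cprod (2 * n) (map X [])))))"
    proof (rule tens_cong_mlin[OF ST])
      show "fsum (2 * n) (\<lambda>f. ?S (cv (cprod (2 * n) (map Y (rev [])))
         (cv (res (2 * n) (\<lambda>w. f (arr [0..<2 * n] w))) (cprod (2 * n) (map X [])))))"
        by (rule fsum_bind[OF tens_fsum[OF ST]], rule fsum_cv_middle) (simp add: res_apply fsum_single)
    next
      fix f assume f: "mlin f"
      have e: "res (2 * n) (\<lambda>w. f (arr [0..<2 * n] w)) = res (2 * n) f" by (auto simp: res_def arr_upt)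
      have "res (2 * n) f \<in> fnl (2 * n)" using f by (simp add: res_fnl)
      then have "?S (cv (cprod (2 * n) (map Y (rev [])))
         (cv (res (2 * n) (\<lambda>w. f (arr [0..<2 * n] w))) (cprod (2 * n) (map X [])))) = ?S (res (2 * n) f)"
        unfolding e by simp
      also have "\<dots> = ?S f" by (rule fsum_cong[OF tens_fsum[OF ST]]) (simp add: res_apply)
      finally show "?S f = ?S (cv (cprod (2 * n) (map Y (rev [])))
         (cv (res (2 * n) (\<lambda>w. f (arr [0..<2 * n] w))) (cprod (2 * n) (map X []))))" ..
    qed
  qed (use tens_fsum[OF ST] coalg_map_upt in auto)
  from state_all_rows[OF this n order_refl]
  have "tens (2 * n) (foldr (\<circ>) [PsiStep i j. i \<leftarrow> rev [1..<n], j \<leftarrow> [i + 1..<n + 1]] id (tprod B x y))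
     (\<lambda>f. ?S (cv (cprod (2 * n) (map Y (rev (columns n))))
       (cv (res (2 * n) (\<lambda>w. f (arr (word n (n + 1)) w))) (cprod (2 * n) (map X (columns n))))))"
    by (simp add: state_def columns_def)
  moreover have "cprod (2 * n) (map X (columns n)) = J" by (simp add: cprod_columns_eq_rows J_eq)
  \<comment> \<open>The inverse factors need no reordering of their own: the columns multiply to
    \<open>J\<close>, hence their reversed inverses to its inverse.\<close>
  moreover from this have "cprod (2 * n) (map Y (rev (columns n))) = Jinv"
    by (intro Jinv_eq[symmetric] set_columns) simp
  ultimately have "tens n (mult_power B n (foldr (\<circ>)
     [PsiStep i j. i \<leftarrow> rev [1..<n], j \<leftarrow> [i + 1..<n + 1]] id (tprod B x y)))
     (\<lambda>f. ?S (cv Jinv (cv (res (2 * n) (\<lambda>w. f (map (\<lambda>s. arr (word n (n + 1)) w ! (2 * s) *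
        arr (word n (n + 1)) w ! (2 * s + 1)) [0..<n]))) J)))"
    using tens_mult_power by fastforce
  \<comment> \<open>The final arrangement is a_1 b_1 a_2 b_2 ..., so multiplying neighbours in it
    amounts to multiplying the two halves of the original word.\<close>
  moreover have "res (2 * n) (\<lambda>w. f (map (\<lambda>s. arr (word n (n + 1)) w ! (2 * s) *
        arr (word n (n + 1)) w ! (2 * s + 1)) [0..<n])) = fmul n f" for f
  proof -
    let ?w = "word n (n + 1)"
    have "word n (n + 1) = concat (map (\<lambda>s. [s - 1, n + s - 1]) [1..<n + 1])"
      using n unfolding word_def by simp
    also have "\<dots> = concat (map2 (\<lambda>u v. [u, v]) [0..<n] [n..<2 * n])"
    proof (rule arg_cong[of _ _ concat])
      show "map (\<lambda>s. [s - 1, n + s - 1]) [1..<n + 1] = map2 (\<lambda>u v. [u, v]) [0..<n] [n..<2 * n]"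
        by (rule nth_equalityI) (auto simp del: upt_Suc)
    qed
    finally have w: "?w = concat (map2 (\<lambda>u v. [u, v]) [0..<n] [n..<2 * n])" .
    have nw: "?w ! (2 * s) = s" "?w ! (2 * s + 1) = n + s" if "s < n" for s
      unfolding w using nth_weave[of "[0..<n]" n "[n..<2 * n]" s] that by simp_all
    have "length ?w = 2 * n" using n by (simp add: word_def length_concat_pairs)
    then have "map (\<lambda>s. arr ?w v ! (2 * s) * arr ?w v ! (2 * s + 1)) [0..<n] = map2 (*) (take n v) (drop n v)"
      if "length v = 2 * n" for v :: "'h list"
      using that by (intro nth_equalityI) (simp_all add: arr_def nw nw[simplified] del: upt_Suc)
    then show ?thesis by (auto simp: fmul_def res_def)
  qed
  ultimately have "tens n (mult_power B n (foldr (\<circ>)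
     [PsiStep i j. i \<leftarrow> rev [1..<n], j \<leftarrow> [i + 1..<n + 1]] id (tprod B x y)))
     (\<lambda>f. ?S (cv Jinv (cv (fmul n f) J)))" by simp
  from tens_eqI[OF tens_twisted_mult_J[OF S T] this] show ?thesis by simp
qed

section \<open>The explicit formula\<close>

definition pair_ops :: "(nat \<times> nat \<Rightarrow> 'h list \<Rightarrow> 'k) \<Rightarrow> (nat \<times> nat) list \<Rightarrow> ('k, 'h) operation list" where
  "pair_ops g es = map (\<lambda>e. (\<lambda>p. p = fst e - 1 \<or> p = n + snd e - 1, g e)) es"

lemma pair_ops_simps [simp]:
  "pair_ops g [] = []"
  "pair_ops g (e # es) = (\<lambda>p. p = fst e - 1 \<or> p = n + snd e - 1, g e) # pair_ops g es"
  "pair_ops g (es @ es') = pair_ops g es @ pair_ops g es'"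
  by (simp_all add: pair_ops_def)

lemma idx_pairs: "(i, j) \<in> pairs \<Longrightarrow> idx (\<lambda>p. p = i - 1 \<or> p = n + j - 1) (2 * n) = [i - 1, n + j - 1]"
  by (rule idx_pair) (auto simp: pairs_def)

lemma op_eval_append:
  "op_eval N (ops @ ops') off y = op_eval N ops off y * op_eval N ops' (\<lambda>p. off p + op_count ops p) y"
proof (induction ops arbitrary: off)
  case (Cons op ops)
  obtain P g where op: "op = (P, g)" by (cases op)
  have "(\<lambda>p. (if P p then Suc (off p) else off p) + op_count ops p) = (\<lambda>p. off p + op_count (op # ops) p)"
    unfolding op by auto
  then show ?case using Cons.IH op by (simp add: mult.assoc)
qed simp

lemma rows_Suc: "1 \<le> m \<Longrightarrow> rows (Suc m) = rows m @ map (Pair (Suc m)) (rev [1..<Suc m])"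
  by (simp add: rows_def)

lemma op_count_row_left:
  assumes "1 \<le> i" "i \<le> n" "1 \<le> k" "k \<le> n" "0 \<notin> set js"
  shows "op_count (pair_ops g (map (Pair i) js)) (k - 1) = (if k = i then length js else 0)"
  using assms(5) by (induction js) (use assms(1-4) in auto)

text \<open>The condition on 0 keeps the positions \<open>n + j - 1\<close> in the second half: j =
  0 would address a_n.\<close>

lemma op_count_row_right:
  assumes "1 \<le> i" "i \<le> n" "1 \<le> k" "0 \<notin> set js" "distinct js"
  shows "op_count (pair_ops g (map (Pair i) js)) (n + k - 1) = (if k \<in> set js then 1 else 0)"
  using assms(4,5)
proof (induction js)
  case (Cons j js)
  then have "n + k - 1 = n + j - 1 \<longleftrightarrow> k = j" "n + k - 1 \<noteq> i - 1" using assms(1-3) by auto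
  then show ?case using Cons by auto
qed simp

text \<open>a_k takes part in row k only, once for each j < k; b_k takes part once in every row i
  with k < i. Counting \<open>J\<close>, its inverse and the product, a_k gets 2k - 1 legs and b_k
  gets 2(n - k) + 1.\<close>

lemma op_count_rows:
  assumes "m \<le> n" "1 \<le> k" "k \<le> n"
  shows "op_count (pair_ops g (rows m)) (k - 1) = (if k \<le> m then k - 1 else 0)"
    "op_count (pair_ops g (rows m)) (n + k - 1) = m - k"
proof -
  have "op_count (pair_ops g (rows m)) (k - 1) = (if k \<le> m then k - 1 else 0) \<and>
      op_count (pair_ops g (rows m)) (n + k - 1) = m - k"
    using assms(1)
  proof (induction m)
    case (Suc m)
    show ?case
    proof (cases "m = 0")
      case True
      then show ?thesis using assms by (auto simp: rows_def)
    next
      case False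
      have "op_count (pair_ops g (map (Pair (Suc m)) (rev [1..<Suc m]))) (k - 1) = (if k = Suc m then m else 0)"
        using op_count_row_left[of "Suc m" k "rev [1..<Suc m]" g] assms Suc.prems by (simp del: upt_Suc)
      moreover have "op_count (pair_ops g (map (Pair (Suc m)) (rev [1..<Suc m]))) (n + k - 1) = (if k \<le> m then 1 else 0)"
        using op_count_row_right[of "Suc m" k "rev [1..<Suc m]" g] assms Suc.prems by (auto simp del: upt_Suc)
      moreover have "rows (Suc m) = rows m @ map (Pair (Suc m)) (rev [1..<Suc m])" using False by (simp add: rows_Suc)
      ultimately show ?thesis using Suc by (auto simp del: upt_Suc)
    qed
  qed (use assms in \<open>simp add: rows_def\<close>)
  then show "op_count (pair_ops g (rows m)) (k - 1) = (if k \<le> m then k - 1 else 0)"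
    "op_count (pair_ops g (rows m)) (n + k - 1) = m - k" by simp_all
qed

lemma op_count_rev: "op_count (pair_ops g (rev es)) p = op_count (pair_ops g' es) p"
  by (induction es) simp_all

lemma op_eval_row:
  assumes "i \<le> n"
  shows "m < i \<Longrightarrow> op_eval (2 * n) (pair_ops g (map (Pair i) (rev [1..<Suc m]))) off y =
    (\<Prod>j\<in>{1..m}. g (i, j) [y (i - 1) (off (i - 1) + (m - j)), y (n + j - 1) (off (n + j - 1))])"
proof (induction m arbitrary: off)
  case (Suc m)
  let ?off = "\<lambda>p. if p = i - 1 \<or> p = n + Suc m - 1 then Suc (off p) else off p"
  have p: "(i, Suc m) \<in> pairs" using assms Suc.prems by (auto simp: pairs_def)
  have "rev [1..<Suc (Suc m)] = Suc m # rev [1..<Suc m]" by simp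
  then have "op_eval (2 * n) (pair_ops g (map (Pair i) (rev [1..<Suc (Suc m)]))) off y =
      g (i, Suc m) [y (i - 1) (off (i - 1)), y (n + Suc m - 1) (off (n + Suc m - 1))] *
      op_eval (2 * n) (pair_ops g (map (Pair i) (rev [1..<Suc m]))) ?off y"
    using idx_pairs[OF p] by (simp del: upt_Suc)
  also have "op_eval (2 * n) (pair_ops g (map (Pair i) (rev [1..<Suc m]))) ?off y =
     (\<Prod>j\<in>{1..m}. g (i, j) [y (i - 1) (?off (i - 1) + (m - j)), y (n + j - 1) (?off (n + j - 1))])"
    using Suc.prems by (intro Suc.IH) simp
  also have "\<dots> = (\<Prod>j\<in>{1..m}. g (i, j) [y (i - 1) (off (i - 1) + (Suc m - j)), y (n + j - 1) (off (n + j - 1))])"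
  proof (rule prod.cong)
    fix j assume j: "j \<in> {1..m}"
    then have "?off (i - 1) + (m - j) = off (i - 1) + (Suc m - j)" "?off (n + j - 1) = off (n + j - 1)"
      using assms Suc.prems by auto
    then show "g (i, j) [y (i - 1) (?off (i - 1) + (m - j)), y (n + j - 1) (?off (n + j - 1))] =
       g (i, j) [y (i - 1) (off (i - 1) + (Suc m - j)), y (n + j - 1) (off (n + j - 1))]" by (simp only:)
  qed simp
  finally show ?case by (simp add: mult.commute)
qed simp

text \<open>Before the factor (i, j), a_i was used in row i for j' = i - 1, ..., j + 1, and b_j in
  the rows j + 1, ..., i - 1: both i - 1 - j times.\<close>

lemma op_eval_rows:
  "m \<le> n \<Longrightarrow> op_eval (2 * n) (pair_ops g (rows m)) off y =
    (\<Prod>i\<in>{2..m}. \<Prod>j\<in>{1..i - 1}. g (i, j) [y (i - 1) (off (i - 1) + (i - 1 - j)),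
       y (n + j - 1) (off (n + j - 1) + (i - 1 - j))])"
proof (induction m)
  case (Suc m)
  show ?case
  proof (cases "m = 0")
    case True
    then show ?thesis by (simp add: rows_def)
  next
    case False
    let ?off = "\<lambda>p. off p + op_count (pair_ops g (rows m)) p"
    have "op_eval (2 * n) (pair_ops g (rows (Suc m))) off y = op_eval (2 * n) (pair_ops g (rows m)) off y *
      op_eval (2 * n) (pair_ops g (map (Pair (Suc m)) (rev [1..<Suc m]))) ?off y"
    proof -
      have "rows (Suc m) = rows m @ map (Pair (Suc m)) (rev [1..<Suc m])" using False by (intro rows_Suc) simp
      then show ?thesis by (simp only: pair_ops_simps op_eval_append)
    qed
    also have "op_eval (2 * n) (pair_ops g (map (Pair (Suc m)) (rev [1..<Suc m]))) ?off y =
      (\<Prod>j\<in>{1..m}. g (Suc m, j) [y (Suc m - 1) (?off (Suc m - 1) + (m - j)), y (n + j - 1) (?off (n + j - 1))])"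
      using Suc.prems by (intro op_eval_row) simp_all
    also have "\<dots> = (\<Prod>j\<in>{1..Suc m - 1}. g (Suc m, j) [y (Suc m - 1) (off (Suc m - 1) + (Suc m - 1 - j)),
       y (n + j - 1) (off (n + j - 1) + (Suc m - 1 - j))])"
    proof (rule prod.cong)
      fix j assume j: "j \<in> {1..Suc m - 1}"
      then have "?off (Suc m - 1) = off (Suc m - 1)" "?off (n + j - 1) = off (n + j - 1) + (m - j)"
        using op_count_rows(1)[of m "Suc m" g] op_count_rows(2)[of m j g] Suc.prems by auto
      then show "g (Suc m, j) [y (Suc m - 1) (?off (Suc m - 1) + (m - j)), y (n + j - 1) (?off (n + j - 1))] =
        g (Suc m, j) [y (Suc m - 1) (off (Suc m - 1) + (Suc m - 1 - j)),
          y (n + j - 1) (off (n + j - 1) + (Suc m - 1 - j))]" by simp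
    qed simp
    finally show ?thesis using Suc False by (simp add: numeral_2_eq_2)
  qed
qed (simp add: rows_def)

lemma op_eval_rev_row:
  assumes "i \<le> n"
  shows "m < i \<Longrightarrow> op_eval (2 * n) (pair_ops g (map (Pair i) [1..<Suc m])) off y =
    (\<Prod>j\<in>{1..m}. g (i, j) [y (i - 1) (off (i - 1) + (j - 1)), y (n + j - 1) (off (n + j - 1))])"
proof (induction m)
  case (Suc m)
  let ?off = "\<lambda>p. off p + op_count (pair_ops g (map (Pair i) [1..<Suc m])) p"
  have p: "(i, Suc m) \<in> pairs" using assms Suc.prems by (auto simp: pairs_def)
  have off: "?off (i - 1) = off (i - 1) + (Suc m - 1)" "?off (n + Suc m - 1) = off (n + Suc m - 1)"
    using op_count_row_left[of i i "[1..<Suc m]" g] op_count_row_right[of i "Suc m" "[1..<Suc m]" g] assms Suc.prems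
    by (simp_all del: upt_Suc)
  have "[1..<Suc (Suc m)] = [1..<Suc m] @ [Suc m]" by simp
  then have "op_eval (2 * n) (pair_ops g (map (Pair i) [1..<Suc (Suc m)])) off y =
      op_eval (2 * n) (pair_ops g (map (Pair i) [1..<Suc m])) off y *
      op_eval (2 * n) (pair_ops g (map (Pair i) [Suc m])) ?off y"
    by (simp only: map_append pair_ops_simps op_eval_append)
  also have "op_eval (2 * n) (pair_ops g (map (Pair i) [Suc m])) ?off y =
      g (i, Suc m) [y (i - 1) (?off (i - 1)), y (n + Suc m - 1) (?off (n + Suc m - 1))]"
    using idx_pairs[OF p] by simp
  finally show ?case unfolding off using Suc by simp
qed simp

text \<open>In reversed order, before (i, j), a_i was used for the indices 1, ..., j - 1 and b_j in
  the rows m, ..., i + 1.\<close>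

lemma op_eval_rev_rows:
  "m \<le> n \<Longrightarrow> op_eval (2 * n) (pair_ops g (rev (rows m))) off y =
    (\<Prod>i\<in>{2..m}. \<Prod>j\<in>{1..i - 1}. g (i, j) [y (i - 1) (off (i - 1) + (j - 1)),
       y (n + j - 1) (off (n + j - 1) + (m - i))])"
proof (induction m arbitrary: off)
  case (Suc m)
  show ?case
  proof (cases "m = 0")
    case True
    then show ?thesis by (simp add: rows_def)
  next
    case False
    let ?row = "map (Pair (Suc m)) [1..<Suc m]"
    let ?off = "\<lambda>p. off p + op_count (pair_ops g ?row) p"
    have "rev (rows (Suc m)) = ?row @ rev (rows m)" using False by (simp add: rows_Suc rev_map del: upt_Suc)
    then have "op_eval (2 * n) (pair_ops g (rev (rows (Suc m)))) off y =
      op_eval (2 * n) (pair_ops g ?row) off y * op_eval (2 * n) (pair_ops g (rev (rows m))) ?off y"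
      by (simp only: pair_ops_simps op_eval_append)
    also have "op_eval (2 * n) (pair_ops g ?row) off y =
      (\<Prod>j\<in>{1..m}. g (Suc m, j) [y (Suc m - 1) (off (Suc m - 1) + (j - 1)), y (n + j - 1) (off (n + j - 1))])"
      using Suc.prems by (intro op_eval_rev_row) simp_all
    also have "op_eval (2 * n) (pair_ops g (rev (rows m))) ?off y =
      (\<Prod>i\<in>{2..m}. \<Prod>j\<in>{1..i - 1}. g (i, j) [y (i - 1) (?off (i - 1) + (j - 1)),
         y (n + j - 1) (?off (n + j - 1) + (m - i))])"
      using Suc.prems by (intro Suc.IH) simp
    also have "\<dots> = (\<Prod>i\<in>{2..m}. \<Prod>j\<in>{1..i - 1}. g (i, j) [y (i - 1) (off (i - 1) + (j - 1)),
         y (n + j - 1) (off (n + j - 1) + (Suc m - i))])"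
    proof (intro prod.cong refl)
      fix i j assume ij: "i \<in> {2..m}" "j \<in> {1..i - 1}"
      have "?off (i - 1) = off (i - 1)" "?off (n + j - 1) = off (n + j - 1) + 1"
        using op_count_row_left[of "Suc m" i "[1..<Suc m]" g] op_count_row_right[of "Suc m" j "[1..<Suc m]" g]
          ij Suc.prems by (auto simp del: upt_Suc)
      moreover have "off (n + j - 1) + 1 + (m - i) = off (n + j - 1) + (Suc m - i)" using ij by auto
      ultimately show "g (i, j) [y (i - 1) (?off (i - 1) + (j - 1)), y (n + j - 1) (?off (n + j - 1) + (m - i))] =
        g (i, j) [y (i - 1) (off (i - 1) + (j - 1)), y (n + j - 1) (off (n + j - 1) + (Suc m - i))]"
        by (simp only:)
    qed
    finally show ?thesis using False by (simp add: numeral_2_eq_2 mult.commute)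
  qed
qed (simp add: rows_def)

lemma pairs_Sigma: "pairs = (SIGMA i:{2..n}. {1..i - 1})"
  by (auto simp: pairs_def)

lemma cprod_res: "cprod N (map (res N) Gs) = res N (foldr cv Gs eps)"
  by (induction Gs) (simp_all add: un_def res_cv)

text \<open>The inverse of J uses the first i - 1 legs of a_i and the first n - j legs of b_j, the
  product the next leg of each, and J the remaining ones. Adding these offsets to the numbers of
  earlier uses in the rows, and counting from 1, gives the leg numbers 2i - j and n + i + 1 -
  2j.\<close>

lemma twisted_mult_sweedler:
  fixes a b :: "nat \<Rightarrow> 'h"
  assumes n: "n \<ge> 1"
  shows "twisted_mult B R n c (pure B (map a [1..<n + 1])) (pure B (map b [1..<n + 1])) =
    sweedler B (map (\<lambda>i. (a i, 2 * i - 1)) [1..<n + 1] @ map (\<lambda>j. (b j, 2 * (n - j) + 1)) [1..<n + 1])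
      (\<lambda>y. tscale
        (\<Prod>(i, j)\<in>{(i, j). 1 \<le> j \<and> j < i \<and> i \<le> n}.
           conv_inverse B 2 (R (c (j, i))) (pure B [y i j, y (n + j) (n + 1 - i)]) *
           R (c (j, i)) (pure B [y i (2 * i - j), y (n + j) (n + i + 1 - 2 * j)]))
        (pure B (map (\<lambda>i. y i i * y (n + i) (n + 1 - i)) [1..<n + 1])))"
    (is "?L = sweedler B ?ps ?F")
proof
  fix f
  have T: "tens n ?L (\<lambda>f. cv Jinv (cv (fmul n f) J) (map a [1..<n + 1] @ map b [1..<n + 1]))"
    by (rule tens_twisted_mult_J[OF tens_pure tens_pure]) simp_all
  show "?L f = sweedler B ?ps ?F f"
  proof (cases "mlin f")
    case False
    then have "sweedler B ?ps ?F f = 0" by (intro sweedler_eq_0) (auto simp: tscale_def pure_def)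
    then show ?thesis using tens_apply_non_mlin[OF T False] by simp
  next
    case True
    let ?N = "2 * n" and ?hs = "map a [1..<n + 1] @ map b [1..<n + 1]"
    define ops where "ops = pair_ops ri (rev (rows n)) @ [(\<lambda>_. True, fmul n f)] @ pair_ops r (rows n)"
    have M: "fmul n f \<in> fnl ?N" using True by (simp add: fmul_fnl)
    have rows: "set (rows n) \<subseteq> pairs" by (rule set_rows) simp
    have fnl: "set (map Y (rev (rows n))) \<subseteq> fnl ?N" "set (map X (rows n)) \<subseteq> fnl ?N"
      using rows X_inverse(1,2) by auto
    have "?L f = cv Jinv (cv (fmul n f) J) ?hs" using tens_apply[OF T True] .
    also have "cv Jinv (cv (fmul n f) J) = cprod ?N (map Y (rev (rows n)) @ fmul n f # map X (rows n))"
      unfolding Jinv_eq[OF set_rows[OF order_refl] J_eq[symmetric]] J_eq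
      using fnl M cprod_append[OF fnl(1), of "fmul n f # map X (rows n)"] by simp
    also have "map Y (rev (rows n)) @ fmul n f # map X (rows n) = map (res ?N) (map (case_prod opf) ops)"
    proof -
      have "fmul n f = res ?N (opf (\<lambda>_. True) (fmul n f))"
        by (auto simp: opf_True[abs_def] res_def fmul_def)
      moreover have "map Y es = map (res ?N) (map (case_prod opf) (pair_ops ri es))"
        "map X es = map (res ?N) (map (case_prod opf) (pair_ops r es))" for es
        by (simp_all add: pair_ops_def X_def Y_def pairop_def)
      ultimately show ?thesis unfolding ops_def by simp
    qed
    also have "cprod ?N (map (res ?N) (map (case_prod opf) ops)) ?hs = foldr cv (map (case_prod opf) ops) eps ?hs"
      unfolding cprod_res by (rule res_apply) simp
    also have "foldr cv (map (case_prod opf) ops) eps ?hs = sweedler B ?ps ?F f"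
    proof (rule sweedler_ops[symmetric])
      have "op_ok ?N (pair_ops g es)" if "set es \<subseteq> pairs" "\<And>e. e \<in> pairs \<Longrightarrow> g e \<in> fnl 2" for g es
      proof -
        have "ml (length (idx (\<lambda>p. p = i - 1 \<or> p = n + j - 1) ?N)) (g (i, j))" if "(i, j) \<in> set es" for i j
        proof -
          have e: "(i, j) \<in> pairs" using that \<open>set es \<subseteq> pairs\<close> by auto
          show ?thesis unfolding idx_pairs[OF e] using fnl_ml[OF \<open>\<And>e. e \<in> pairs \<Longrightarrow> g e \<in> fnl 2\<close>[OF e]]
            by (simp add: numeral_2_eq_2)
        qed
        then show ?thesis by (auto simp: op_ok_def pair_ops_def)
      qed
      then have "op_ok ?N (pair_ops ri (rev (rows n)))" "op_ok ?N (pair_ops r (rows n))"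
        using rows r_inverse(1,2) by auto
      moreover have "idx (\<lambda>_. True) ?N = [0..<?N]" by (simp add: idx_def)
      ultimately show "op_ok ?N ops" using fnl_ml[OF M] by (auto simp: op_ok_def ops_def)
    next
      have count: "op_count ops (k - 1) = 2 * k - 1" "op_count ops (n + k - 1) = 2 * (n - k) + 1"
        if "1 \<le> k" "k \<le> n" for k
        using that op_count_rows[of n k r] by (simp_all add: ops_def op_count_rev[of ri "rows n" _ r])
      show "length ?hs = ?N" by simp
      show "0 < op_count ops p" if "p < ?N" for p by (simp add: ops_def)
      show "?ps = map (\<lambda>p. (?hs ! p, op_count ops p)) [0..<?N]"
      proof (rule nth_equalityI)
        fix p assume "p < length ?ps"
        then have p: "p < ?N" by (simp del: upt_Suc)
        show "?ps ! p = map (\<lambda>p. (?hs ! p, op_count ops p)) [0..<?N] ! p"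
        proof (cases "p < n")
          case True
          then show ?thesis using count(1)[of "Suc p"] p by (simp add: nth_append del: upt_Suc)
        next
          case False
          define k where "k = Suc (p - n)"
          have k: "1 \<le> k" "k \<le> n" "n + k - 1 = p" "p - n = k - 1" using p False by (auto simp: k_def)
          moreover have "[1..<n + 1] ! (k - 1) = k" using nth_upt[of 1 "k - 1" "n + 1"] k by simp
          ultimately show ?thesis using count(2)[OF k(1,2)] p False by (simp add: nth_append del: upt_Suc)
        qed
      qed simp
    next
      fix y :: "nat \<Rightarrow> nat \<Rightarrow> 'h"
      let ?y = "\<lambda>p s. y (Suc p) (Suc s)"
      let ?off = "op_count (pair_ops ri (rev (rows n)))"
      have off: "?off (k - 1) = k - 1" "?off (n + k - 1) = n - k" if "1 \<le> k" "k \<le> n" for k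
        using that op_count_rows[of n k r] by (simp_all add: op_count_rev[of ri "rows n" _ r])
      have "op_eval ?N (pair_ops ri (rev (rows n))) (\<lambda>_. 0) ?y =
          (\<Prod>(i, j)\<in>pairs. ri (i, j) [y i j, y (n + j) (n + 1 - i)])"
        unfolding op_eval_rev_rows[OF order_refl] pairs_Sigma prod.Sigma[OF finite_atLeastAtMost ballI[OF finite_atLeastAtMost], symmetric]
        by (intro prod.cong refl) (auto simp: Suc_diff_le)
      moreover have "op_eval ?N (pair_ops r (rows n)) (\<lambda>p. Suc (?off p)) ?y =
          (\<Prod>(i, j)\<in>pairs. r (i, j) [y i (2 * i - j), y (n + j) (n + i + 1 - 2 * j)])"
        unfolding op_eval_rows[OF order_refl] pairs_Sigma prod.Sigma[OF finite_atLeastAtMost ballI[OF finite_atLeastAtMost], symmetric]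
      proof (intro prod.cong refl)
        fix i j assume ij: "i \<in> {2..n}" "j \<in> {1..i - 1}"
        have "Suc (i - 1) = i" "Suc (Suc (?off (i - 1)) + (i - 1 - j)) = 2 * i - j"
          "Suc (n + j - 1) = n + j" "Suc (Suc (?off (n + j - 1)) + (i - 1 - j)) = n + i + 1 - 2 * j"
          using ij off(1)[of i] off(2)[of j] by auto
        then show "r (i, j) [?y (i - 1) (Suc (?off (i - 1)) + (i - 1 - j)),
            ?y (n + j - 1) (Suc (?off (n + j - 1)) + (i - 1 - j))] =
          r (i, j) [y i (2 * i - j), y (n + j) (n + i + 1 - 2 * j)]" by (simp only:)
      qed
      moreover have "fmul n f (map (\<lambda>p. ?y p (?off p)) (idx (\<lambda>_. True) ?N)) =
          f (map (\<lambda>i. y i i * y (n + i) (n + 1 - i)) [1..<n + 1])"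
      proof -
        have "map2 (*) (take n (map (\<lambda>p. ?y p (?off p)) [0..<?N])) (drop n (map (\<lambda>p. ?y p (?off p)) [0..<?N])) =
            map (\<lambda>i. y i i * y (n + i) (n + 1 - i)) [1..<n + 1]"
        proof (rule nth_equalityI)
          fix k assume "k < length (map2 (*) (take n (map (\<lambda>p. ?y p (?off p)) [0..<?N]))
            (drop n (map (\<lambda>p. ?y p (?off p)) [0..<?N])))"
          then have "k < n" by simp
          then show "map2 (*) (take n (map (\<lambda>p. ?y p (?off p)) [0..<?N])) (drop n (map (\<lambda>p. ?y p (?off p)) [0..<?N])) ! k =
            map (\<lambda>i. y i i * y (n + i) (n + 1 - i)) [1..<n + 1] ! k"
            using off[of "Suc k"] by (simp add: Suc_diff_Suc del: upt_Suc)
        qed simp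
        then show ?thesis by (simp add: fmul_def res_apply idx_def)
      qed
      ultimately have "op_eval ?N ops (\<lambda>_. 0) ?y =
          (\<Prod>(i, j)\<in>pairs. ri (i, j) [y i j, y (n + j) (n + 1 - i)]) *
          (f (map (\<lambda>i. y i i * y (n + i) (n + 1 - i)) [1..<n + 1]) *
          (\<Prod>(i, j)\<in>pairs. r (i, j) [y i (2 * i - j), y (n + j) (n + i + 1 - 2 * j)]))"
        unfolding ops_def by (simp add: op_eval_append)
      also have "\<dots> = (\<Prod>e\<in>pairs. (case e of (i, j) \<Rightarrow> ri (i, j) [y i j, y (n + j) (n + 1 - i)]) *
          (case e of (i, j) \<Rightarrow> r (i, j) [y i (2 * i - j), y (n + j) (n + i + 1 - 2 * j)])) *
          f (map (\<lambda>i. y i i * y (n + i) (n + 1 - i)) [1..<n + 1])"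
        unfolding prod.distrib by (simp only: mult_ac)
      also have "\<dots> = ?F y f"
        using True unfolding pairs_def[symmetric]
        by (simp add: tscale_def pure_def ri_def r_def dual_def res_def case_prod_beta)
      finally show "?F y f = op_eval ?N ops (\<lambda>_. 0) (\<lambda>p s. y (Suc p) (Suc s))" ..
    qed
    finally show ?thesis .
  qed
qed

section \<open>The counital case\<close>

definition template :: "nat \<Rightarrow> nat \<Rightarrow> nat \<Rightarrow> 'h list \<Rightarrow> 'h list" where
  "template p m s w = replicate p 1 @ w ! 0 # replicate m 1 @ w ! 1 # replicate s 1"

lemma length_template [simp]: "length (template p m s w) = p + m + s + 2"
  by (simp add: template_def)

lemma nth_template:
  "x < p + m + s + 2 \<Longrightarrow>
     template p m s w ! x = (if x = p then w ! 0 else if x = p + m + 1 then w ! 1 else 1)"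
  by (auto simp: template_def nth_append nth_Cons')

text \<open>1 is group-like, so each letter 1 passes unchanged to both functionals.\<close>

lemma cv_replicate_one:
  "ml (length (replicate p 1 @ hs)) F \<Longrightarrow> ml (length (replicate p 1 @ hs)) G \<Longrightarrow>
     cv F G (replicate p 1 @ hs) = cv (\<lambda>w. F (replicate p 1 @ w)) (\<lambda>w. G (replicate p 1 @ w)) hs"
proof (induction p arbitrary: F G)
  case (Suc p)
  let ?hs = "replicate p 1 @ hs"
  have m: "ml (length ?hs) (\<lambda>w. F (x # w))" "ml (length ?hs) (\<lambda>w. G (x # w))"
    "length w = length ?hs \<Longrightarrow> lin (\<lambda>x. F (x # w))" "length w = length ?hs \<Longrightarrow> lin (\<lambda>x. G (x # w))" for x w
    using Suc.prems by (simp_all add: ml_Suc)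
  have "cv F G (1 # ?hs) = cv (\<lambda>w. F (1 # w)) (\<lambda>w. G (1 # w)) ?hs"
    unfolding cv_Cons by (rule csum_one) (intro lin_cv_left lin_cv_right m(3,4); assumption)+
  also have "\<dots> = cv (\<lambda>w. F (1 # replicate p 1 @ w)) (\<lambda>w. G (1 # replicate p 1 @ w)) hs"
    by (rule Suc.IH[OF m(1,2)])
  finally show ?case by simp
qed simp

text \<open>Filling a word of 1s with two letters is a coalgebra map from H \<otimes> H; this makes
  \<open>rho\<close> multiplicative.\<close>

lemma cv_template:
  assumes F: "mlin F" and G: "mlin G"
  shows "cv F G (template p m s [h, h']) =
    cv (\<lambda>w. F (template p m s w)) (\<lambda>w. G (template p m s w)) [h, h']"
proof -
  have m: "mlin (\<lambda>w. F (xs @ w))" "mlin (\<lambda>w. G (xs @ w))" for xs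
    using F G by (simp_all add: multilinear_append)
  have m1: "mlin (\<lambda>w. F (xs @ x # w))" "mlin (\<lambda>w. G (xs @ x # w))" for xs x
    using m[of "xs @ [x]"] by simp_all
  have m2: "mlin (\<lambda>w. F (xs @ x # ys @ w))" "mlin (\<lambda>w. G (xs @ x # ys @ w))" for xs x ys
    using m[of "xs @ [x] @ ys"] by simp_all
  have m3: "mlin (\<lambda>w. F (xs @ x # ys @ y # w))" "mlin (\<lambda>w. G (xs @ x # ys @ y # w))" for xs x ys y
    using m[of "xs @ [x] @ ys @ [y]"] by simp_all
  have c: "cv f g (replicate p 1 @ hs) = cv (\<lambda>w. f (replicate p 1 @ w)) (\<lambda>w. g (replicate p 1 @ w)) hs"
    if "mlin f" "mlin g" for f g p hs
    using that by (intro cv_replicate_one) simp_all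
  have c0: "cv f g (replicate s 1) = f (replicate s 1) * g (replicate s 1)" if "mlin f" "mlin g" for f g
    using c[OF that, of s "[]"] by simp
  show ?thesis
    unfolding template_def c[OF F G] cv_Cons list.inject nth_Cons_0 One_nat_def nth_Cons_Suc
    by (simp add: c c0 m1 m2 m3 cv_Cons)
qed

text \<open>Restriction to h in position l of the first tensor and h' in position k of the second.
  The middle gap holds the \<open>n - l\<close> letters 1 after h and the \<open>k - 1\<close>
  letters 1 before h'.\<close>

definition rho :: "nat \<Rightarrow> nat \<Rightarrow> ('h list \<Rightarrow> 'k) \<Rightarrow> 'h list \<Rightarrow> 'k" where
  "rho l k F = res 2 (\<lambda>w. F (template (l - 1) (n - l + (k - 1)) (n - k) w))"

lemma rho_fnl: "F \<in> fnl (2 * n) \<Longrightarrow> rho l k F \<in> fnl 2"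
proof -
  assume "F \<in> fnl (2 * n)"
  note F = fnl_mlin[OF this]
  have 1: "lin (\<lambda>x. F (xs @ x # ys))" for xs ys
    using F[rule_format, of "length (xs @ 0 # ys)", unfolded ml_iff_lin, rule_format, of "xs @ 0 # ys" "length xs"] by simp
  have 2: "lin (\<lambda>x. F (xs @ x # ys @ y # zs))" "lin (\<lambda>y. F (xs @ x # ys @ y # zs))" for xs x ys y zs
    using 1[of xs "ys @ y # zs"] 1[of "xs @ x # ys" zs] by simp_all
  show ?thesis unfolding rho_def
    by (rule res_fnl) (simp add: numeral_2_eq_2 ml_Suc ml_0 template_def 2)
qed

lemma rho_cv:
  assumes "F \<in> fnl (2 * n)" "G \<in> fnl (2 * n)"
  shows "rho l k (cv F G) = cv (rho l k F) (rho l k G)"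
proof
  fix w :: "'h list"
  show "rho l k (cv F G) w = cv (rho l k F) (rho l k G) w"
  proof (cases "length w = 2")
    case True
    then have w: "w = [w ! 0, w ! 1]" by (simp add: length_2_conv)
    show ?thesis
      unfolding rho_def res_cv by (subst (1 2) w) (simp only: res_apply list.size cv_template[OF fnl_mlin[OF assms(1)] fnl_mlin[OF assms(2)]])
  next
    case False
    then show ?thesis unfolding rho_def res_cv by (simp add: res_def)
  qed
qed

lemma rho_un:
  assumes "l \<in> {1..n}" "k \<in> {1..n}"
  shows "rho l k (un (2 * n)) = un 2"
proof
  fix w :: "'h list"
  have e: "eps (replicate p 1) = 1" for p by (induction p) (simp_all add: counit_one)
  show "rho l k (un (2 * n)) w = un 2 w"
  proof (cases "length w = 2")
    case True
    then have w: "w = [w ! 0, w ! 1]" by (simp add: length_2_conv)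
    have "length (template (l - 1) (n - l + (k - 1)) (n - k) w) = 2 * n" using assms by auto
    then have "un (2 * n) (template (l - 1) (n - l + (k - 1)) (n - k) w) =
        eps (template (l - 1) (n - l + (k - 1)) (n - k) w)" by (simp only: un_def res_apply)
    also have "\<dots> = counit B (w ! 0) * counit B (w ! 1)" by (simp add: template_def e)
    finally have "un (2 * n) (template (l - 1) (n - l + (k - 1)) (n - k) w) = counit B (w ! 0) * counit B (w ! 1)" .
    moreover have "un 2 w = counit B (w ! 0) * counit B (w ! 1)"
      by (subst w) (simp add: un_def res_def)
    ultimately show ?thesis using True by (simp add: rho_def res_apply)
  qed (simp add: rho_def un_def res_def)
qed

lemma rho_cprod:
  assumes "l \<in> {1..n}" "k \<in> {1..n}" "set Fs \<subseteq> fnl (2 * n)"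
  shows "rho l k (cprod (2 * n) Fs) = cprod 2 (map (rho l k) Fs)"
  using assms(3)
proof (induction Fs)
  case (Cons F Fs)
  then have "F \<in> fnl (2 * n)" "cprod (2 * n) Fs \<in> fnl (2 * n)" by (auto intro: cprod_fnl)
  then show ?case using Cons by (simp add: rho_cv)
qed (simp only: rho_un[OF assms(1,2)] cprod_Nil list.map)

text \<open>Unless R receives both letters, one of its arguments is 1 and counitality turns it into
  a counit. A letter that R does not see meets a counit of \<open>pairop\<close>, and the 1s
  elsewhere contribute 1.\<close>

lemma rho_X:
  assumes lk: "l \<in> {1..n}" "k \<in> {1..n}" and e: "(i, j) \<in> pairs" and cu: "counital B (R (c (j, i)))"
  shows "rho l k (X (i, j)) = (if (i, j) = (l, k) then r (i, j) else un 2)"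
proof
  fix w :: "'h list"
  show "rho l k (X (i, j)) w = (if (i, j) = (l, k) then r (i, j) else un 2) w"
  proof (cases "length w = 2")
    case True
    then have w: "w = [w ! 0, w ! 1]" by (simp add: length_2_conv)
    have ij: "1 \<le> j" "j < i" "i \<le> n" using e by (auto simp: pairs_def)
    let ?t = "template (l - 1) (n - l + (k - 1)) (n - k) w"
    let ?P = "\<lambda>x. x = i - 1 \<or> x = n + j - 1"
    have len: "length ?t = 2 * n" using lk by auto
    have t: "?t ! x = (if x = l - 1 then w ! 0 else if x = n + k - 1 then w ! 1 else 1)" if "x < 2 * n" for x
      using nth_template[of x "l - 1" "n - l + (k - 1)" "n - k" w] that lk by auto
    have "rho l k (X (i, j)) w = r (i, j) [?t ! (i - 1), ?t ! (n + j - 1)] *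
        prod_list (map (\<lambda>x. counit B (?t ! x)) (idx (\<lambda>x. \<not> ?P x) (2 * n)))"
      using True by (simp only: rho_def X_def pairop_def fst_conv snd_conv res_apply len opf_apply idx_pairs[OF e] list.map)
    also have "prod_list (map (\<lambda>x. counit B (?t ! x)) (idx (\<lambda>x. \<not> ?P x) (2 * n))) =
        (\<Prod>x\<in>{x. x < 2 * n \<and> \<not> ?P x}. counit B (?t ! x))"
      unfolding prod.distinct_set_conv_list[OF distinct_idx, symmetric] set_idx ..
    also have "\<dots> = (\<Prod>x\<in>{l - 1, n + k - 1} - {i - 1, n + j - 1}. counit B (?t ! x))"
    proof (rule prod.mono_neutral_right)
      show "\<forall>x\<in>{x. x < 2 * n \<and> \<not> ?P x} - ({l - 1, n + k - 1} - {i - 1, n + j - 1}). counit B (?t ! x) = 1"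
      proof
        fix x assume "x \<in> {x. x < 2 * n \<and> \<not> ?P x} - ({l - 1, n + k - 1} - {i - 1, n + j - 1})"
        then have "?t ! x = 1" by (subst t) auto
        then show "counit B (?t ! x) = 1" by (simp only: counit_one)
      qed
    qed (use lk in auto)
    also have "\<dots> = (if i = l then 1 else counit B (w ! 0)) * (if j = k then 1 else counit B (w ! 1))"
    proof -
      have s: "{l - 1, n + k - 1} - {i - 1, n + j - 1} =
          (if i = l then {} else {l - 1}) \<union> (if j = k then {} else {n + k - 1})"
        using lk ij by auto
      have "l - 1 \<noteq> n + k - 1" "l - 1 < 2 * n" "n + k - 1 < 2 * n" using lk by auto
      then show ?thesis unfolding s using t[of "l - 1"] t[of "n + k - 1"] by simp
    qed
    also have "?t ! (i - 1) = (if i = l then w ! 0 else 1)"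
      using t[of "i - 1"] ij lk by auto
    also have "?t ! (n + j - 1) = (if j = k then w ! 1 else 1)"
      using t[of "n + j - 1"] ij lk by auto
    finally have 1: "rho l k (X (i, j)) w =
        r (i, j) [if i = l then w ! 0 else 1, if j = k then w ! 1 else 1] *
        ((if i = l then 1 else counit B (w ! 0)) * (if j = k then 1 else counit B (w ! 1)))" .
    have 2: "r (i, j) [x, 1] = counit B x" "r (i, j) [1, x] = counit B x" for x
      using cu by (simp_all add: r_def dual_apply counital_def)
    have 3: "un 2 w = counit B (w ! 0) * counit B (w ! 1)" by (subst w) (simp add: un_def res_def)
    have 4: "r (i, j) w = r (i, j) [w ! 0, w ! 1]" using arg_cong[OF w] .
    show ?thesis unfolding 1 using 2[of "w ! 0"] 2[of "w ! 1"] 2[of 1] 3 4 by (auto simp: counit_one)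
  next
    case False
    then show ?thesis by (simp add: rho_def r_def dual_def un_def res_def)
  qed
qed

lemma cprod_un: "(\<And>e. e \<in> set es \<Longrightarrow> f e = un N) \<Longrightarrow> cprod N (map f es) = un N"
  by (induction es) (simp_all add: un_fnl)

lemma cprod_single:
  assumes "distinct es" "e \<in> set es" "f e \<in> fnl N" "\<And>e'. e' \<in> set es \<Longrightarrow> e' \<noteq> e \<Longrightarrow> f e' = un N"
  shows "cprod N (map f es) = f e"
proof -
  obtain es1 es2 where es: "es = es1 @ e # es2" "e \<notin> set es1" "e \<notin> set es2"
    using assms(1,2) by (auto dest!: split_list)
  have 1: "cprod N (map f es2) = un N" using assms(4) es by (intro cprod_un) auto
  have "cprod N (map f es1 @ Fs) = cprod N Fs" if "cprod N Fs \<in> fnl N" for Fs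
  proof -
    have "f e' = un N" if "e' \<in> set es1" for e' using assms(4) es that by auto
    then show ?thesis using that by (induction es1) simp_all
  qed
  from this[of "f e # map f es2"] show ?thesis using assms(3) by (simp add: es(1) 1)
qed

lemma distinct_rows: "distinct (rows m)"
proof (induction m)
  case (Suc m)
  show ?case
  proof (cases "m = 0")
    case False
    have "set (rows m) \<inter> set (map (Pair (Suc m)) (rev [1..<Suc m])) = {}" by (auto simp: rows_def)
    then show ?thesis using Suc False by (simp add: rows_Suc distinct_map inj_on_def del: upt_Suc)
  qed (simp add: rows_def)
qed (simp add: rows_def)

lemma mem_rows: "(i, j) \<in> set (rows n) \<longleftrightarrow> (i, j) \<in> pairs"
  by (auto simp: rows_def pairs_def image_iff)

lemma rho_J:
  assumes lk: "l \<in> {1..n}" "k \<in> {1..n}" and cu: "\<And>i j. (i, j) \<in> pairs \<Longrightarrow> counital B (R (c (j, i)))"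
  shows "rho l k J = (if k < l then r (l, k) else un 2)"
proof -
  have rows: "set (map X (rows n)) \<subseteq> fnl (2 * n)" using X_inverse(1) by (auto simp: mem_rows)
  have X: "rho l k (X e) = (if e = (l, k) then r e else un 2)" if "e \<in> set (rows n)" for e
  proof -
    obtain i j where e: "e = (i, j)" by (cases e)
    then have "(i, j) \<in> pairs" using that by (simp add: mem_rows)
    then show ?thesis unfolding e by (intro rho_X[OF lk] cu)
  qed
  have "rho l k J = cprod 2 (map (\<lambda>e. rho l k (X e)) (rows n))"
    unfolding J_eq rho_cprod[OF lk rows] by (simp add: comp_def)
  also have "\<dots> = (if k < l then r (l, k) else un 2)"
  proof (cases "k < l")
    case True
    then have p: "(l, k) \<in> pairs" using lk by (simp add: pairs_def)
    then have "(l, k) \<in> set (rows n)" by (simp add: mem_rows)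
    then have "cprod 2 (map (\<lambda>e. rho l k (X e)) (rows n)) = rho l k (X (l, k))"
      by (intro cprod_single distinct_rows) (simp_all add: X r_inverse p)
    then show ?thesis using True X[OF \<open>(l, k) \<in> set (rows n)\<close>] by simp
  next
    case False
    then have "(l, k) \<notin> set (rows n)" by (simp add: mem_rows pairs_def)
    then have "cprod 2 (map (\<lambda>e. rho l k (X e)) (rows n)) = un 2"
      by (intro cprod_un) (auto simp: X)
    then show ?thesis using False by simp
  qed
  finally show ?thesis .
qed

lemma rho_Jinv:
  assumes lk: "l \<in> {1..n}" "k \<in> {1..n}" and cu: "\<And>i j. (i, j) \<in> pairs \<Longrightarrow> counital B (R (c (j, i)))"
  shows "rho l k Jinv = (if k < l then ri (l, k) else un 2)"
proof (rule cv_inverse_unique)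
  have p: "k < l \<Longrightarrow> (l, k) \<in> pairs" using lk by (simp add: pairs_def)
  show "rho l k J \<in> fnl 2" "rho l k Jinv \<in> fnl 2" using J_fnl Jinv_fnl by (simp_all add: rho_fnl)
  show "(if k < l then ri (l, k) else un 2) \<in> fnl 2" using r_inverse(2)[OF p] by (simp add: un_fnl)
  have "cv (rho l k J) (rho l k Jinv) = rho l k (cv J Jinv)" by (rule rho_cv[OF J_fnl Jinv_fnl, symmetric])
  then show "cv (rho l k J) (rho l k Jinv) = un 2" unfolding Jinv_inverse rho_un[OF lk] .
  show "cv (if k < l then ri (l, k) else un 2) (rho l k J) = un 2"
  proof -
    have "rho l k J = (if k < l then r (l, k) else un 2)" by (rule rho_J[OF lk cu])
    then show ?thesis using r_inverse(4)[OF p] by (simp add: un_fnl)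
  qed
qed

section \<open>Tensors placed in chosen positions\<close>

definition place :: "nat list \<Rightarrow> 'h list \<Rightarrow> 'h list" where
  "place is w = map (\<lambda>p. case map_of (zip is w) p of Some h \<Rightarrow> h | None \<Rightarrow> 1) [1..<n + 1]"

lemma place_update:
  assumes "distinct is" "set is \<subseteq> {1..n}" "length w = length is" "t < length is"
  shows "place is (w[t := x]) = (place is w)[is ! t - 1 := x]"
proof (rule nth_equalityI)
  fix p assume "p < length (place is (w[t := x]))"
  then have p: "p < n" by (simp add: place_def del: upt_Suc)
  have it: "is ! t \<in> {1..n}" using assms(2) nth_mem[OF assms(4)] by blast
  show "place is (w[t := x]) ! p = (place is w)[is ! t - 1 := x] ! p"
  proof (cases "Suc p \<in> set is")
    case True
    then obtain s where s: "s < length is" "is ! s = Suc p" by (auto simp: in_set_conv_nth)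
    have "map_of (zip is v) (Suc p) = Some (v ! s)" if "length v = length is" for v :: "'h list"
      using map_of_zip_nth[of "is" v s] s that assms(1) by simp
    moreover have "s = t \<longleftrightarrow> is ! t - 1 = p"
      using s it assms(1,4) nth_eq_iff_index_eq[of "is" s t] by auto
    ultimately show ?thesis
      using p it assms(3,4) by (auto simp: place_def nth_list_update simp del: upt_Suc)
  next
    case False
    then have None: "map_of (zip is (w[t := x])) (Suc p) = None" "map_of (zip is w) (Suc p) = None"
      using assms(3) by simp_all
    have "is ! t - 1 \<noteq> p" using False it assms(4) nth_mem[of t "is"] by auto
    then show ?thesis using p by (simp add: None place_def del: upt_Suc)
  qed
qed (simp add: place_def del: upt_Suc)

lemma tens_tensor_at:
  assumes x: "tens (length is) x S" and is_pos: "distinct is" "set is \<subseteq> {1..n}"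
  shows "tens n (tensor_at B n is x) (\<lambda>f. S (\<lambda>w. f (place is w)))"
  unfolding tensor_at_def place_def[symmetric]
proof (rule tens_tlift[OF x tens_pure])
  show "length (place is w) = n" for w by (simp add: place_def del: upt_Suc)
next
  fix f assume f: "mlin f"
  show "ml (length is) (\<lambda>w. f (place is w))"
    unfolding ml_iff_lin
  proof (intro allI impI)
    fix w :: "'h list" and t assume *: "length w = length is" "t < length is"
    then have "is ! t \<in> {1..n}" using is_pos(2) nth_mem[of t "is"] by blast
    then have "is ! t - 1 < n" by auto
    moreover have "length (place is w) = n" by (simp add: place_def del: upt_Suc)
    ultimately have "lin (\<lambda>x. f ((place is w)[is ! t - 1 := x]))" using f by (simp add: ml_iff_lin)
    then show "lin (\<lambda>x. f (place is (w[t := x])))" using * is_pos by (simp add: place_update)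
  qed
qed

text \<open>In each position at least one of the two factors is 1, except when k = l, where the
  letters meet in the order h h'.\<close>

lemma map2_template:
  assumes lk: "l \<in> {1..n}" "k \<in> {1..n}" and t_def: "t = template (l - 1) (n - l + (k - 1)) (n - k) w"
  shows "map2 (*) (take n t) (drop n t) =
    (if k = l then place [k] [w ! 0 * w ! 1] else place [l, k] [w ! 0, w ! 1])" (is "_ = ?R")
proof (rule nth_equalityI)
  have len: "length t = 2 * n" using lk unfolding t_def length_template by auto
  have lenR: "length ?R = n" by (simp add: place_def del: upt_Suc)
  show "length (map2 (*) (take n t) (drop n t)) = length ?R" unfolding lenR using len by simp
  fix x assume "x < length (map2 (*) (take n t) (drop n t))"
  then have x: "x < n" using len by simp
  have t: "t ! x = (if x = l - 1 then w ! 0 else if x = n + k - 1 then w ! 1 else 1)" if "x < 2 * n" for x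
    unfolding t_def using that lk by (subst nth_template) auto
  have "map2 (*) (take n t) (drop n t) ! x = t ! x * t ! (n + x)" using x len by simp
  also have "\<dots> = (if x = l - 1 then w ! 0 else 1) * (if x = k - 1 then w ! 1 else 1)"
  proof -
    have "x \<noteq> n + k - 1" "n + x \<noteq> l - 1" "n + x = n + k - 1 \<longleftrightarrow> x = k - 1" using x lk by auto
    then show ?thesis using t[of x] t[of "n + x"] x by simp
  qed
  also have "\<dots> = ?R ! x"
  proof -
    have "[1..<n + 1] ! x = Suc x" "Suc x = l \<longleftrightarrow> x = l - 1" "Suc x = k \<longleftrightarrow> x = k - 1" "k - 1 = l - 1 \<longleftrightarrow> k = l"
      using x lk nth_upt[of 1 x "n + 1"] by auto
    then show ?thesis using x by (simp add: place_def del: upt_Suc)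
  qed
  finally show "map2 (*) (take n t) (drop n t) ! x = ?R ! x" .
qed

text \<open>\<open>rho\<close> reduces the triple convolution to two letters. For k \<ge> l the
  outer factors are units and only the product remains; for k < l one pair of factors survives, and
  the result is the formula for \<open>Psi\<close>.\<close>

lemma twisted_mult_counital:
  assumes k: "k \<in> {1..n}" and l: "l \<in> {1..n}" and cu: "\<And>i j. (i, j) \<in> pairs \<Longrightarrow> counital B (R (c (j, i)))"
  shows "twisted_mult B R n c
      (pure B (replicate (l - 1) 1 @ [h] @ replicate (n - l) 1))
      (pure B (replicate (k - 1) 1 @ [h'] @ replicate (n - k) 1)) =
    (if k = l then tensor_at B n [k] (pure B [h * h'])
     else if k > l then tensor_at B n [l, k] (pure B [h, h'])
     else tensor_at B n [k, l] (Psi B (R (c (k, l))) (pure B [h, h'])))" (is "?L = ?R")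
proof -
  let ?t = "template (l - 1) (n - l + (k - 1)) (n - k)"
  have t: "(replicate (l - 1) 1 @ [h] @ replicate (n - l) 1) @ (replicate (k - 1) 1 @ [h'] @ replicate (n - k) 1) =
      ?t [h, h']"
    by (simp add: template_def replicate_add)
  have "tens n ?L (\<lambda>f. cv Jinv (cv (fmul n f) J)
      ((replicate (l - 1) 1 @ [h] @ replicate (n - l) 1) @ (replicate (k - 1) 1 @ [h'] @ replicate (n - k) 1)))"
    using k l by (intro tens_twisted_mult_J tens_pure) auto
  then have T: "tens n ?L (\<lambda>f. cv Jinv (cv (fmul n f) J) (?t [h, h']))" unfolding t .
  have L: "cv Jinv (cv (fmul n f) J) (?t [h, h']) =
      cv (if k < l then ri (l, k) else un 2) (cv (rho l k (fmul n f)) (if k < l then r (l, k) else un 2)) [h, h']"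
    if "mlin f" for f
  proof -
    have M: "fmul n f \<in> fnl (2 * n)" using that by (simp add: fmul_fnl)
    have "cv Jinv (cv (fmul n f) J) (?t [h, h']) = rho l k (cv Jinv (cv (fmul n f) J)) [h, h']"
      by (simp add: rho_def res_apply)
    also have "\<dots> = cv (rho l k Jinv) (cv (rho l k (fmul n f)) (rho l k J)) [h, h']"
      using M J_fnl Jinv_fnl by (simp add: rho_cv cv_fnl)
    finally show ?thesis by (simp only: rho_J[OF l k cu] rho_Jinv[OF l k cu])
  qed
  have rhoM: "rho l k (fmul n f) = res 2 (\<lambda>w. f (if k = l then place [k] [w ! 0 * w ! 1] else place [l, k] [w ! 0, w ! 1]))" for f
    
  proof
    fix w :: "'h list"
    have "length (?t w) = 2 * n" using k l unfolding length_template by auto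
    then show "rho l k (fmul n f) w =
        res 2 (\<lambda>w. f (if k = l then place [k] [w ! 0 * w ! 1] else place [l, k] [w ! 0, w ! 1])) w"
      unfolding rho_def fmul_def res_def map2_template[OF l k refl] by (simp only: simp_thms if_True)
  qed
  have rhoM_fnl: "mlin f \<Longrightarrow> rho l k (fmul n f) \<in> fnl 2" for f by (simp add: rho_fnl fmul_fnl)
  consider "k = l" | "k > l" | "k < l" by linarith
  then show ?thesis
  proof cases
    case 1
    have R: "tens n (tensor_at B n [k] (pure B [h * h'])) (\<lambda>f. f (place [k] [h * h']))"
      using k by (intro tens_tensor_at tens_pure) auto
    have "?L = tensor_at B n [k] (pure B [h * h'])"
    proof (rule tens_eqI[OF T R])
      fix f assume f: "mlin f"
      show "cv Jinv (cv (fmul n f) J) (?t [h, h']) = f (place [k] [h * h'])"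
        using L[OF f] 1 rhoM_fnl[OF f] rhoM[of f] by (simp add: res_apply)
    qed
    then show ?thesis using 1 by simp
  next
    case 2
    have R: "tens n (tensor_at B n [l, k] (pure B [h, h'])) (\<lambda>f. f (place [l, k] [h, h']))"
      using k l 2 by (intro tens_tensor_at tens_pure) auto
    have "?L = tensor_at B n [l, k] (pure B [h, h'])"
    proof (rule tens_eqI[OF T R])
      fix f assume f: "mlin f"
      show "cv Jinv (cv (fmul n f) J) (?t [h, h']) = f (place [l, k] [h, h'])"
        using L[OF f] 2 rhoM_fnl[OF f] rhoM[of f] by (simp add: res_apply)
    qed
    then show ?thesis using 2 by simp
  next
    case 3
    then have p: "(l, k) \<in> pairs" using k l by (simp add: pairs_def)
    note rr = r_inverse(1,2)[OF p, unfolded r_def ri_def fst_conv snd_conv]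
    have P: "tens (length [k, l]) (Psi B (R (c (k, l))) (pure B [h, h']))
        (\<lambda>f. cv (ri (l, k)) (cv (res 2 (\<lambda>w. f (swap_at 0 w))) (r (l, k))) [h, h'])"
      using Psi_dual[OF rr, of h h'] by (simp add: r_def ri_def numeral_2_eq_2)
    have R: "tens n (tensor_at B n [k, l] (Psi B (R (c (k, l))) (pure B [h, h'])))
        (\<lambda>f. cv (ri (l, k)) (cv (res 2 (\<lambda>w. f (place [k, l] (swap_at 0 w)))) (r (l, k))) [h, h'])"
      using k l 3 by (intro tens_tensor_at[OF P]) auto
    have "?L = tensor_at B n [k, l] (Psi B (R (c (k, l))) (pure B [h, h']))"
    proof (rule tens_eqI[OF T R])
      fix f assume f: "mlin f"
      \<comment> \<open>The exchange in \<open>Psi\<close> is absorbed by listing the positions in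
        the opposite order.\<close>
      have "place [l, k] [w ! 0, w ! 1] = place [k, l] (swap_at 0 w)" if "length w = 2" for w :: "'h list"
        using 3 that unfolding place_def by (intro map_cong) (auto simp: swap_at_def)
      then have "rho l k (fmul n f) = res 2 (\<lambda>w. f (place [k, l] (swap_at 0 w)))"
        unfolding rhoM using 3 by (auto simp: res_def)
      then show "cv Jinv (cv (fmul n f) J) (?t [h, h']) =
          cv (ri (l, k)) (cv (res 2 (\<lambda>w. f (place [k, l] (swap_at 0 w)))) (r (l, k))) [h, h']"
        using L[OF f] 3 by simp
    qed
    then show ?thesis using 3 by simp
  qed
qed

end

theorem proposition5p12:
  fixes B :: "('k::field_char_0, 'h::ring_1) bialgebra_data"
    and C :: "'c set"
    and R :: "'c \<Rightarrow> ('k, 'h) tensor \<Rightarrow> 'k"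
    and n :: nat
    and c :: "nat \<times> nat \<Rightarrow> 'c"
  assumes "bialgebra B"
    and "\<And>d. d \<in> C \<Longrightarrow> co_quasi_triangular B (R d)"
    and "n > 1"
    and "c \<in> {(i, j). 1 \<le> i \<and> i < j \<and> j \<le> n} \<rightarrow> C"
    and "transitive_colouring n c"
  shows "(\<forall>x\<in>tensor_power B n. \<forall>x'\<in>tensor_power B n.
           twisted_mult B R n c x x' =
             mult_power B n
               (foldr (\<circ>)
                  [amplify B (i + j - 2) 2 (Psi B (R (c (i, j)))) (2 * n - i - j).
                     i \<leftarrow> rev [1..<n], j \<leftarrow> [i + 1..<n + 1]]
                  id (tprod B x x'))) \<and>
         (\<forall>a b :: nat \<Rightarrow> 'h.
           twisted_mult B R n c (pure B (map a [1..<n + 1])) (pure B (map b [1..<n + 1])) =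
             sweedler B
               (map (\<lambda>i. (a i, 2 * i - 1)) [1..<n + 1] @ map (\<lambda>j. (b j, 2 * (n - j) + 1)) [1..<n + 1])
               (\<lambda>y. tscale
                 (\<Prod>(i, j)\<in>{(i, j). 1 \<le> j \<and> j < i \<and> i \<le> n}.
                    conv_inverse B 2 (R (c (j, i))) (pure B [y i j, y (n + j) (n + 1 - i)]) *
                    R (c (j, i)) (pure B [y i (2 * i - j), y (n + j) (n + i + 1 - 2 * j)]))
                 (pure B (map (\<lambda>i. y i i * y (n + i) (n + 1 - i)) [1..<n + 1])))) \<and>
         ((\<forall>d\<in>C. counital B (R d)) \<longrightarrow>
           (\<forall>h h'. \<forall>k\<in>{1..n}. \<forall>l\<in>{1..n}.
             twisted_mult B R n c
               (pure B (replicate (l - 1) 1 @ [h] @ replicate (n - l) 1))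
               (pure B (replicate (k - 1) 1 @ [h'] @ replicate (n - k) 1)) =
             (if k = l then tensor_at B n [k] (pure B [h * h'])
              else if k > l then tensor_at B n [l, k] (pure B [h, h'])
              else tensor_at B n [k, l] (Psi B (R (c (k, l))) (pure B [h, h'])))))"
proof -
  interpret bialgebra B by fact
  have R: "linear_on_power B 2 (*) (R (c (j, i)))" "\<exists>g. is_conv_inverse B 2 (R (c (j, i))) g"
    and C: "c (j, i) \<in> C" if "1 \<le> j" "j < i" "i \<le> n" for i j
  proof -
    show "c (j, i) \<in> C" using assms(4) that by auto
    from assms(2)[OF this] show "linear_on_power B 2 (*) (R (c (j, i)))"
      "\<exists>g. is_conv_inverse B 2 (R (c (j, i))) g" by (simp_all add: co_quasi_triangular_def)
  qed
  interpret twist B R n c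
    by unfold_locales ((rule dual_fnl, rule R(1) | rule R(2)); assumption)+
  have n: "n \<ge> 1" using assms(3) by simp
  show ?thesis
  proof (intro conjI impI ballI allI)
    fix h h' k l assume "\<forall>d\<in>C. counital B (R d)" and kl: "k \<in> {1..n}" "l \<in> {1..n}"
    then have "counital B (R (c (j, i)))" if "(i, j) \<in> pairs" for i j
      using that C by (auto simp: pairs_def)
    from twisted_mult_counital[OF kl this]
    show "twisted_mult B R n c
         (pure B (replicate (l - 1) 1 @ [h] @ replicate (n - l) 1))
         (pure B (replicate (k - 1) 1 @ [h'] @ replicate (n - k) 1)) =
       (if k = l then tensor_at B n [k] (pure B [h * h'])
        else if k > l then tensor_at B n [l, k] (pure B [h, h'])
        else tensor_at B n [k, l] (Psi B (R (c (k, l))) (pure B [h, h'])))" .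
  qed (rule twisted_mult_eq_Psi[OF n] twisted_mult_sweedler[OF n]; assumption)+
qed

end
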